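(* Let $\varphi_0,\varphi_1\in\mathcal G$ with $\mathrm{char}(\varphi_0)=\mathrm{char}(\varphi_1)=0$. Assume that there exists $C>0$ such that, on $\mathbb C_+$, $$|\varphi_0-\varphi_1|\le C\,m,\qquad m:=\min\left(\frac{\mathrm{Re}\,\varphi_0-1/2}{|1+\varphi_0|^2},\frac{\mathrm{Re}\,\varphi_1-1/2}{|1+\varphi_1|^2}\right).$$ Then $C_{\varphi_0}$ and $C_{\varphi_1}$ belong to the same connected component of $\mathcal C(\mathcal H)$. If, moreover, $|\varphi_0-\varphi_1|=o(m)$ as $m$ tends to zero, then $C_{\varphi_0}-C_{\varphi_1}$ is compact on $\mathcal H$.
   Context: For $\theta\in\mathbb R$, $\mathbb C_\theta=\{s\in\mathbb C:\ \mathrm{Re}\, s>\theta\}$, $\mathbb C_+=\mathbb C_0$. $\mathcal H$ is the Hilbert space of Dirichlet series $f(s)=\sum_{n\ge1}a_nn^{-s}$ with $\|f\|^2=\sum_n|a_n|^2<\infty$; its elements are analytic on $\mathbb C_{1/2}$. The Gordon-Hedenmalm class $\mathcal G$ is the set of maps $\varphi:\mathbb C_{1/2}\to\mathbb C_{1/2}$ of the form $\varphi(s)=c_0s+\psi(s)$, where $c_0=:\mathrm{char}(\varphi)$ is a non-negative integer (the characteristic of $\varphi$) and $\psi(s)=\sum_{n\ge1}c_nn^{-s}$ converges uniformly in $\mathbb C_\varepsilon$ for every $\varepsilon>0$ and satisfies: (a) if $c_0=0$, then $\psi(\mathbb C_0)\subseteq\mathbb C_{1/2}$; (b) if $c_0\ge1$,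 then either $\psi\equiv c_1$ with $\mathrm{Re}\,c_1\ge0$ or $\psi(\mathbb C_0)\subseteq\mathbb C_0$. Such $\varphi$ is regarded as an analytic function on $\mathbb C_+$ by the same formula. These are exactly the symbols for which $C_\varphi f=f\circ\varphi$ defines a bounded operator on $\mathcal H$. $\mathcal C(\mathcal H)=\{C_\varphi:\ \varphi\in\mathcal G\}$ carries the operator norm topology. The asymptotic condition means: for every $\varepsilon>0$ there is $\theta>0$ such that for all $s\in\mathbb C_+$ with $m(s)<\theta$ one has $|\varphi_0(s)-\varphi_1(s)|\le\varepsilon\, m(s)$. *)

theory Defs
  imports "HOL-Analysis.Analysis"
begin

definition half_plane :: "real \<Rightarrow> complex set"  where
  "half_plane \<theta> = {s. Re s > \<theta>}"

text \<open>
  Coefficient sequences are indexed as in the mathematics, by \<open>n \<ge> 1\<close>. The value at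
  index \<open>0\<close> is irrelevant below, because \<open>0 powr z = 0\<close>.
\<close>

definition dirichlet_series :: "(nat \<Rightarrow> complex) \<Rightarrow> complex \<Rightarrow> complex" where
  "dirichlet_series c s = (\<Sum>n. c n * of_nat n powr (- s))"


section \<open>The Hilbert space of Dirichlet series with square summable coefficients\<close>

text \<open>
  An element is represented by its coefficient sequence, normalised to be \<open>0\<close> at the unused
  index \<open>0\<close>; its value at a point of \<open>half_plane (1/2)\<close> is given by \<open>dseries_eval\<close> below.
  Only the underlying real Hilbert space structure is declared, with inner product
  \<open>Re (\<Sum>n. a n * cnj (b n))\<close>. Norm, operator norm and compactness are the same as
  for the complex structure.
\<close>

typedef dseries = "{a :: nat \<Rightarrow> complex. a 0 = 0 \<and> summable (\<lambda>n. (cmod (a n))\<^sup>2)}"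
  morphisms dcoeff Abs_dseries
  by (rule exI[of _ "\<lambda>_. 0"]) simp

setup_lifting type_definition_dseries

lemma summable_inner_of_squares:
  fixes a b :: "nat \<Rightarrow> complex"
  assumes "summable (\<lambda>n. (cmod (a n))\<^sup>2)" "summable (\<lambda>n. (cmod (b n))\<^sup>2)"
  shows "summable (\<lambda>n. a n \<bullet> b n)"
proof (rule summable_comparison_test')
  show "summable (\<lambda>n. (cmod (a n))\<^sup>2 + (cmod (b n))\<^sup>2)"
    using assms by (rule summable_add)
  show "norm (a n \<bullet> b n) \<le> (cmod (a n))\<^sup>2 + (cmod (b n))\<^sup>2" if "n \<ge> 0" for n
  proof -
    have "norm (a n \<bullet> b n) \<le> cmod (a n) * cmod (b n)"
      using Cauchy_Schwarz_ineq2 by auto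
    also have "\<dots> \<le> (cmod (a n))\<^sup>2 + (cmod (b n))\<^sup>2"
      using sum_squares_bound[of "cmod (a n)" "cmod (b n)"]
        mult_nonneg_nonneg[OF norm_ge_zero[of "a n"] norm_ge_zero[of "b n"]]
      by linarith
    finally show ?thesis .
  qed
qed

lemma summable_squares_add:
  fixes a b :: "nat \<Rightarrow> complex"
  assumes "summable (\<lambda>n. (cmod (a n))\<^sup>2)" "summable (\<lambda>n. (cmod (b n))\<^sup>2)"
  shows "summable (\<lambda>n. (cmod (a n + b n))\<^sup>2)"
proof -
  have "summable (\<lambda>n. (cmod (a n))\<^sup>2 + (cmod (b n))\<^sup>2 + 2 * (a n \<bullet> b n))"
    by (intro summable_add summable_mult assms summable_inner_of_squares)
  moreover have "(cmod (a n))\<^sup>2 + (cmod (b n))\<^sup>2 + 2 * (a n \<bullet> b n) = (cmod (a n + b n))\<^sup>2" for n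
    by (simp add: power2_norm_eq_inner inner_add_left inner_add_right inner_commute)
  ultimately show ?thesis by simp
qed

instantiation dseries :: real_vector
begin

lift_definition zero_dseries :: dseries is "\<lambda>_. 0" by simp

lift_definition plus_dseries :: "dseries \<Rightarrow> dseries \<Rightarrow> dseries" is "\<lambda>a b n. a n + b n"
  by (simp add: summable_squares_add)

lift_definition uminus_dseries :: "dseries \<Rightarrow> dseries" is "\<lambda>a n. - a n" by simp

lift_definition minus_dseries :: "dseries \<Rightarrow> dseries \<Rightarrow> dseries" is "\<lambda>a b n. a n - b n"
  subgoal for a b using summable_squares_add[of a "\<lambda>n. - b n"] by simp
  done

lift_definition scaleR_dseries :: "real \<Rightarrow> dseries \<Rightarrow> dseries" is "\<lambda>r a n. r *\<^sub>R a n"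
  by (simp add: power_mult_distrib summable_mult)

instance
  by standard (transfer; simp add: fun_eq_iff algebra_simps)+

end

instantiation dseries :: real_inner
begin

lift_definition inner_dseries :: "dseries \<Rightarrow> dseries \<Rightarrow> real" is "\<lambda>a b. \<Sum>n. a n \<bullet> b n" .

lift_definition norm_dseries :: "dseries \<Rightarrow> real" is "\<lambda>a. sqrt (\<Sum>n. (cmod (a n))\<^sup>2)" .

definition sgn_dseries :: "dseries \<Rightarrow> dseries" where
  "sgn_dseries f = inverse (norm f) *\<^sub>R f"

definition dist_dseries :: "dseries \<Rightarrow> dseries \<Rightarrow> real" where
  "dist_dseries f g = norm (f - g)"

definition uniformity_dseries :: "(dseries \<times> dseries) filter" where
  "uniformity_dseries = (INF e\<in>{0 <..}. principal {(f, g). dist f g < e})"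

definition open_dseries :: "dseries set \<Rightarrow> bool" where
  "open_dseries U \<longleftrightarrow> (\<forall>f\<in>U. eventually (\<lambda>(f', g). f' = f \<longrightarrow> g \<in> U) uniformity)"

instance
proof
  fix f g h :: dseries and r :: real and U :: "dseries set"
  show "sgn f = inverse (norm f) *\<^sub>R f" by (rule sgn_dseries_def)
  show "dist f g = norm (f - g)" by (rule dist_dseries_def)
  show "uniformity = (INF e\<in>{0 <..}. principal {(f, g :: dseries). dist f g < e})"
    by (rule uniformity_dseries_def)
  show "open U \<longleftrightarrow> (\<forall>f\<in>U. \<forall>\<^sub>F (f', g) in uniformity. f' = f \<longrightarrow> g \<in> U)"
    by (rule open_dseries_def)
  show "f \<bullet> g = g \<bullet> f" by transfer (simp add: inner_commute)
  show "(f + g) \<bullet> h = f \<bullet> h + g \<bullet> h"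
    by transfer (simp add: inner_add_left suminf_add summable_inner_of_squares)
  show "(r *\<^sub>R f) \<bullet> g = r * (f \<bullet> g)"
    by transfer (simp add: suminf_mult summable_inner_of_squares)
  show "0 \<le> f \<bullet> f"
    by transfer (simp add: suminf_nonneg summable_inner_of_squares)
  show "f \<bullet> f = 0 \<longleftrightarrow> f = 0"
    by transfer (auto simp: suminf_eq_zero_iff summable_inner_of_squares fun_eq_iff)
  show "norm f = sqrt (f \<bullet> f)"
    by transfer (simp add: power2_norm_eq_inner)
qed

end

definition dseries_eval :: "dseries \<Rightarrow> complex \<Rightarrow> complex" where
  "dseries_eval f s = dirichlet_series (dcoeff f) s"


section \<open>The Gordon-Hedenmalm class\<close>

text \<open>
  A symbol is a total function of which only the values on \<open>half_plane 0\<close> matter; there it is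
  given by the formula \<open>c0 * s + dirichlet_series c s\<close>.
\<close>

definition gh_repr :: "(complex \<Rightarrow> complex) \<Rightarrow> nat \<Rightarrow> (nat \<Rightarrow> complex) \<Rightarrow> bool" where
  "gh_repr \<phi> c0 c \<longleftrightarrow>
     (\<forall>s\<in>half_plane 0. \<phi> s = of_nat c0 * s + dirichlet_series c s) \<and>
     \<phi> ` half_plane (1/2) \<subseteq> half_plane (1/2) \<and>
     (\<forall>\<epsilon>>0. uniform_limit (half_plane \<epsilon>) (\<lambda>N s. \<Sum>n=1..N. c n * of_nat n powr (- s))
        (dirichlet_series c) sequentially) \<and>
     (c0 = 0 \<longrightarrow> dirichlet_series c ` half_plane 0 \<subseteq> half_plane (1/2)) \<and>
     (c0 \<ge> 1 \<longrightarrow>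
        ((\<forall>s\<in>half_plane 0. dirichlet_series c s = c 1) \<and> Re (c 1) \<ge> 0) \<or>
        dirichlet_series c ` half_plane 0 \<subseteq> half_plane 0)"

definition gordon_hedenmalm :: "(complex \<Rightarrow> complex) set" where
  "gordon_hedenmalm = {\<phi>. \<exists>c0 c. gh_repr \<phi> c0 c}"

definition gh_char :: "(complex \<Rightarrow> complex) \<Rightarrow> nat" where
  "gh_char \<phi> = (THE c0. \<exists>c. gh_repr \<phi> c0 c)"


section \<open>Composition operators\<close>

text \<open>
  Elements of the space live on \<open>half_plane (1/2)\<close>, so this is the identity
  \<open>C\<^sub>\<phi> f = f \<circ> \<phi>\<close> there. There is at most one such operator, since coefficients are determined
  by values; for \<open>\<phi>\<close> in the Gordon-Hedenmalm class there is one, by the Gordon-Hedenmalm theorem.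
\<close>

definition comp_op :: "(complex \<Rightarrow> complex) \<Rightarrow> dseries \<Rightarrow>\<^sub>L dseries" where
  "comp_op \<phi> = (THE T. \<forall>f. \<forall>s\<in>half_plane (1/2).
     dseries_eval (blinfun_apply T f) s = dseries_eval f (\<phi> s))"

definition comp_ops :: "(dseries \<Rightarrow>\<^sub>L dseries) set" where
  "comp_ops = comp_op ` gordon_hedenmalm"

definition compact_operator :: "('a::real_normed_vector \<Rightarrow>\<^sub>L 'b::real_normed_vector) \<Rightarrow> bool" where
  "compact_operator T \<longleftrightarrow> compact (closure (blinfun_apply T ` cball 0 1))"


definition gh_min :: "(complex \<Rightarrow> complex) \<Rightarrow> (complex \<Rightarrow> complex) \<Rightarrow> complex \<Rightarrow> real" where
  "gh_min \<phi>\<^sub>0 \<phi>\<^sub>1 s =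
     min ((Re (\<phi>\<^sub>0 s) - 1/2) / (cmod (1 + \<phi>\<^sub>0 s))\<^sup>2) ((Re (\<phi>\<^sub>1 s) - 1/2) / (cmod (1 + \<phi>\<^sub>1 s))\<^sup>2)"

end

theory Submission
  imports Defs
begin

text \<open>
  Everything rests on an explicit harmonic majorant of \<open>\<bar>f\<bar>\<^sup>2\<close> that also controls differences of values of \<open>f\<close>.
  Write \<open>f\<close> for a Dirichlet polynomial with coefficients \<open>a\<^sub>n\<close>, \<open>n \<le> N\<close>, and \<open>\<sigma> = Re w - 1/2\<close>.

  \<^bold>\<open>A holomorphic majorant.\<close> The Poisson extension \<open>u\<close> to \<open>Re w > 1/2\<close> of \<open>\<bar>f\<bar>\<^sup>2\<close> on the line
  \<open>Re w = 1/2\<close> is the real part of an explicit finite sum \<open>F\<close> of terms \<open>m powr (- w) * n powr (w - 1)\<close>,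
  and it is also a sum of squares: \<open>u(w)\<close> is the sum over \<open>k \<le> N\<close> of
  \<open>k powr (2\<sigma>) - (k-1) powr (2\<sigma>)\<close> times the squared modulus of the tail \<open>R\<^sub>k\<close> that consists of the
  terms \<open>n \<ge> k\<close> of \<open>f(w)\<close> (lemma \<open>Re_poisson_majorant\<close>).
  The term \<open>k = 1\<close> gives \<open>\<bar>f(w)\<bar>\<^sup>2 \<le> u(w)\<close>. Summing \<open>f(w')\<close> by parts against the tails \<open>R\<^sub>k\<close> at \<open>w\<close>
  and applying the Cauchy-Schwarz inequality gives the quantitative continuity estimate
  \<open>\<bar>f(w) - f(w')\<bar>\<^sup>2 \<le> \<bar>w - w'\<bar>\<^sup>2 / (4 \<sigma> \<sigma>') * u(w)\<close>
  (lemma \<open>dpoly_difference_square_le_poisson_majorant\<close>). A Schur test on the tails bounds \<open>u(w)\<close> at a fixed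
  point \<open>w\<close> by a constant times the squared norm of \<open>f\<close> (lemma \<open>poisson_majorant_le\<close>).

  \<^bold>\<open>From pointwise bounds to norm bounds.\<close> Let \<open>g\<close> and \<open>G\<close> be uniform limits of Dirichlet polynomials
  on every \<open>half_plane \<epsilon>\<close>, let \<open>\<bar>g\<bar>\<^sup>2 \<le> Re G\<close> on \<open>half_plane 0\<close>, and let \<open>l\<close> be the limit of \<open>G\<close> at \<open>+\<infinity>\<close>.
  Averaging over vertical lines shows that \<open>g\<close> belongs to the Hilbert space, with squared norm at most
  \<open>Re l\<close> (lemma \<open>dominated_approximable_is_dseries\<close>). For a symbol \<open>\<phi>\<close> of characteristic \<open>0\<close> with limit
  \<open>l\<close> at \<open>+\<infinity>\<close> this applies to \<open>g = f \<circ> \<phi>\<close> and \<open>G = F \<circ> \<phi>\<close>, since the uniform limits form an algebra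
  that is closed under \<open>exp\<close>. It bounds \<open>comp_op \<phi>\<close>, because \<open>Re l > 1/2\<close>.

  \<^bold>\<open>The two conclusions.\<close> If \<open>\<bar>\<phi> - \<phi>'\<bar>\<close> is at most \<open>c\<close> times the geometric mean of
  \<open>Re \<phi> - 1/2\<close> and \<open>Re \<phi>' - 1/2\<close>, the continuity estimate bounds the operator norm of the difference by
  a constant times \<open>c\<close>. The segment from \<open>\<phi>\<^sub>0\<close> to \<open>\<phi>\<^sub>1\<close> consists of symbols of characteristic \<open>0\<close>, for
  which the real part minus \<open>1/2\<close> is at least \<open>m\<close>; hence \<open>t \<mapsto> comp_op ((1 - t) \<phi>\<^sub>0 + t \<phi>\<^sub>1)\<close> is continuous, which connects
  the two operators. For compactness, apply the difference to functions whose first \<open>N\<close> coefficients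
  vanish: where \<open>m\<close> is small the continuity estimate gains a small factor, and where \<open>m \<ge> \<theta>\<close> both
  symbols take values in \<open>Re w \<ge> 1/2 + \<theta>\<close>, on which such functions are uniformly small. So the difference
  is a norm limit of finite rank operators.
\<close>

section \<open>Means of Dirichlet polynomials over vertical lines\<close>

definition dpoly :: "(nat \<Rightarrow> complex) \<Rightarrow> nat \<Rightarrow> complex \<Rightarrow> complex" where
  "dpoly p N s = (\<Sum>n=1..N. p n * of_nat n powr (- s))"

lemma average_powers_tendsto:
  fixes z :: complex
  assumes "cmod z = 1"
  shows "(\<lambda>J. (\<Sum>j<J. z ^ j) / of_nat J) \<longlonglongrightarrow> (if z = 1 then 1 else 0)"
proof (cases "z = 1")
  case True
  have "(\<lambda>J. (\<Sum>j<J. z ^ j) / of_nat J) \<longlonglongrightarrow> 1"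
    by (rule tendsto_eventually) (use True in \<open>auto intro!: eventually_sequentiallyI[of 1]\<close>)
  with True show ?thesis by simp
next
  case False
  have bound: "cmod ((\<Sum>j<J. z ^ j) / of_nat J) \<le> (2 / cmod (z - 1)) * inverse (real J)" for J
  proof -
    have "cmod (z ^ J - 1) \<le> cmod (z ^ J) + cmod 1"
      by (rule norm_triangle_ineq4)
    then have "cmod (z ^ J - 1) \<le> 2"
      using assms by (simp add: norm_power)
    then have "cmod (\<Sum>j<J. z ^ j) \<le> 2 / cmod (z - 1)"
      using False by (simp add: geometric_sum norm_divide divide_right_mono)
    then have "cmod (\<Sum>j<J. z ^ j) / real J \<le> 2 / cmod (z - 1) / real J"
      by (rule divide_right_mono) simp
    then show ?thesis
      unfolding norm_divide norm_of_nat by (simp only: divide_inverse)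
  qed
  have "(\<lambda>J. (2 / cmod (z - 1)) * inverse (real J)) \<longlonglongrightarrow> (2 / cmod (z - 1)) * 0"
    by (intro tendsto_intros lim_inverse_n)
  then have "(\<lambda>J. (2 / cmod (z - 1)) * inverse (real J)) \<longlonglongrightarrow> 0"
    by (simp only: mult_zero_right)
  then have "(\<lambda>J. (\<Sum>j<J. z ^ j) / of_nat J) \<longlonglongrightarrow> 0"
    by (rule Lim_null_comparison[OF always_eventually[OF allI[OF bound]]])
  with False show ?thesis by simp
qed

lemma average_exponential_sum_tendsto:
  fixes b z :: "'i \<Rightarrow> complex"
  assumes "finite I" and "\<And>i. i \<in> I \<Longrightarrow> cmod (z i) = 1"
  shows "(\<lambda>J. (\<Sum>j<J. \<Sum>i\<in>I. b i * z i ^ j) / of_nat J)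
           \<longlonglongrightarrow> (\<Sum>i\<in>I. if z i = 1 then b i else 0)"
proof -
  have "(\<lambda>J. \<Sum>i\<in>I. b i * ((\<Sum>j<J. z i ^ j) / of_nat J))
          \<longlonglongrightarrow> (\<Sum>i\<in>I. b i * (if z i = 1 then 1 else 0))"
    by (intro tendsto_intros average_powers_tendsto assms)
  moreover have "(\<Sum>j<J. \<Sum>i\<in>I. b i * z i ^ j) / of_nat J
      = (\<Sum>i\<in>I. b i * ((\<Sum>j<J. z i ^ j) / of_nat J))" for J
    by (subst sum.swap) (simp add: sum_divide_distrib sum_distrib_left)
  moreover have "(\<Sum>i\<in>I. b i * (if z i = 1 then 1 else 0)) = (\<Sum>i\<in>I. if z i = 1 then b i else 0)"
    by (intro sum.cong) auto
  ultimately show ?thesis by simp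
qed

lemma norm_of_nat_powr [simp]: "cmod (of_nat n powr s) = real n powr Re s"
  by (simp add: norm_powr_real_powr)

lemma of_nat_powr_vertical_step:
  assumes "n \<ge> 1"
  shows "of_nat n powr (- (of_real \<sigma> + \<i> * of_real (h * real j)))
       = of_real (real n powr (- \<sigma>)) * exp (- (\<i> * of_real (h * ln (real n)))) ^ j"
proof -
  have "of_nat n powr (- (of_real \<sigma> + \<i> * of_real (h * real j)))
      = exp (of_real (- \<sigma> * ln (real n)) + of_nat j * (- (\<i> * of_real (h * ln (real n)))))"
    using assms by (simp add: powr_def Ln_of_nat algebra_simps)
  also have "\<dots> = of_real (exp (- \<sigma> * ln (real n))) * exp (- (\<i> * of_real (h * ln (real n)))) ^ j"
    by (simp only: exp_add exp_of_nat_mult exp_of_real)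
  finally show ?thesis
    using assms by (simp add: powr_def)
qed

text \<open>
  The powers \<open>n powr (- \<i> * t)\<close> are sampled at the points \<open>t = h * j\<close> of an arithmetic progression. When
  \<open>h * ln N \<le> 1 < 2 * pi\<close>, sampling does not identify the frequencies of distinct \<open>n \<le> N\<close>.
\<close>

lemma exp_ln_ratio_eq_1_iff:
  fixes h :: real
  assumes h: "h > 0" "h * ln (real N) \<le> 1" and mn: "m \<in> {1..N}" "n \<in> {1..N}"
  shows "exp (- (\<i> * of_real (h * ln (real n)))) * cnj (exp (- (\<i> * of_real (h * ln (real m))))) = 1
     \<longleftrightarrow> n = m"
proof
  assume "exp (- (\<i> * of_real (h * ln (real n)))) * cnj (exp (- (\<i> * of_real (h * ln (real m))))) = 1"
  then have "exp (\<i> * of_real (h * ln (real m) - h * ln (real n))) = 1"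
    by (simp add: exp_cnj exp_add[symmetric] algebra_simps)
  then obtain k :: int where k: "h * ln (real m) - h * ln (real n) = of_int (2 * k) * pi"
    by (auto simp: exp_eq_1)
  have r: "0 \<le> h * ln (real l)" "h * ln (real l) \<le> 1" if "l \<in> {1..N}" for l
  proof -
    show "0 \<le> h * ln (real l)" using that h by simp
    have "h * ln (real l) \<le> h * ln (real N)" using that h by simp
    then show "h * ln (real l) \<le> 1" using h by linarith
  qed
  have "\<bar>of_int (2 * k) * pi\<bar> \<le> 1"
    using r[OF mn(1)] r[OF mn(2)] k by linarith
  then have "\<bar>of_int k\<bar> * (2 * pi) \<le> 1" by (simp add: abs_mult)
  moreover have "1 < \<bar>of_int k\<bar> * (2 * pi)" if "k \<noteq> 0"
  proof -
    have a: "(1::real) \<le> \<bar>of_int k\<bar>" using that by linarith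
    have "1 < 2 * pi" using pi_gt3 by linarith
    also have "2 * pi \<le> \<bar>of_int k\<bar> * (2 * pi)" using a by simp
    finally show ?thesis by simp
  qed
  ultimately have "k = 0" by linarith
  with k h mn show "n = m" by simp
next
  assume "n = m"
  then show "exp (- (\<i> * of_real (h * ln (real n)))) * cnj (exp (- (\<i> * of_real (h * ln (real m))))) = 1"
    by (simp add: exp_cnj exp_add[symmetric])
qed

text \<open>
  Averages over equidistant points of a vertical line recover both sides: on the left the diagonal
  terms of \<open>\<bar>P\<bar>\<^sup>2\<close>, on the right the constant term. Averages over finite
  progressions with small step take the place of the integral mean.
\<close>

lemma dpoly_square_sum_le_mean:
  assumes M: "M \<ge> 1"
    and le: "\<And>t. (cmod (dpoly p N (of_real \<sigma> + \<i> * of_real t)))\<^sup>2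
                     \<le> Re (dpoly q M (of_real \<sigma> + \<i> * of_real t))"
  shows "(\<Sum>n=1..N. (cmod (p n))\<^sup>2 * real n powr (- 2 * \<sigma>)) \<le> Re (q 1)"
proof -
  define L where "L = max N M"
  define h where "h = 1 / (1 + ln (real L))"
  define z where "z n = exp (- (\<i> * of_real (h * ln (real n))))" for n :: nat
  have L: "L \<ge> 1" using M by (simp add: L_def)
  then have lnL: "ln (real L) \<ge> 0" by simp
  then have h: "h > 0" "h * ln (real L) \<le> 1" by (auto simp: h_def field_simps)
  have z_iff: "z n * cnj (z m) = 1 \<longleftrightarrow> n = m" if "m \<in> {1..L}" "n \<in> {1..L}" for m n
    unfolding z_def by (rule exp_ln_ratio_eq_1_iff[OF h that])
  have z1: "z 1 = 1" by (simp add: z_def)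
  have nz: "cmod (z n) = 1" for n by (simp add: z_def)
  define r where "r n = complex_of_real (real n powr (- \<sigma>))" for n :: nat
  define S where "S j = of_real \<sigma> + \<i> * of_real (h * real j)" for j :: nat
  have dp: "dpoly c K (S j) = (\<Sum>n=1..K. c n * r n * z n ^ j)" for c K j
    unfolding dpoly_def S_def
    by (intro sum.cong refl) (simp only: of_nat_powr_vertical_step r_def z_def atLeastAtMost_iff mult.assoc)
  have Q: "(\<lambda>J. (\<Sum>j<J. dpoly q M (S j)) / of_nat J) \<longlonglongrightarrow> q 1"
  proof -
    have "(\<lambda>J. (\<Sum>j<J. dpoly q M (S j)) / of_nat J)
        \<longlonglongrightarrow> (\<Sum>n=1..M. if z n = 1 then q n * r n else 0)"
      unfolding dp by (rule average_exponential_sum_tendsto) (auto simp: nz)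
    also have "(\<Sum>n=1..M. if z n = 1 then q n * r n else 0) = (\<Sum>n=1..M. if n = 1 then q n * r n else 0)"
    proof (intro sum.cong refl)
      fix n assume n: "n \<in> {1..M}"
      have "z n = 1 \<longleftrightarrow> n = 1" using z_iff[of 1 n] n M z1 by (auto simp: L_def)
      then show "(if z n = 1 then q n * r n else 0) = (if n = 1 then q n * r n else 0)" by simp
    qed
    also have "\<dots> = q 1" using M by (simp add: r_def)
    finally show ?thesis .
  qed
  have P: "(\<lambda>J. (\<Sum>j<J. complex_of_real ((cmod (dpoly p N (S j)))\<^sup>2)) / of_nat J)
      \<longlonglongrightarrow> complex_of_real (\<Sum>n=1..N. (cmod (p n))\<^sup>2 * real n powr (- 2 * \<sigma>))"
  proof -
    have eq: "complex_of_real ((cmod (dpoly p N (S j)))\<^sup>2)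
        = (\<Sum>(n, m)\<in>{1..N}\<times>{1..N}. (p n * r n * cnj (p m * r m)) * (z n * cnj (z m)) ^ j)" for j
      unfolding complex_norm_square dp cnj_sum sum_product sum.cartesian_product
      by (intro sum.cong refl) (simp only: split_paired_all prod.case complex_cnj_mult complex_cnj_power power_mult_distrib mult.assoc mult.left_commute mult.commute)
    have "(\<lambda>J. (\<Sum>j<J. \<Sum>x\<in>{1..N}\<times>{1..N}. (p (fst x) * r (fst x) * cnj (p (snd x) * r (snd x))) * (z (fst x) * cnj (z (snd x))) ^ j) / of_nat J)
        \<longlonglongrightarrow> (\<Sum>x\<in>{1..N}\<times>{1..N}. if z (fst x) * cnj (z (snd x)) = 1
              then p (fst x) * r (fst x) * cnj (p (snd x) * r (snd x)) else 0)"
      by (rule average_exponential_sum_tendsto) (auto simp: nz norm_mult)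
    also have "(\<Sum>x\<in>{1..N}\<times>{1..N}. if z (fst x) * cnj (z (snd x)) = 1
              then p (fst x) * r (fst x) * cnj (p (snd x) * r (snd x)) else 0)
       = (\<Sum>n=1..N. \<Sum>m=1..N. if n = m then p n * r n * cnj (p m * r m) else 0)"
      unfolding sum.cartesian_product
      by (intro sum.cong refl) (auto simp: z_iff L_def)
    also have "\<dots> = (\<Sum>n=1..N. p n * r n * cnj (p n * r n))" by simp
    also have "\<dots> = of_real (\<Sum>n=1..N. (cmod (p n))\<^sup>2 * real n powr (- 2 * \<sigma>))"
      unfolding of_real_sum
    proof (intro sum.cong refl)
      fix n
      have "p n * r n * cnj (p n * r n) = of_real ((cmod (p n * r n))\<^sup>2)"
        by (simp only: complex_norm_square)
      also have "(cmod (p n * r n))\<^sup>2 = (cmod (p n))\<^sup>2 * real n powr (- 2 * \<sigma>)"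
        by (simp add: r_def norm_mult power_mult_distrib power2_eq_square powr_add[symmetric])
      finally show "p n * r n * cnj (p n * r n) = of_real ((cmod (p n))\<^sup>2 * real n powr (- 2 * \<sigma>))" .
    qed
    finally show ?thesis unfolding eq case_prod_beta .
  qed
  have Re_average: "Re ((\<Sum>j<J. f j) / of_nat J) = (\<Sum>j<J. Re (f j)) / real J" for f J
    by (simp only: Re_divide_of_nat Re_sum)
  have "(\<lambda>J. (\<Sum>j<J. (cmod (dpoly p N (S j)))\<^sup>2) / real J)
      \<longlonglongrightarrow> (\<Sum>n=1..N. (cmod (p n))\<^sup>2 * real n powr (- 2 * \<sigma>))"
    using tendsto_Re[OF P] by (simp only: Re_average Re_complex_of_real)
  moreover have "(\<lambda>J. (\<Sum>j<J. Re (dpoly q M (S j))) / real J) \<longlonglongrightarrow> Re (q 1)"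
    using tendsto_Re[OF Q] by (simp only: Re_average)
  ultimately show "(\<Sum>n=1..N. (cmod (p n))\<^sup>2 * real n powr (- 2 * \<sigma>)) \<le> Re (q 1)"
  proof (rule LIMSEQ_le, intro exI allI impI divide_right_mono sum_mono)
    show "(cmod (dpoly p N (S j)))\<^sup>2 \<le> Re (dpoly q M (S j))" for j
      unfolding S_def by (rule le)
  qed simp
qed

section \<open>The algebra of uniform limits of Dirichlet polynomials\<close>

lemma half_plane_iff [simp]: "s \<in> half_plane \<theta> \<longleftrightarrow> Re s > \<theta>"
  by (simp add: half_plane_def)

lemma of_nat_mult_powr: "of_nat (n * m) powr s = of_nat n powr s * (of_nat m powr s :: complex)"
proof (cases "n = 0 \<or> m = 0")
  case False
  then have nm: "0 < n * m" "0 < n" "0 < m" "ln (real (n * m)) = ln (real n) + ln (real m)" by (auto simp: ln_mult)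
  then show ?thesis
    unfolding powr_def using Ln_of_nat[OF nm(1)] Ln_of_nat[OF nm(2)] Ln_of_nat[OF nm(3)]
    by (simp del: of_nat_mult add: exp_add[symmetric] distrib_left)
qed auto

lemma dpoly_extend:
  assumes "N \<le> M"
  shows "dpoly p N s = dpoly (\<lambda>n. if n \<le> N then p n else 0) M s"
  unfolding dpoly_def using assms by (intro sum.mono_neutral_cong_left) auto

lemma dpoly_add: "dpoly p N s + dpoly q N s = dpoly (\<lambda>n. p n + q n) N s"
  by (simp add: dpoly_def sum.distrib distrib_right)

lemma dpoly_diff: "dpoly p N s - dpoly q N s = dpoly (\<lambda>n. p n - q n) N s"
  by (simp add: dpoly_def sum_subtractf left_diff_distrib)

lemma dpoly_cmult: "c * dpoly p N s = dpoly (\<lambda>n. c * p n) N s"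
  by (simp add: dpoly_def sum_distrib_left mult.assoc)

lemma dpoly_mult:
  "dpoly p N s * dpoly q M s
     = dpoly (\<lambda>k. \<Sum>(n, m) | (n, m) \<in> {1..N} \<times> {1..M} \<and> n * m = k. p n * q m) (N * M) s"
proof -
  have "dpoly p N s * dpoly q M s
      = (\<Sum>(n, m)\<in>{1..N}\<times>{1..M}. p n * q m * of_nat (n * m) powr (- s))"
    unfolding dpoly_def sum_product sum.cartesian_product
    by (intro sum.cong refl) (auto simp del: of_nat_mult simp: of_nat_mult_powr)
  also have "\<dots> = (\<Sum>k\<in>{1..N * M}. \<Sum>x\<in>{x \<in> {1..N}\<times>{1..M}. fst x * snd x = k}.
      case x of (n, m) \<Rightarrow> p n * q m * of_nat (n * m) powr (- s))"
  proof (rule sum.group[symmetric])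
    show "(\<lambda>x. fst x * snd x) ` ({1..N} \<times> {1..M}) \<subseteq> {1..N * M}"
      by (auto simp: mult_le_mono Suc_leI)
  qed auto
  also have "\<dots> = dpoly (\<lambda>k. \<Sum>(n, m) | (n, m) \<in> {1..N} \<times> {1..M} \<and> n * m = k. p n * q m) (N * M) s"
    unfolding dpoly_def sum_distrib_right
    by (intro sum.cong refl) (auto simp: case_prod_beta)
  finally show ?thesis .
qed

lemma dpoly_bound:
  assumes "Re s \<ge> 0"
  shows "cmod (dpoly p N s) \<le> (\<Sum>n=1..N. cmod (p n))"
  unfolding dpoly_def
proof (intro sum_norm_le)
  fix n assume n: "n \<in> {1..N}"
  then have "real n powr (- Re s) \<le> real n powr 0" using assms by (intro powr_mono) auto
  then show "cmod (p n * of_nat n powr (- s)) \<le> cmod (p n)"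
    using n by (simp add: norm_mult mult_left_le)
qed

lemma dpoly_tendsto:
  assumes "N \<ge> 1"
  shows "((\<lambda>x. dpoly p N (of_real x)) \<longlongrightarrow> p 1) at_top"
proof -
  have "((\<lambda>x. p n * of_nat n powr (- complex_of_real x)) \<longlongrightarrow> (if n = 1 then p 1 else 0)) at_top"
    if "n \<in> {1..N}" for n
  proof (cases "n = 1")
    case False
    then have n: "real n > 1" using that by simp
    have "LIM x at_top. ln (real n) * x :> at_top"
      using n by (intro filterlim_tendsto_pos_mult_at_top[OF tendsto_const] filterlim_ident) simp
    then have "((\<lambda>x. exp (- (ln (real n) * x))) \<longlongrightarrow> 0) at_top"
      by (intro filterlim_compose[OF exp_at_bot] filterlim_compose[OF filterlim_uminus_at_bot_at_top])
    then have "((\<lambda>x. real n powr (- x)) \<longlongrightarrow> 0) at_top"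
      using n by (simp add: powr_def mult.commute)
    then have "((\<lambda>x. of_nat n powr (- complex_of_real x)) \<longlongrightarrow> 0) at_top"
      by (subst tendsto_norm_zero_iff[symmetric]) simp
    then show ?thesis using False tendsto_mult_right_zero by auto
  qed auto
  then have "((\<lambda>x. dpoly p N (of_real x)) \<longlongrightarrow> (\<Sum>n=1..N. if n = 1 then p 1 else 0)) at_top"
    unfolding dpoly_def by (rule tendsto_sum)
  then show ?thesis using assms by simp
qed

text \<open>
  The approximants are arbitrary Dirichlet polynomials rather than the partial sums of one series; this
  makes closure under products and under \<open>exp\<close> immediate from that of the polynomials.
\<close>

definition approximable :: "real \<Rightarrow> (complex \<Rightarrow> complex) \<Rightarrow> bool" where
  "approximable \<epsilon> g \<longleftrightarrow>
     (\<forall>\<eta>>0. \<exists>p N. N \<ge> 1 \<and> (\<forall>s\<in>half_plane \<epsilon>. cmod (g s - dpoly p N s) \<le> \<eta>))"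

lemma approximableD:
  assumes "approximable \<epsilon> g" "\<eta> > 0"
  obtains p N where "N \<ge> 1" "\<And>s. Re s > \<epsilon> \<Longrightarrow> cmod (g s - dpoly p N s) \<le> \<eta>"
  using assms unfolding approximable_def by (meson half_plane_iff)

lemma approximable_limit:
  assumes "\<And>\<eta>. \<eta> > 0 \<Longrightarrow> \<exists>h. approximable \<epsilon> h \<and> (\<forall>s\<in>half_plane \<epsilon>. cmod (g s - h s) \<le> \<eta>)"
  shows "approximable \<epsilon> g"
  unfolding approximable_def
proof (intro allI impI)
  fix \<eta> :: real assume \<eta>: "\<eta> > 0"
  then obtain h where h: "approximable \<epsilon> h" "\<forall>s\<in>half_plane \<epsilon>. cmod (g s - h s) \<le> \<eta> / 2"
    using assms[of "\<eta> / 2"] by auto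
  obtain p N where p: "N \<ge> 1" "\<And>s. Re s > \<epsilon> \<Longrightarrow> cmod (h s - dpoly p N s) \<le> \<eta> / 2"
    using approximableD[OF h(1) half_gt_zero[OF \<eta>]] by blast
  have "cmod (g s - dpoly p N s) \<le> \<eta>" if "Re s > \<epsilon>" for s
    using norm_diff_triangle_le[of "g s" "h s" "\<eta> / 2" "dpoly p N s" "\<eta> / 2"] h(2) p(2)[OF that] that
    by simp
  with p(1) show "\<exists>p N. N \<ge> 1 \<and> (\<forall>s\<in>half_plane \<epsilon>. cmod (g s - dpoly p N s) \<le> \<eta>)"
    by (metis half_plane_iff)
qed

lemma approximable_dpoly:
  assumes "N \<ge> 1"
  shows "approximable \<epsilon> (dpoly p N)"
  unfolding approximable_def using assms by (auto intro!: exI[of _ p] exI[of _ N])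

lemma approximable_const: "approximable \<epsilon> (\<lambda>s. c)"
  using approximable_dpoly[of 1 \<epsilon> "\<lambda>_. c"] by (simp add: dpoly_def[abs_def])

lemma approximable_bounded:
  assumes "approximable \<epsilon> g" "\<epsilon> \<ge> 0"
  obtains B where "B > 0" "\<And>s. Re s > \<epsilon> \<Longrightarrow> cmod (g s) \<le> B"
proof -
  obtain p N where p: "\<And>s. Re s > \<epsilon> \<Longrightarrow> cmod (g s - dpoly p N s) \<le> 1"
    using approximableD[OF assms(1) zero_less_one] by blast
  have "cmod (g s) \<le> 1 + (\<Sum>n=1..N. cmod (p n))" if "Re s > \<epsilon>" for s
    using p[OF that] dpoly_bound[of s p N] that assms(2) norm_triangle_sub[of "g s" "dpoly p N s"] by linarith
  moreover have "1 + (\<Sum>n=1..N. cmod (p n)) > 0" by (simp add: sum_nonneg add_pos_nonneg)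
  ultimately show ?thesis using that by blast
qed

lemma approximable_add:
  assumes "approximable \<epsilon> g" "approximable \<epsilon> h"
  shows "approximable \<epsilon> (\<lambda>s. g s + h s)"
proof (rule approximable_limit)
  fix \<eta> :: real assume \<eta>: "\<eta> > 0"
  obtain p N where p: "N \<ge> 1" "\<And>s. Re s > \<epsilon> \<Longrightarrow> cmod (g s - dpoly p N s) \<le> \<eta> / 2"
    using approximableD[OF assms(1) half_gt_zero[OF \<eta>]] by blast
  obtain q M where q: "M \<ge> 1" "\<And>s. Re s > \<epsilon> \<Longrightarrow> cmod (h s - dpoly q M s) \<le> \<eta> / 2"
    using approximableD[OF assms(2) half_gt_zero[OF \<eta>]] by blast
  define r where "r = (\<lambda>s. dpoly p N s + dpoly q M s)"
  have "r = dpoly (\<lambda>n. (if n \<le> N then p n else 0) + (if n \<le> M then q n else 0)) (max N M)"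
    unfolding r_def
    by (simp add: dpoly_extend[of N "max N M" p] dpoly_extend[of M "max N M" q] dpoly_add)
  then have "approximable \<epsilon> r" using p(1) by (simp add: approximable_dpoly)
  moreover have "cmod (g s + h s - r s) \<le> \<eta>" if "Re s > \<epsilon>" for s
    using norm_add_rule_thm[OF p(2)[OF that] q(2)[OF that]] by (simp add: r_def algebra_simps)
  ultimately show "\<exists>r. approximable \<epsilon> r \<and> (\<forall>s\<in>half_plane \<epsilon>. cmod (g s + h s - r s) \<le> \<eta>)"
    by auto
qed

lemma approximable_mult:
  assumes g: "approximable \<epsilon> g" and h: "approximable \<epsilon> h" and \<epsilon>: "\<epsilon> \<ge> 0"
  shows "approximable \<epsilon> (\<lambda>s. g s * h s)"
proof (rule approximable_limit)
  fix \<eta> :: real assume \<eta>: "\<eta> > 0"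
  obtain A where A: "A > 0" "\<And>s. Re s > \<epsilon> \<Longrightarrow> cmod (g s) \<le> A" using approximable_bounded[OF g \<epsilon>] by blast
  obtain B where B: "B > 0" "\<And>s. Re s > \<epsilon> \<Longrightarrow> cmod (h s) \<le> B" using approximable_bounded[OF h \<epsilon>] by blast
  define \<delta> where "\<delta> = min 1 (\<eta> / (A + B + 1))"
  have \<delta>: "\<delta> > 0" "\<delta> \<le> 1" using \<eta> A(1) B(1) by (auto simp: \<delta>_def)
  have "\<delta> * (A + B + 1) \<le> \<eta> / (A + B + 1) * (A + B + 1)"
    using A(1) B(1) by (intro mult_right_mono) (auto simp: \<delta>_def)
  then have \<delta>\<eta>: "\<delta> * (A + B + 1) \<le> \<eta>" using A(1) B(1) by simp
  obtain p N where p: "N \<ge> 1" "\<And>s. Re s > \<epsilon> \<Longrightarrow> cmod (g s - dpoly p N s) \<le> \<delta>"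
    using approximableD[OF g \<delta>(1)] by blast
  obtain q M where q: "M \<ge> 1" "\<And>s. Re s > \<epsilon> \<Longrightarrow> cmod (h s - dpoly q M s) \<le> \<delta>"
    using approximableD[OF h \<delta>(1)] by blast
  define r where "r = (\<lambda>s. dpoly p N s * dpoly q M s)"
  have "approximable \<epsilon> r" unfolding r_def dpoly_mult using p(1) q(1) by (intro approximable_dpoly) simp
  moreover have "cmod (g s * h s - r s) \<le> \<eta>" if s: "Re s > \<epsilon>" for s
  proof -
    define u v where "u = g s - dpoly p N s" and "v = h s - dpoly q M s"
    have u: "cmod u \<le> \<delta>" and v: "cmod v \<le> \<delta>" using p(2)[OF s] q(2)[OF s] by (auto simp: u_def v_def)
    have "g s * h s - r s = g s * v + u * h s - u * v"
      by (simp add: r_def u_def v_def algebra_simps)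
    also have "cmod \<dots> \<le> cmod (g s) * cmod v + cmod u * cmod (h s) + cmod u * cmod v"
      using norm_triangle_ineq4[of "g s * v + u * h s" "u * v"] norm_triangle_ineq[of "g s * v" "u * h s"]
      by (simp add: norm_mult)
    also have "\<dots> \<le> A * \<delta> + \<delta> * B + \<delta> * 1"
      using A B u v \<delta> s by (intro add_mono mult_mono) (auto intro: order_trans)
    also have "\<dots> = \<delta> * (A + B + 1)" by (simp add: algebra_simps)
    finally show ?thesis using \<delta>\<eta> by linarith
  qed
  ultimately show "\<exists>r. approximable \<epsilon> r \<and> (\<forall>s\<in>half_plane \<epsilon>. cmod (g s * h s - r s) \<le> \<eta>)"
    by auto
qed

lemma approximable_sum:
  assumes "finite I" "\<And>i. i \<in> I \<Longrightarrow> approximable \<epsilon> (g i)"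
  shows "approximable \<epsilon> (\<lambda>s. \<Sum>i\<in>I. g i s)"
  using assms by (induction I rule: finite_induct) (auto intro: approximable_const approximable_add)

lemma approximable_cmult:
  assumes "approximable \<epsilon> g" "\<epsilon> \<ge> 0"
  shows "approximable \<epsilon> (\<lambda>s. c * g s)"
  by (intro approximable_mult approximable_const assms)

lemma approximable_diff:
  assumes "approximable \<epsilon> g" "approximable \<epsilon> h" "\<epsilon> \<ge> 0"
  shows "approximable \<epsilon> (\<lambda>s. g s - h s)"
  using approximable_add[OF assms(1) approximable_cmult[OF assms(2,3), of "-1"]] by simp

lemma approximable_power:
  assumes "approximable \<epsilon> g" "\<epsilon> \<ge> 0"
  shows "approximable \<epsilon> (\<lambda>s. g s ^ k)"
  using assms by (induction k) (auto intro: approximable_const approximable_mult)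

text \<open>
  Approximable functions are bounded, and the exponential series converges uniformly on bounded sets.
\<close>

lemma approximable_exp:
  assumes g: "approximable \<epsilon> g" and \<epsilon>: "\<epsilon> \<ge> 0"
  shows "approximable \<epsilon> (\<lambda>s. exp (g s))"
proof (rule approximable_limit)
  fix \<eta> :: real assume \<eta>: "\<eta> > 0"
  obtain B where B: "B > 0" "\<And>s. Re s > \<epsilon> \<Longrightarrow> cmod (g s) \<le> B" using approximable_bounded[OF g \<epsilon>] by blast
  have "uniform_limit (cball 0 B) (\<lambda>n z::complex. \<Sum>k<n. z ^ k /\<^sub>R fact k) (\<lambda>z. \<Sum>k. z ^ k /\<^sub>R fact k) sequentially"
  proof (rule Weierstrass_m_test)
    show "summable (\<lambda>k. B ^ k /\<^sub>R fact k)" by (rule summable_exp_generic)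
    show "norm (z ^ k /\<^sub>R fact k) \<le> B ^ k /\<^sub>R fact k" if "z \<in> cball 0 B" for k and z :: complex
      using that by (auto simp: norm_power intro!: mult_left_mono power_mono)
  qed
  then have "\<forall>\<^sub>F n in sequentially. \<forall>z\<in>cball 0 B. dist (\<Sum>k<n. z ^ k /\<^sub>R fact k) (\<Sum>k. z ^ k /\<^sub>R fact k :: complex) < \<eta>"
    using \<eta> by (simp add: uniform_limit_iff)
  then obtain n where n: "\<And>z::complex. cmod z \<le> B \<Longrightarrow> cmod ((\<Sum>k<n. z ^ k /\<^sub>R fact k) - exp z) < \<eta>"
    unfolding exp_def dist_norm using eventually_happens trivial_limit_sequentially by (force simp: )
  show "\<exists>h. approximable \<epsilon> h \<and> (\<forall>s\<in>half_plane \<epsilon>. cmod (exp (g s) - h s) \<le> \<eta>)"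
  proof (intro exI conjI ballI)
    show "approximable \<epsilon> (\<lambda>s. \<Sum>k<n. (g s) ^ k /\<^sub>R fact k)"
      unfolding scaleR_conv_of_real
      by (intro approximable_sum approximable_cmult approximable_power g \<epsilon> finite_lessThan)
    show "cmod (exp (g s) - (\<Sum>k<n. (g s) ^ k /\<^sub>R fact k)) \<le> \<eta>" if "s \<in> half_plane \<epsilon>" for s
      using n[of "g s"] B(2)[of s] that by (simp add: norm_minus_commute less_imp_le)
  qed
qed

lemma approximable_constant_term:
  assumes close: "\<And>s. Re s > \<epsilon> \<Longrightarrow> cmod (g s - dpoly p N s) \<le> \<eta>" and "N \<ge> 1"
    and lim: "((\<lambda>x. g (of_real x)) \<longlongrightarrow> l) at_top"
  shows "cmod (l - p 1) \<le> \<eta>"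
proof (rule tendsto_upperbound)
  show "((\<lambda>x. cmod (g (of_real x) - dpoly p N (of_real x))) \<longlongrightarrow> cmod (l - p 1)) at_top"
    by (intro tendsto_intros lim dpoly_tendsto assms)
  show "\<forall>\<^sub>F x in at_top. cmod (g (of_real x) - dpoly p N (of_real x)) \<le> \<eta>"
    using eventually_gt_at_top[of \<epsilon>] by eventually_elim (auto intro: close)
qed auto

section \<open>Completeness of the Hilbert space and evaluation at points\<close>

lemma dcoeff_0 [simp]: "dcoeff f 0 = 0"
  using dcoeff[of f] by simp

lemma summable_dcoeff_squares: "summable (\<lambda>n. (cmod (dcoeff f n))\<^sup>2)"
  using dcoeff[of f] by simp

lemma norm_dseries_square: "(norm f)\<^sup>2 = (\<Sum>n. (cmod (dcoeff f n))\<^sup>2)"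
  by (simp add: norm_dseries.rep_eq suminf_nonneg summable_dcoeff_squares)

lemma dseries_eqI: "(\<And>n. n \<ge> 1 \<Longrightarrow> dcoeff f n = dcoeff g n) \<Longrightarrow> f = g"
  by (metis dcoeff_0 dcoeff_inject ext less_one not_le)

lemma sum_dcoeff_squares_le:
  assumes "finite A"
  shows "(\<Sum>n\<in>A. (cmod (dcoeff f n))\<^sup>2) \<le> (norm f)\<^sup>2"
  unfolding norm_dseries_square
  by (intro sum_le_suminf summable_dcoeff_squares assms) auto

lemma cmod_dcoeff_le: "cmod (dcoeff f n) \<le> norm f"
  using sum_dcoeff_squares_le[of "{n}" f] by (simp add: power2_le_iff_abs_le)

lemma norm_dseries_square_leI:
  assumes "\<And>K. (\<Sum>n=1..K. (cmod (dcoeff f n))\<^sup>2) \<le> B"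
  shows "(norm f)\<^sup>2 \<le> B"
  unfolding norm_dseries_square
proof (rule suminf_le_const[OF summable_dcoeff_squares])
  fix K
  have "(\<Sum>n<K. (cmod (dcoeff f n))\<^sup>2) \<le> (\<Sum>n\<in>insert 0 {1..K}. (cmod (dcoeff f n))\<^sup>2)"
    by (intro sum_mono2) auto
  also have "\<dots> = (\<Sum>n=1..K. (cmod (dcoeff f n))\<^sup>2)" by simp
  finally show "(\<Sum>n<K. (cmod (dcoeff f n))\<^sup>2) \<le> B" using assms[of K] by linarith
qed

text \<open>
  Both completeness and the construction of \<open>f \<circ> \<phi>\<close> produce a sequence of limit coefficients that is
  only known to have bounded partial square sums.
\<close>

lemma dseries_of_bounded_square_sums:
  assumes "\<And>K. (\<Sum>n=1..K. (cmod (p n))\<^sup>2) \<le> B"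
  obtains d where "\<And>n. n \<ge> 1 \<Longrightarrow> dcoeff d n = p n" "(norm d)\<^sup>2 \<le> B"
proof -
  define q where "q n = (if n = 0 then 0 else p n)" for n :: nat
  have "summable (\<lambda>n. (cmod (q n))\<^sup>2)"
  proof (rule bounded_imp_summable)
    fix K
    have "(\<Sum>n\<le>K. (cmod (q n))\<^sup>2) \<le> (\<Sum>n\<in>insert 0 {1..K}. (cmod (q n))\<^sup>2)"
      by (intro sum_mono2) auto
    also have "\<dots> = (\<Sum>n=1..K. (cmod (p n))\<^sup>2)" by (simp add: q_def)
    finally show "(\<Sum>n\<le>K. (cmod (q n))\<^sup>2) \<le> B" using assms[of K] by linarith
  qed auto
  then have q: "dcoeff (Abs_dseries q) = q" by (intro Abs_dseries_inverse) (simp add: q_def)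
  show thesis
  proof
    show "dcoeff (Abs_dseries q) n = p n" if "n \<ge> 1" for n using that by (simp add: q) (simp add: q_def)
    then show "(norm (Abs_dseries q))\<^sup>2 \<le> B"
      by (intro norm_dseries_square_leI order_trans[OF eq_refl assms] sum.cong) auto
  qed
qed

lemma dseries_Cauchy_limit:
  fixes f :: "nat \<Rightarrow> dseries"
  assumes "Cauchy f"
  obtains l where "f \<longlonglongrightarrow> l"
proof -
  have "Cauchy (\<lambda>k. dcoeff (f k) n)" for n
  proof (rule CauchyI)
    fix e :: real assume "e > 0"
    then obtain M where M: "\<And>k l. k \<ge> M \<Longrightarrow> l \<ge> M \<Longrightarrow> norm (f k - f l) < e"
      using CauchyD[OF assms] by blast
    show "\<exists>M. \<forall>k\<ge>M. \<forall>l\<ge>M. norm (dcoeff (f k) n - dcoeff (f l) n) < e"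
      using M cmod_dcoeff_le[of "f _ - f _" n] unfolding minus_dseries.rep_eq by (meson le_less_trans)
  qed
  then have "\<exists>a. (\<lambda>k. dcoeff (f k) n) \<longlonglongrightarrow> a" for n
    by (simp add: Cauchy_convergent_iff convergent_def)
  then obtain a where a: "\<And>n. (\<lambda>k. dcoeff (f k) n) \<longlonglongrightarrow> a n" by metis
  have tail: "(\<Sum>n=1..K. (cmod (dcoeff (f k) n - a n))\<^sup>2) \<le> e\<^sup>2"
    if M: "\<And>k l. k \<ge> M \<Longrightarrow> l \<ge> M \<Longrightarrow> norm (f k - f l) < e" and k: "k \<ge> M" for e M k K
  proof (rule tendsto_upperbound)
    show "(\<lambda>l. \<Sum>n=1..K. (cmod (dcoeff (f k) n - dcoeff (f l) n))\<^sup>2)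
            \<longlonglongrightarrow> (\<Sum>n=1..K. (cmod (dcoeff (f k) n - a n))\<^sup>2)"
      by (intro tendsto_intros a)
    have "(\<Sum>n=1..K. (cmod (dcoeff (f k) n - dcoeff (f l) n))\<^sup>2) \<le> e\<^sup>2" if l: "l \<ge> M" for l
    proof -
      have "(\<Sum>n=1..K. (cmod (dcoeff (f k) n - dcoeff (f l) n))\<^sup>2) \<le> (norm (f k - f l))\<^sup>2"
        using sum_dcoeff_squares_le[of "{1..K}" "f k - f l"] by (simp add: minus_dseries.rep_eq)
      also have "\<dots> \<le> e\<^sup>2" using M[OF k l] by (intro power_mono) auto
      finally show ?thesis .
    qed
    then show "\<forall>\<^sub>F l in sequentially. (\<Sum>n=1..K. (cmod (dcoeff (f k) n - dcoeff (f l) n))\<^sup>2) \<le> e\<^sup>2"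
      by (auto intro: eventually_sequentiallyI[of M])
  qed auto
  obtain M where M: "\<And>k l. k \<ge> M \<Longrightarrow> l \<ge> M \<Longrightarrow> norm (f k - f l) < 1"
    using CauchyD[OF assms zero_less_one] by blast
  obtain d where d: "\<And>n. n \<ge> 1 \<Longrightarrow> dcoeff d n = dcoeff (f M) n - a n"
    using dseries_of_bounded_square_sums[OF tail[OF M order_refl]] by blast
  have l: "dcoeff (f M - d) n = a n" if "n \<ge> 1" for n
    using d[OF that] by (simp add: minus_dseries.rep_eq)
  have "f \<longlonglongrightarrow> f M - d"
  proof (rule LIMSEQ_I)
    fix e :: real assume e: "e > 0"
    then obtain M' where M': "\<And>k l. k \<ge> M' \<Longrightarrow> l \<ge> M' \<Longrightarrow> norm (f k - f l) < e / 2"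
      using CauchyD[OF assms half_gt_zero[OF e]] by blast
    have "norm (f k - (f M - d)) < e" if "k \<ge> M'" for k
    proof -
      have "(norm (f k - (f M - d)))\<^sup>2 \<le> (e / 2)\<^sup>2"
      proof (rule norm_dseries_square_leI)
        fix K
        have "(\<Sum>n=1..K. (cmod (dcoeff (f k - (f M - d)) n))\<^sup>2) = (\<Sum>n=1..K. (cmod (dcoeff (f k) n - a n))\<^sup>2)"
          by (intro sum.cong refl) (simp add: minus_dseries.rep_eq[of "f k"] l)
        with tail[OF M' that] show "(\<Sum>n=1..K. (cmod (dcoeff (f k - (f M - d)) n))\<^sup>2) \<le> (e / 2)\<^sup>2"
          by simp
      qed
      then have "norm (f k - (f M - d)) \<le> e / 2" by (rule power2_le_imp_le) (use e in simp)
      with e show ?thesis by linarith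
    qed
    then show "\<exists>M'. \<forall>k\<ge>M'. norm (f k - (f M - d)) < e" by auto
  qed
  then show thesis by (rule that)
qed

lemma complete_dseries_UNIV: "complete (UNIV :: dseries set)"
  unfolding complete_def using dseries_Cauchy_limit by (metis UNIV_I)

text \<open>
  The tail of the series of \<open>\<zeta>(2 * x)\<close>: its square root is the norm of evaluation at a point of real part \<open>x\<close> on
  the elements whose first \<open>N\<close> coefficients vanish.
\<close>

definition zeta_tail :: "nat \<Rightarrow> real \<Rightarrow> real" where
  "zeta_tail N x = (\<Sum>n. if n > N then real n powr (- 2 * x) else 0)"

lemma summable_zeta_tail:
  assumes "x > 1/2"
  shows "summable (\<lambda>n. if n > N then real n powr (- 2 * x) else 0)"
proof (rule summable_comparison_test')
  show "summable (\<lambda>n. real n powr (- 2 * x))" using assms by (simp add: summable_real_powr_iff)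
qed auto

lemma zeta_tail_nonneg: "x > 1/2 \<Longrightarrow> zeta_tail N x \<ge> 0"
  unfolding zeta_tail_def by (intro suminf_nonneg summable_zeta_tail) auto

lemma sum_powr_le_zeta_tail:
  assumes "x > 1/2" "finite A" "\<And>n. n \<in> A \<Longrightarrow> n > N"
  shows "(\<Sum>n\<in>A. real n powr (- 2 * x)) \<le> zeta_tail N x"
proof -
  have "(\<Sum>n\<in>A. real n powr (- 2 * x)) = (\<Sum>n\<in>A. if n > N then real n powr (- 2 * x) else 0)"
    using assms(3) by (intro sum.cong) auto
  also have "\<dots> \<le> zeta_tail N x"
    unfolding zeta_tail_def by (intro sum_le_suminf summable_zeta_tail assms) auto
  finally show ?thesis .
qed

lemma zeta_tail_tendsto:
  assumes "x > 1/2"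
  shows "(\<lambda>N. zeta_tail N x) \<longlonglongrightarrow> 0"
proof -
  have s: "summable (\<lambda>n. real n powr (- 2 * x))" using assms by (simp add: summable_real_powr_iff)
  have "zeta_tail N x = (\<Sum>n. real n powr (- 2 * x)) - (\<Sum>n<Suc N. real n powr (- 2 * x))" for N
  proof -
    have "zeta_tail N x = (\<Sum>n. (if n + Suc N > N then real (n + Suc N) powr (- 2 * x) else 0))
        + (\<Sum>n<Suc N. if n > N then real n powr (- 2 * x) else 0)"
      unfolding zeta_tail_def by (rule suminf_split_initial_segment[OF summable_zeta_tail[OF assms]])
    also have "(\<Sum>n<Suc N. if n > N then real n powr (- 2 * x) else 0) = 0"
      by (intro sum.neutral) auto
    also have "(\<Sum>n. (if n + Suc N > N then real (n + Suc N) powr (- 2 * x) else 0)) = (\<Sum>n. real (n + Suc N) powr (- 2 * x))"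
      by simp
    also have "(\<Sum>n. real (n + Suc N) powr (- 2 * x)) = (\<Sum>n. real n powr (- 2 * x)) - (\<Sum>n<Suc N. real n powr (- 2 * x))"
      by (rule suminf_minus_initial_segment[OF s])
    finally show ?thesis by simp
  qed
  moreover have "(\<lambda>N. (\<Sum>n. real n powr (- 2 * x)) - (\<Sum>n<Suc N. real n powr (- 2 * x)))
      \<longlonglongrightarrow> (\<Sum>n. real n powr (- 2 * x)) - (\<Sum>n. real n powr (- 2 * x))"
    by (intro tendsto_intros LIMSEQ_Suc[OF summable_LIMSEQ[OF s]])
  ultimately show ?thesis by simp
qed

lemma sum_norm_dseries_terms_le:
  assumes "Re s > 1/2" "finite A" "\<And>n. n \<in> A \<Longrightarrow> n > N"
  shows "(\<Sum>n\<in>A. cmod (dcoeff f n * of_nat n powr (- s))) \<le> norm f * sqrt (zeta_tail N (Re s))"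
proof (rule power2_le_imp_le)
  have "(\<Sum>n\<in>A. cmod (dcoeff f n * of_nat n powr (- s)))\<^sup>2
      = (\<Sum>n\<in>A. cmod (dcoeff f n) * real n powr (- Re s))\<^sup>2" by (simp add: norm_mult)
  also have "\<dots> \<le> (\<Sum>n\<in>A. (cmod (dcoeff f n))\<^sup>2) * (\<Sum>n\<in>A. (real n powr (- Re s))\<^sup>2)"
    by (rule Cauchy_Schwarz_ineq_sum)
  also have "\<dots> = (\<Sum>n\<in>A. (cmod (dcoeff f n))\<^sup>2) * (\<Sum>n\<in>A. real n powr (- 2 * Re s))"
    by (simp add: power2_eq_square powr_add[symmetric])
  also have "\<dots> \<le> (norm f)\<^sup>2 * zeta_tail N (Re s)"
    by (intro mult_mono sum_dcoeff_squares_le sum_powr_le_zeta_tail assms sum_nonneg) auto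
  also have "\<dots> = (norm f * sqrt (zeta_tail N (Re s)))\<^sup>2"
    using zeta_tail_nonneg[OF assms(1)] by (simp add: power_mult_distrib)
  finally show "(\<Sum>n\<in>A. cmod (dcoeff f n * of_nat n powr (- s)))\<^sup>2 \<le> (norm f * sqrt (zeta_tail N (Re s)))\<^sup>2" .
qed (use zeta_tail_nonneg[OF assms(1)] in simp)

lemma summable_dseries_terms:
  assumes "Re s > 1/2"
  shows "summable (\<lambda>n. dcoeff f n * of_nat n powr (- s))"
proof (rule summable_norm_cancel, rule bounded_imp_summable)
  fix K
  have "(\<Sum>n\<le>K. cmod (dcoeff f n * of_nat n powr (- s))) = (\<Sum>n=1..K. cmod (dcoeff f n * of_nat n powr (- s)))"
    by (intro sum.mono_neutral_right) (auto simp: Suc_le_eq)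
  also have "\<dots> \<le> norm f * sqrt (zeta_tail 0 (Re s))"
    by (rule sum_norm_dseries_terms_le[OF assms]) auto
  finally show "(\<Sum>n\<le>K. norm (dcoeff f n * of_nat n powr (- s))) \<le> norm f * sqrt (zeta_tail 0 (Re s))" .
qed auto

lemma dseries_eval_sums:
  assumes "Re s > 1/2"
  shows "(\<lambda>n. dcoeff f n * of_nat n powr (- s)) sums dseries_eval f s"
  unfolding dseries_eval_def dirichlet_series_def by (intro summable_sums summable_dseries_terms assms)

lemma dpoly_tendsto_dseries_eval:
  assumes "Re s > 1/2"
  shows "(\<lambda>N. dpoly (dcoeff f) N s) \<longlonglongrightarrow> dseries_eval f s"
proof -
  have "dpoly (dcoeff f) N s = (\<Sum>n<Suc N. dcoeff f n * of_nat n powr (- s))" for N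
    unfolding dpoly_def by (intro sum.mono_neutral_left) (auto simp: Suc_le_eq)
  then show ?thesis
    using LIMSEQ_Suc[OF dseries_eval_sums[OF assms, unfolded sums_def]] by simp
qed

lemma dseries_eval_minus_dpoly_le:
  assumes "Re s > 1/2"
  shows "cmod (dseries_eval f s - dpoly (dcoeff f) N s) \<le> norm f * sqrt (zeta_tail N (Re s))"
proof (rule tendsto_upperbound)
  show "(\<lambda>M. cmod (dpoly (dcoeff f) M s - dpoly (dcoeff f) N s)) \<longlonglongrightarrow> cmod (dseries_eval f s - dpoly (dcoeff f) N s)"
    by (intro tendsto_intros dpoly_tendsto_dseries_eval assms)
  have "cmod (dpoly (dcoeff f) M s - dpoly (dcoeff f) N s) \<le> norm f * sqrt (zeta_tail N (Re s))" if "M \<ge> N" for M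
  proof -
    have "dpoly (dcoeff f) M s - dpoly (dcoeff f) N s = (\<Sum>n\<in>{1..M} - {1..N}. dcoeff f n * of_nat n powr (- s))"
      unfolding dpoly_def using that by (subst sum_diff) auto
    also have "cmod \<dots> \<le> (\<Sum>n\<in>{1..M} - {1..N}. cmod (dcoeff f n * of_nat n powr (- s)))"
      by (rule norm_sum)
    also have "\<dots> \<le> norm f * sqrt (zeta_tail N (Re s))"
      by (rule sum_norm_dseries_terms_le[OF assms]) auto
    finally show ?thesis .
  qed
  then show "\<forall>\<^sub>F M in sequentially. cmod (dpoly (dcoeff f) M s - dpoly (dcoeff f) N s) \<le> norm f * sqrt (zeta_tail N (Re s))"
    by (auto intro: eventually_sequentiallyI[of N])
qed auto

lemma dseries_eval_bound:
  assumes "Re s > 1/2"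
  shows "cmod (dseries_eval f s) \<le> norm f * sqrt (zeta_tail 0 (Re s))"
  using dseries_eval_minus_dpoly_le[OF assms, of f 0] by (simp add: dpoly_def)

lemma zeta_tail_antimono:
  assumes "1/2 < x" "x \<le> y"
  shows "zeta_tail N y \<le> zeta_tail N x"
  unfolding zeta_tail_def using assms by (intro suminf_le summable_zeta_tail) (auto intro!: powr_mono)

lemma dseries_eval_add:
  assumes "Re s > 1/2"
  shows "dseries_eval (f + g) s = dseries_eval f s + dseries_eval g s"
  using sums_add[OF dseries_eval_sums[OF assms, of f] dseries_eval_sums[OF assms, of g]]
    dseries_eval_sums[OF assms, of "f + g"]
  by (simp add: plus_dseries.rep_eq distrib_right sums_unique2)

lemma dseries_eval_scaleR:
  assumes "Re s > 1/2"
  shows "dseries_eval (r *\<^sub>R f) s = r *\<^sub>R dseries_eval f s"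
  using sums_scaleR_right[OF dseries_eval_sums[OF assms, of f], of r]
    dseries_eval_sums[OF assms, of "r *\<^sub>R f"]
  by (simp add: scaleR_dseries.rep_eq sums_unique2)

lemma dseries_eval_diff:
  assumes "Re s > 1/2"
  shows "dseries_eval (f - g) s = dseries_eval f s - dseries_eval g s"
  using dseries_eval_add[OF assms, of f "(-1) *\<^sub>R g"] dseries_eval_scaleR[OF assms, of "-1" g] by simp

text \<open>
  The difference \<open>d\<close> of the two elements vanishes on the line \<open>Re s = 1\<close>, so its partial sums are
  uniformly small there, and the mean value inequality bounds each coefficient by this supremum.
\<close>

lemma dseries_eqI_eval:
  assumes "\<And>s. Re s > 1/2 \<Longrightarrow> dseries_eval f s = dseries_eval g s"
  shows "f = g"
proof -
  define d where "d = f - g"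
  have d: "dseries_eval d s = 0" if "Re s > 1/2" for s
    using assms[OF that] dseries_eval_diff[OF that] by (simp add: d_def)
  have "dcoeff d n = 0" if n: "n \<ge> 1" for n
  proof -
    define B where "B K = (norm d)\<^sup>2 * zeta_tail K 1" for K
    have le: "(cmod (dcoeff d n))\<^sup>2 * real n powr (- 2 * 1) \<le> B K" if K: "K \<ge> n" for K
    proof -
      have "(cmod (dcoeff d n))\<^sup>2 * real n powr (- 2 * 1)
         \<le> (\<Sum>m=1..K. (cmod (dcoeff d m))\<^sup>2 * real m powr (- 2 * 1))"
        using n K by (intro member_le_sum[where f = "\<lambda>m. (cmod (dcoeff d m))\<^sup>2 * real m powr (- 2 * 1)"]) auto
      also have "\<dots> \<le> Re ((\<lambda>_. complex_of_real (B K)) 1)"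
      proof (rule dpoly_square_sum_le_mean)
        fix t
        have "cmod (dpoly (dcoeff d) K (of_real 1 + \<i> * of_real t)) \<le> norm d * sqrt (zeta_tail K 1)"
          using dseries_eval_minus_dpoly_le[of "of_real 1 + \<i> * of_real t" d K] d[of "of_real 1 + \<i> * of_real t"] by simp
        then have "(cmod (dpoly (dcoeff d) K (of_real 1 + \<i> * of_real t)))\<^sup>2 \<le> (norm d * sqrt (zeta_tail K 1))\<^sup>2"
          by (rule power_mono) simp
        then show "(cmod (dpoly (dcoeff d) K (of_real 1 + \<i> * of_real t)))\<^sup>2
          \<le> Re (dpoly (\<lambda>_. complex_of_real (B K)) 1 (of_real 1 + \<i> * of_real t))"
          using zeta_tail_nonneg[of 1 K] by (simp add: dpoly_def B_def power_mult_distrib)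
      qed simp
      finally show ?thesis by simp
    qed
    have "B \<longlonglongrightarrow> (norm d)\<^sup>2 * 0"
      unfolding B_def by (intro tendsto_intros zeta_tail_tendsto) simp
    then have "(cmod (dcoeff d n))\<^sup>2 * real n powr (- 2 * 1) \<le> (norm d)\<^sup>2 * 0"
      by (rule tendsto_lowerbound) (use le in \<open>auto intro: eventually_sequentiallyI[of n]\<close>)
    then show ?thesis using n by (simp add: mult_le_0_iff)
  qed
  then have "d = 0" by (intro dseries_eqI) (simp add: zero_dseries.rep_eq)
  then show ?thesis by (simp add: d_def)
qed

lift_definition dtrunc :: "nat \<Rightarrow> dseries \<Rightarrow> dseries" is "\<lambda>N a n. if n \<le> N then a n else 0"
proof -
  fix N and a :: "nat \<Rightarrow> complex"
  assume a: "a 0 = 0 \<and> summable (\<lambda>n. (cmod (a n))\<^sup>2)"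
  then show "(if 0 \<le> N then a 0 else 0) = 0 \<and> summable (\<lambda>n. (cmod (if n \<le> N then a n else 0))\<^sup>2)"
    by (auto intro!: summable_comparison_test'[of "\<lambda>n. (cmod (a n))\<^sup>2"])
qed

lemma dcoeff_dtrunc: "dcoeff (dtrunc N f) n = (if n \<le> N then dcoeff f n else 0)"
  by (simp add: dtrunc.rep_eq)

lemma dseries_eval_finite_support:
  assumes "\<And>n. n > N \<Longrightarrow> dcoeff f n = 0"
  shows "dseries_eval f s = dpoly (dcoeff f) N s"
  unfolding dseries_eval_def dirichlet_series_def dpoly_def
  by (rule suminf_finite) (use assms in \<open>auto simp: Suc_le_eq not_le intro: ccontr\<close>)

lemma dtrunc_tendsto: "(\<lambda>N. dtrunc N f) \<longlonglongrightarrow> f"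
proof -
  have "(norm (dtrunc N f - f))\<^sup>2 = (norm f)\<^sup>2 - (\<Sum>n<Suc N. (cmod (dcoeff f n))\<^sup>2)" for N
  proof -
    have "(norm (dtrunc N f - f))\<^sup>2
      = (\<Sum>n. (cmod (dcoeff (dtrunc N f - f) (n + Suc N)))\<^sup>2) + (\<Sum>n<Suc N. (cmod (dcoeff (dtrunc N f - f) n))\<^sup>2)"
      unfolding norm_dseries_square by (rule suminf_split_initial_segment[OF summable_dcoeff_squares])
    also have "\<dots> = (\<Sum>n. (cmod (dcoeff f (n + Suc N)))\<^sup>2)"
      by (simp add: minus_dseries.rep_eq dcoeff_dtrunc del: sum.lessThan_Suc)
    also have "\<dots> = (norm f)\<^sup>2 - (\<Sum>n<Suc N. (cmod (dcoeff f n))\<^sup>2)"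
      unfolding norm_dseries_square by (rule suminf_minus_initial_segment[OF summable_dcoeff_squares])
    finally show ?thesis .
  qed
  moreover have "(\<lambda>N. (norm f)\<^sup>2 - (\<Sum>n<Suc N. (cmod (dcoeff f n))\<^sup>2)) \<longlonglongrightarrow> (norm f)\<^sup>2 - (norm f)\<^sup>2"
    unfolding norm_dseries_square
    by (intro tendsto_intros LIMSEQ_Suc[OF summable_LIMSEQ[OF summable_dcoeff_squares]])
  ultimately have "(\<lambda>N. (norm (dtrunc N f - f))\<^sup>2) \<longlonglongrightarrow> 0" by simp
  then have "(\<lambda>N. sqrt ((norm (dtrunc N f - f))\<^sup>2)) \<longlonglongrightarrow> sqrt 0" by (intro tendsto_intros)
  then show ?thesis by (simp add: tendsto_norm_zero_iff Lim_null[symmetric] LIM_zero_iff)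
qed

lemma norm_dtrunc_diff_le: "norm (dtrunc M f - dtrunc N f) \<le> norm f"
proof (rule power2_le_imp_le[OF norm_dseries_square_leI])
  fix K
  have "(\<Sum>n=1..K. (cmod (dcoeff (dtrunc M f - dtrunc N f) n))\<^sup>2) \<le> (\<Sum>n=1..K. (cmod (dcoeff f n))\<^sup>2)"
    by (intro sum_mono) (simp add: minus_dseries.rep_eq dcoeff_dtrunc)
  also have "\<dots> \<le> (norm f)\<^sup>2" by (rule sum_dcoeff_squares_le) simp
  finally show "(\<Sum>n=1..K. (cmod (dcoeff (dtrunc M f - dtrunc N f) n))\<^sup>2) \<le> (norm f)\<^sup>2" .
qed simp

section \<open>From a pointwise majorant to membership in the Hilbert space\<close>

lemma partial_sums_tendsto_constant_term:
  assumes "\<And>\<eta>. \<eta> > 0 \<Longrightarrow> \<exists>N\<ge>1. \<forall>s. Re s > \<epsilon> \<longrightarrow> cmod (g s - dpoly c N s) \<le> \<eta>"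
  shows "((\<lambda>x. g (of_real x)) \<longlongrightarrow> c 1) at_top"
proof (rule tendstoI)
  fix e :: real assume e: "e > 0"
  then obtain N where N: "N \<ge> 1" "\<And>s. Re s > \<epsilon> \<Longrightarrow> cmod (g s - dpoly c N s) \<le> e / 2"
    using assms[OF half_gt_zero[OF e]] by blast
  have "\<forall>\<^sub>F x in at_top. dist (dpoly c N (of_real x)) (c 1) < e / 2"
    by (rule tendstoD[OF dpoly_tendsto[OF N(1)]]) (use e in simp)
  with eventually_gt_at_top[of \<epsilon>] show "\<forall>\<^sub>F x in at_top. dist (g (of_real x)) (c 1) < e"
  proof eventually_elim
    case (elim x)
    then have "dist (g (of_real x)) (dpoly c N (of_real x)) \<le> e / 2"
      using N(2)[of "of_real x"] by (simp add: dist_norm)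
    with elim(2) dist_triangle[of "g (of_real x)" "c 1" "dpoly c N (of_real x)"] show ?case by linarith
  qed
qed

lemma dseries_eval_tendsto:
  "((\<lambda>x. dseries_eval d (of_real x)) \<longlongrightarrow> dcoeff d 1) at_top"
proof (rule partial_sums_tendsto_constant_term)
  fix e :: real assume e: "e > 0"
  have "(\<lambda>N. norm d * sqrt (zeta_tail N 1)) \<longlonglongrightarrow> norm d * sqrt 0"
    by (intro tendsto_intros zeta_tail_tendsto) simp
  then have "(\<lambda>N. norm d * sqrt (zeta_tail N 1)) \<longlonglongrightarrow> 0" by simp
  then have "\<forall>\<^sub>F N in sequentially. norm d * sqrt (zeta_tail N 1) < e"
    by (rule order_tendstoD) (use e in simp)
  with eventually_ge_at_top[of 1] have "\<forall>\<^sub>F N in sequentially. N \<ge> 1 \<and> norm d * sqrt (zeta_tail N 1) < e"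
    by eventually_elim simp
  then obtain N where N: "N \<ge> 1" "norm d * sqrt (zeta_tail N 1) < e"
    using eventually_happens trivial_limit_sequentially by blast
  have "cmod (dseries_eval d s - dpoly (dcoeff d) N s) \<le> e" if s: "Re s > 1" for s
  proof -
    have "cmod (dseries_eval d s - dpoly (dcoeff d) N s) \<le> norm d * sqrt (zeta_tail N (Re s))"
      using s by (intro dseries_eval_minus_dpoly_le) simp
    also have "\<dots> \<le> norm d * sqrt (zeta_tail N 1)"
      using zeta_tail_antimono[of 1 "Re s" N] s by (intro mult_left_mono) auto
    finally show ?thesis using N(2) by linarith
  qed
  with N(1) show "\<exists>N\<ge>1. \<forall>s. Re s > 1 \<longrightarrow> cmod (dseries_eval d s - dpoly (dcoeff d) N s) \<le> e" by blast
qed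

lemma dpoly_bound_imp_square_sum_le:
  assumes "\<And>s. Re s = \<sigma> \<Longrightarrow> cmod (dpoly p N s) \<le> B"
  shows "(\<Sum>n=1..N. (cmod (p n))\<^sup>2 * real n powr (- 2 * \<sigma>)) \<le> B\<^sup>2"
proof -
  have "(\<Sum>n=1..N. (cmod (p n))\<^sup>2 * real n powr (- 2 * \<sigma>)) \<le> Re ((\<lambda>_. complex_of_real (B\<^sup>2)) 1)"
  proof (rule dpoly_square_sum_le_mean)
    fix t
    have "(cmod (dpoly p N (of_real \<sigma> + \<i> * of_real t)))\<^sup>2 \<le> B\<^sup>2"
      by (intro power_mono assms) auto
    then show "(cmod (dpoly p N (of_real \<sigma> + \<i> * of_real t)))\<^sup>2
        \<le> Re (dpoly (\<lambda>_. complex_of_real (B\<^sup>2)) 1 (of_real \<sigma> + \<i> * of_real t))"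
      by (simp add: dpoly_def)
  qed simp
  then show ?thesis by (simp only: Re_complex_of_real)
qed

text \<open>
  The coefficients of good approximants form Cauchy sequences, because the weighted square sum of the
  difference of two approximants is at most the square of the supremum of their difference on a line.
  One sequence of approximants, accurate to \<open>1 / (k + 1)\<close> on \<open>half_plane (1 / (k + 1))\<close>, serves all lines
  \<open>Re s = \<sigma>\<close> at once, so the limit coefficients do not depend on \<open>\<sigma>\<close>.
\<close>

lemma approximable_coefficients:
  assumes g: "\<And>\<epsilon>. \<epsilon> > 0 \<Longrightarrow> approximable \<epsilon> g"
  obtains a :: "nat \<Rightarrow> complex" where
    "\<And>\<sigma> \<eta>. \<sigma> > 0 \<Longrightarrow> \<eta> > 0 \<Longrightarrow> \<exists>p N. (\<forall>s. Re s \<ge> \<sigma> \<longrightarrow> cmod (g s - dpoly p N s) \<le> \<eta>) \<and>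
        (\<forall>n>N. p n = 0) \<and> (\<forall>K. (\<Sum>n=1..K. (cmod (p n - a n))\<^sup>2 * real n powr (- 2 * \<sigma>)) \<le> \<eta>\<^sup>2)"
proof -
  define \<eta> where "\<eta> k = inverse (real (Suc k))" for k
  have \<eta>: "\<eta> k > 0" for k by (simp add: \<eta>_def)
  have \<eta>_lim: "\<eta> \<longlonglongrightarrow> 0" unfolding \<eta>_def by (rule LIMSEQ_inverse_real_of_nat)
  have "\<exists>p N. (\<forall>s. Re s > \<eta> k \<longrightarrow> cmod (g s - dpoly p N s) \<le> \<eta> k) \<and> (\<forall>n>N. p n = 0)" for k
  proof -
    obtain p N where p: "\<And>s. Re s > \<eta> k \<Longrightarrow> cmod (g s - dpoly p N s) \<le> \<eta> k"
      using approximableD[OF g[OF \<eta>] \<eta>] by blast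
    have "dpoly (\<lambda>n. if n \<le> N then p n else 0) N s = dpoly p N s" for s
      using dpoly_extend[of N N p s] by simp
    with p show ?thesis by (intro exI[of _ "\<lambda>n. if n \<le> N then p n else 0"] exI[of _ N]) auto
  qed
  then obtain p N where p: "\<And>k s. Re s > \<eta> k \<Longrightarrow> cmod (g s - dpoly (p k) (N k) s) \<le> \<eta> k"
    and p0: "\<And>k n. n > N k \<Longrightarrow> p k n = 0" by metis
  have ext: "dpoly (p k) (N k) s = dpoly (p k) K s" if "K \<ge> N k" for k K s
    unfolding dpoly_def using that p0[of k] by (intro sum.mono_neutral_left) auto
  have close: "(\<Sum>n=1..K. (cmod (p k n - p l n))\<^sup>2 * real n powr (- 2 * \<sigma>)) \<le> (\<eta> k + \<eta> l)\<^sup>2"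
    if "\<eta> k < \<sigma>" "\<eta> l < \<sigma>" for k l K \<sigma>
  proof -
    define K' where "K' = max K (max (N k) (N l))"
    have "(\<Sum>n=1..K. (cmod (p k n - p l n))\<^sup>2 * real n powr (- 2 * \<sigma>))
        \<le> (\<Sum>n=1..K'. (cmod (p k n - p l n))\<^sup>2 * real n powr (- 2 * \<sigma>))"
      by (intro sum_mono2) (auto simp: K'_def)
    also have "\<dots> \<le> (\<eta> k + \<eta> l)\<^sup>2"
    proof (rule dpoly_bound_imp_square_sum_le)
      fix s assume s: "Re s = \<sigma>"
      have "dpoly (\<lambda>n. p k n - p l n) K' s = (g s - dpoly (p l) (N l) s) - (g s - dpoly (p k) (N k) s)"
        by (simp add: ext[of k K'] ext[of l K'] K'_def dpoly_diff)
      also have "cmod \<dots> \<le> cmod (g s - dpoly (p l) (N l) s) + cmod (g s - dpoly (p k) (N k) s)"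
        by (rule norm_triangle_ineq4)
      also have "\<dots> \<le> \<eta> l + \<eta> k"
        using p[of l s] p[of k s] that s by (intro add_mono) auto
      finally show "cmod (dpoly (\<lambda>n. p k n - p l n) K' s) \<le> \<eta> k + \<eta> l" by simp
    qed
    finally show ?thesis .
  qed
  have "Cauchy (\<lambda>k. p k n)" if n: "n \<ge> 1" for n
  proof (rule CauchyI)
    fix e :: real assume e: "e > 0"
    have "\<forall>\<^sub>F k in sequentially. \<eta> k < 1 \<and> \<eta> k < e / (2 * real n)"
      using order_tendstoD(2)[OF \<eta>_lim] e n by (intro eventually_conj) auto
    then obtain M where M: "\<And>k. k \<ge> M \<Longrightarrow> \<eta> k < 1 \<and> \<eta> k < e / (2 * real n)"
      by (auto simp: eventually_sequentially)
    have "cmod (p k n - p l n) < e" if kl: "k \<ge> M" "l \<ge> M" for k l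
    proof -
      have "(cmod (p k n - p l n))\<^sup>2 * real n powr (- 2 * 1)
          \<le> (\<Sum>m=1..n. (cmod (p k m - p l m))\<^sup>2 * real m powr (- 2 * 1))"
        using n by (intro member_le_sum[where f = "\<lambda>m. (cmod (p k m - p l m))\<^sup>2 * real m powr (- 2 * 1)"]) auto
      also have "\<dots> \<le> (\<eta> k + \<eta> l)\<^sup>2" using M[OF kl(1)] M[OF kl(2)] by (intro close) auto
      also have "real n powr (- 2 * 1) = 1 / (real n)\<^sup>2"
        using n by (simp add: powr_minus powr_numeral divide_inverse)
      finally have "(cmod (p k n - p l n))\<^sup>2 \<le> ((\<eta> k + \<eta> l) * real n)\<^sup>2"
        using n by (simp add: power_mult_distrib pos_divide_le_eq)
      then have "cmod (p k n - p l n) \<le> (\<eta> k + \<eta> l) * real n"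
        by (rule power2_le_imp_le) (simp add: \<eta> less_imp_le add_nonneg_nonneg)
      also have "\<dots> < (e / (2 * real n) + e / (2 * real n)) * real n"
        using M[OF kl(1)] M[OF kl(2)] n by (intro mult_strict_right_mono add_strict_mono) auto
      also have "\<dots> = e" using n by simp
      finally show ?thesis .
    qed
    then show "\<exists>M. \<forall>k\<ge>M. \<forall>l\<ge>M. cmod (p k n - p l n) < e" by blast
  qed
  then have "\<forall>n. \<exists>a. n \<ge> 1 \<longrightarrow> (\<lambda>k. p k n) \<longlonglongrightarrow> a"
    by (auto simp: Cauchy_convergent_iff convergent_def)
  then obtain a where a: "\<And>n. n \<ge> 1 \<Longrightarrow> (\<lambda>k. p k n) \<longlonglongrightarrow> a n" by metis
  show thesis
  proof (rule that[of a])
    fix \<sigma> \<eta>' :: real assume \<sigma>: "\<sigma> > 0" "\<eta>' > 0"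
    have ev: "\<forall>\<^sub>F k in sequentially. \<eta> k < \<sigma> \<and> \<eta> k < \<eta>'"
      using order_tendstoD(2)[OF \<eta>_lim] \<sigma> by (intro eventually_conj) auto
    then obtain k where k: "\<eta> k < \<sigma>" "\<eta> k < \<eta>'"
      using eventually_happens trivial_limit_sequentially by blast
    have "(\<Sum>n=1..K. (cmod (p k n - a n))\<^sup>2 * real n powr (- 2 * \<sigma>)) \<le> \<eta>'\<^sup>2" for K
    proof -
      have "(\<Sum>n=1..K. (cmod (p k n - a n))\<^sup>2 * real n powr (- 2 * \<sigma>)) \<le> (\<eta> k + 0)\<^sup>2"
      proof (rule LIMSEQ_le)
        show "(\<lambda>l. \<Sum>n=1..K. (cmod (p k n - p l n))\<^sup>2 * real n powr (- 2 * \<sigma>))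
                \<longlonglongrightarrow> (\<Sum>n=1..K. (cmod (p k n - a n))\<^sup>2 * real n powr (- 2 * \<sigma>))"
          by (intro tendsto_intros a) auto
        show "(\<lambda>l. (\<eta> k + \<eta> l)\<^sup>2) \<longlonglongrightarrow> (\<eta> k + 0)\<^sup>2" by (intro tendsto_intros \<eta>_lim)
        show "\<exists>M. \<forall>l\<ge>M. (\<Sum>n=1..K. (cmod (p k n - p l n))\<^sup>2 * real n powr (- 2 * \<sigma>)) \<le> (\<eta> k + \<eta> l)\<^sup>2"
          using ev close[OF k(1)] unfolding eventually_sequentially by blast
      qed
      also have "\<dots> \<le> \<eta>'\<^sup>2" using k(2) \<eta>[of k] by (intro power_mono) auto
      finally show ?thesis .
    qed
    moreover have "cmod (g s - dpoly (p k) (N k) s) \<le> \<eta>'" if "Re s \<ge> \<sigma>" for s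
      using p[of k s] that k by linarith
    ultimately show "\<exists>p N. (\<forall>s. Re s \<ge> \<sigma> \<longrightarrow> cmod (g s - dpoly p N s) \<le> \<eta>') \<and>
        (\<forall>n>N. p n = 0) \<and> (\<forall>K. (\<Sum>n=1..K. (cmod (p n - a n))\<^sup>2 * real n powr (- 2 * \<sigma>)) \<le> \<eta>'\<^sup>2)"
      using p0[of k] by (intro exI[of _ "p k"] exI[of _ "N k"]) auto
  qed
qed

text \<open>
  The mean over the line \<open>Re s = \<sigma>\<close> of \<open>\<bar>g\<bar>\<^sup>2\<close> is the square sum of the coefficients with weight
  \<open>n powr (- 2 * \<sigma>)\<close>, while the mean of \<open>Re G\<close> is \<open>Re l\<close> for every \<open>\<sigma>\<close>, since only the constant term of
  \<open>G\<close> survives. Letting \<open>\<sigma> \<rightarrow> 0\<close> removes the weight.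
\<close>

lemma dominated_approximable_is_dseries:
  assumes g: "\<And>\<epsilon>. \<epsilon> > 0 \<Longrightarrow> approximable \<epsilon> g" and G: "\<And>\<epsilon>. \<epsilon> > 0 \<Longrightarrow> approximable \<epsilon> G"
    and le: "\<And>s. Re s > 0 \<Longrightarrow> (cmod (g s))\<^sup>2 \<le> Re (G s)"
    and lim: "((\<lambda>x. G (of_real x)) \<longlongrightarrow> l) at_top"
  obtains d where "\<And>s. Re s > 1/2 \<Longrightarrow> dseries_eval d s = g s" "(norm d)\<^sup>2 \<le> Re l"
proof -
  obtain a where a: "\<And>\<sigma> \<eta>. \<sigma> > 0 \<Longrightarrow> \<eta> > 0 \<Longrightarrow> \<exists>p N. (\<forall>s. Re s \<ge> \<sigma> \<longrightarrow> cmod (g s - dpoly p N s) \<le> \<eta>) \<and>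
        (\<forall>n>N. p n = 0) \<and> (\<forall>K. (\<Sum>n=1..K. (cmod (p n - a n))\<^sup>2 * real n powr (- 2 * \<sigma>)) \<le> \<eta>\<^sup>2)"
    using approximable_coefficients[OF g] by blast
  have weighted: "(\<Sum>n=1..K. (cmod (a n))\<^sup>2 * real n powr (- 2 * \<sigma>)) \<le> Re l" if \<sigma>: "\<sigma> > 0" for \<sigma> K
  proof -
    have \<sigma>2: "\<sigma> / 2 > 0" using \<sigma> by simp
    then obtain B where B: "B > 0" "\<And>s. Re s > \<sigma> / 2 \<Longrightarrow> cmod (g s) \<le> B"
      using approximable_bounded[OF g[OF \<sigma>2]] by auto
    have root_le: "sqrt (\<Sum>n=1..K. (cmod (a n))\<^sup>2 * real n powr (- 2 * \<sigma>)) \<le> sqrt (Re l + \<eta> * (2 * B + 3)) + \<eta>"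
      if \<eta>: "\<eta> > 0" "\<eta> \<le> 1" for \<eta>
    proof -
      obtain p N where p: "\<And>s. Re s \<ge> \<sigma> \<Longrightarrow> cmod (g s - dpoly p N s) \<le> \<eta>"
        and p0: "\<And>n. n > N \<Longrightarrow> p n = 0"
        and pa: "(\<Sum>n=1..K. (cmod (p n - a n))\<^sup>2 * real n powr (- 2 * \<sigma>)) \<le> \<eta>\<^sup>2"
        using a[OF \<sigma> \<eta>(1)] by blast
      obtain q M where M: "M \<ge> 1" and q: "\<And>s. Re s > \<sigma> / 2 \<Longrightarrow> cmod (G s - dpoly q M s) \<le> \<eta>"
        using approximableD[OF G[OF \<sigma>2] \<eta>(1)] by blast
      \<comment> \<open>All approximation errors are absorbed in the constant term of the majorant.\<close>
      define r where "r n = q n + (if n = 1 then of_real (\<eta> * (2 * B + 2)) else 0)" for n :: nat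
      have r: "dpoly r M s = dpoly q M s + of_real (\<eta> * (2 * B + 2))" for s
      proof -
        have "dpoly r M s = dpoly q M s
            + (\<Sum>n=1..M. (if n = 1 then of_real (\<eta> * (2 * B + 2)) else 0) * of_nat n powr (- s))"
          by (simp add: dpoly_def r_def distrib_right sum.distrib)
        also have "(\<Sum>n=1..M. (if n = 1 then of_real (\<eta> * (2 * B + 2)) else 0) * of_nat n powr (- s))
            = (\<Sum>n=1..M. if n = 1 then of_real (\<eta> * (2 * B + 2)) else 0 :: complex)"
          by (intro sum.cong) auto
        finally show ?thesis using M by simp
      qed
      have "(\<Sum>n=1..K. (cmod (p n))\<^sup>2 * real n powr (- 2 * \<sigma>))
          \<le> (\<Sum>n=1..max K N. (cmod (p n))\<^sup>2 * real n powr (- 2 * \<sigma>))"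
        by (intro sum_mono2) auto
      also have "\<dots> \<le> Re (r 1)"
      proof (rule dpoly_square_sum_le_mean[OF M])
        fix t
        define s where "s = of_real \<sigma> + \<i> * of_real t"
        have s: "Re s = \<sigma>" by (simp add: s_def)
        have ext: "dpoly p (max K N) s = dpoly p N s"
          unfolding dpoly_def using p0 by (intro sum.mono_neutral_right) auto
        have "cmod (dpoly p N s) \<le> cmod (g s) + \<eta>"
          using p[of s] s norm_triangle_sub[of "dpoly p N s" "g s"] by (simp add: norm_minus_commute)
        then have "(cmod (dpoly p N s))\<^sup>2 \<le> (cmod (g s) + \<eta>)\<^sup>2" by (intro power_mono) auto
        also have "\<dots> = (cmod (g s))\<^sup>2 + \<eta> * (2 * cmod (g s) + \<eta>)"
          by (simp add: power2_eq_square algebra_simps)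
        also have "\<dots> \<le> Re (G s) + \<eta> * (2 * B + 1)"
          using le[of s] B(2)[of s] s \<sigma> \<eta> by (intro add_mono mult_left_mono) auto
        also have "Re (G s) \<le> Re (dpoly q M s) + \<eta>"
          using q[of s] s \<sigma> complex_Re_le_cmod[of "G s - dpoly q M s"] by simp
        finally show "(cmod (dpoly p (max K N) (of_real \<sigma> + \<i> * of_real t)))\<^sup>2
            \<le> Re (dpoly r M (of_real \<sigma> + \<i> * of_real t))"
          unfolding s_def[symmetric] ext r by (simp add: algebra_simps)
      qed
      also have "\<dots> \<le> Re l + \<eta> * (2 * B + 3)"
        using approximable_constant_term[where \<epsilon> = "\<sigma> / 2", OF q M lim] complex_Re_le_cmod[of "q 1 - l"]
        by (simp add: r_def algebra_simps norm_minus_commute)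
      finally have p_le: "(\<Sum>n=1..K. (cmod (p n))\<^sup>2 * real n powr (- 2 * \<sigma>)) \<le> Re l + \<eta> * (2 * B + 3)" .
      define v where "v n = real n powr (- \<sigma>)" for n :: nat
      have v: "(x * v n)\<^sup>2 = x\<^sup>2 * real n powr (- 2 * \<sigma>)" for x :: real and n
        by (simp add: v_def power_mult_distrib) (simp add: power2_eq_square powr_add[symmetric])
      have "sqrt (\<Sum>n=1..K. (cmod (a n))\<^sup>2 * real n powr (- 2 * \<sigma>)) = L2_set (\<lambda>n. cmod (a n) * v n) {1..K}"
        by (simp add: L2_set_def v)
      also have "\<dots> \<le> L2_set (\<lambda>n. cmod (p n) * v n + cmod (p n - a n) * v n) {1..K}"
      proof (rule L2_set_mono)
        fix n
        have "cmod (a n) \<le> cmod (p n) + cmod (p n - a n)"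
          using norm_triangle_sub[of "a n" "p n"] by (simp add: norm_minus_commute)
        then have "cmod (a n) * v n \<le> (cmod (p n) + cmod (p n - a n)) * v n"
          by (rule mult_right_mono) (simp add: v_def)
        then show "cmod (a n) * v n \<le> cmod (p n) * v n + cmod (p n - a n) * v n"
          by (simp add: algebra_simps)
      qed (simp add: v_def)
      also have "\<dots> \<le> L2_set (\<lambda>n. cmod (p n) * v n) {1..K} + L2_set (\<lambda>n. cmod (p n - a n) * v n) {1..K}"
        by (rule L2_set_triangle_ineq)
      also have "L2_set (\<lambda>n. cmod (p n) * v n) {1..K} \<le> sqrt (Re l + \<eta> * (2 * B + 3))"
        unfolding L2_set_def v by (rule real_sqrt_le_mono[OF p_le])
      also have "L2_set (\<lambda>n. cmod (p n - a n) * v n) {1..K} \<le> \<eta>"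
        unfolding L2_set_def v using real_sqrt_le_mono[OF pa] \<eta> by simp
      finally show ?thesis by simp
    qed
    have "((\<lambda>\<eta>. sqrt (Re l + \<eta> * (2 * B + 3)) + \<eta>) \<longlongrightarrow> sqrt (Re l + 0 * (2 * B + 3)) + 0) (at_right 0)"
      by (intro tendsto_intros)
    moreover have "\<forall>\<^sub>F \<eta> in at_right 0. sqrt (\<Sum>n=1..K. (cmod (a n))\<^sup>2 * real n powr (- 2 * \<sigma>))
        \<le> sqrt (Re l + \<eta> * (2 * B + 3)) + \<eta>"
      unfolding eventually_at_right_field using root_le by (intro exI[of _ 1]) auto
    ultimately have "sqrt (\<Sum>n=1..K. (cmod (a n))\<^sup>2 * real n powr (- 2 * \<sigma>)) \<le> sqrt (Re l + 0 * (2 * B + 3)) + 0"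
      by (rule tendsto_lowerbound) simp
    then show ?thesis by simp
  qed
  have "(\<Sum>n=1..K. (cmod (a n))\<^sup>2) \<le> Re l" for K
  proof -
    have "((\<lambda>\<sigma>. \<Sum>n=1..K. (cmod (a n))\<^sup>2 * real n powr (- 2 * \<sigma>)) \<longlongrightarrow> (\<Sum>n=1..K. (cmod (a n))\<^sup>2 * real n powr (- 2 * 0))) (at_right 0)"
      by (intro tendsto_intros) auto
    then have "(\<Sum>n=1..K. (cmod (a n))\<^sup>2 * real n powr (- 2 * 0)) \<le> Re l"
      by (rule tendsto_upperbound) (use weighted in \<open>auto simp: eventually_at_right_field intro!: exI[of _ 1]\<close>)
    then show ?thesis by simp
  qed
  then obtain d where d: "\<And>n. n \<ge> 1 \<Longrightarrow> dcoeff d n = a n" and nd: "(norm d)\<^sup>2 \<le> Re l"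
    using dseries_of_bounded_square_sums by metis
  have "dseries_eval d s = g s" if s: "Re s > 1/2" for s
  proof -
    \<comment> \<open>Coefficients are close in the weighted norm for \<open>\<sigma>\<close>, and \<open>Re s - \<sigma> > 1/2\<close> is left over for summability.\<close>
    define \<sigma> where "\<sigma> = (Re s - 1/2) / 2"
    have \<sigma>: "\<sigma> > 0" "\<sigma> < Re s" "Re s - \<sigma> > 1/2" using s by (auto simp: \<sigma>_def field_simps)
    define Z where "Z = sqrt (zeta_tail 0 (Re s - \<sigma>))"
    have Z: "Z \<ge> 0" using zeta_tail_nonneg[OF \<sigma>(3)] by (simp add: Z_def)
    have near: "cmod (g s - dseries_eval d s) \<le> \<eta> * (1 + Z)" if \<eta>: "\<eta> > 0" for \<eta>
    proof (rule tendsto_upperbound)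
      obtain p N where p: "\<And>s. Re s \<ge> \<sigma> \<Longrightarrow> cmod (g s - dpoly p N s) \<le> \<eta>"
        and p0: "\<And>n. n > N \<Longrightarrow> p n = 0"
        and pa: "\<And>K. (\<Sum>n=1..K. (cmod (p n - a n))\<^sup>2 * real n powr (- 2 * \<sigma>)) \<le> \<eta>\<^sup>2"
        using a[OF \<sigma>(1) \<eta>] by blast
      have "cmod (g s - dpoly (dcoeff d) K s) \<le> \<eta> * (1 + Z)" if K: "K \<ge> N" for K
      proof -
        have ext: "dpoly p K s = dpoly p N s"
          unfolding dpoly_def using p0 K by (intro sum.mono_neutral_right) auto
        have "dpoly p K s - dpoly (dcoeff d) K s = (\<Sum>n=1..K. (p n - a n) * of_nat n powr (- s))"
          unfolding dpoly_def sum_subtractf[symmetric]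
          by (intro sum.cong refl) (simp add: d left_diff_distrib)
        also have "cmod \<dots> \<le> (\<Sum>n=1..K. (cmod (p n - a n) * real n powr (- \<sigma>)) * real n powr (- (Re s - \<sigma>)))"
          by (rule order_trans[OF norm_sum])
            (auto intro!: sum_mono simp: norm_mult mult.assoc powr_add[symmetric])
        also have "\<dots> \<le> \<eta> * Z"
        proof (rule power2_le_imp_le)
          have "(\<Sum>n=1..K. (cmod (p n - a n) * real n powr (- \<sigma>)) * real n powr (- (Re s - \<sigma>)))\<^sup>2
              \<le> (\<Sum>n=1..K. (cmod (p n - a n) * real n powr (- \<sigma>))\<^sup>2) * (\<Sum>n=1..K. (real n powr (- (Re s - \<sigma>)))\<^sup>2)"
            by (rule Cauchy_Schwarz_ineq_sum)
          also have "(\<Sum>n=1..K. (cmod (p n - a n) * real n powr (- \<sigma>))\<^sup>2)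
              = (\<Sum>n=1..K. (cmod (p n - a n))\<^sup>2 * real n powr (- 2 * \<sigma>))"
            by (intro sum.cong refl) (simp add: power_mult_distrib, simp add: power2_eq_square powr_add[symmetric])
          also have "(\<Sum>n=1..K. (real n powr (- (Re s - \<sigma>)))\<^sup>2) = (\<Sum>n=1..K. real n powr (- 2 * (Re s - \<sigma>)))"
            by (intro sum.cong refl) (simp add: power2_eq_square powr_add[symmetric])
          also have "(\<Sum>n=1..K. (cmod (p n - a n))\<^sup>2 * real n powr (- 2 * \<sigma>)) * (\<Sum>n=1..K. real n powr (- 2 * (Re s - \<sigma>)))
              \<le> \<eta>\<^sup>2 * zeta_tail 0 (Re s - \<sigma>)"
            by (intro mult_mono pa sum_powr_le_zeta_tail \<sigma> sum_nonneg) auto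
          also have "\<dots> = (\<eta> * Z)\<^sup>2"
            using zeta_tail_nonneg[OF \<sigma>(3)] by (simp add: Z_def power_mult_distrib)
          finally show "(\<Sum>n=1..K. (cmod (p n - a n) * real n powr (- \<sigma>)) * real n powr (- (Re s - \<sigma>)))\<^sup>2 \<le> (\<eta> * Z)\<^sup>2" .
        qed (use \<eta> Z in simp)
        finally have "cmod (dpoly p K s - dpoly (dcoeff d) K s) \<le> \<eta> * Z" .
        moreover have "cmod (g s - dpoly p K s) \<le> \<eta>" unfolding ext using p \<sigma> by simp
        ultimately show ?thesis
          using norm_triangle_ineq[of "g s - dpoly p K s" "dpoly p K s - dpoly (dcoeff d) K s"]
          by (simp add: algebra_simps)
      qed
      then show "\<forall>\<^sub>F K in sequentially. cmod (g s - dpoly (dcoeff d) K s) \<le> \<eta> * (1 + Z)"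
        by (auto intro: eventually_sequentiallyI[of N])
      show "(\<lambda>K. cmod (g s - dpoly (dcoeff d) K s)) \<longlonglongrightarrow> cmod (g s - dseries_eval d s)"
        by (intro tendsto_intros dpoly_tendsto_dseries_eval s)
    qed simp
    have "cmod (g s - dseries_eval d s) \<le> 0"
    proof (rule field_le_epsilon)
      fix e :: real assume e: "e > 0"
      show "cmod (g s - dseries_eval d s) \<le> 0 + e"
        using near[of "e / (1 + Z)"] e Z by simp
    qed
    then show ?thesis by simp
  qed
  with nd show thesis using that by blast
qed

section \<open>The Poisson majorant of a Dirichlet polynomial\<close>

lemma summation_by_parts:
  fixes v c :: "nat \<Rightarrow> 'a::comm_ring"
  assumes "v 0 = 0"
  shows "(\<Sum>k=1..N. (v k - v (k - 1)) * (\<Sum>n=k..N. c n)) = (\<Sum>n=1..N. v n * c n)"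
proof (induction N)
  case (Suc N)
  have v: "(\<Sum>k=1..M. v k - v (k - 1)) = v M" for M
    using assms by (induction M) auto
  have "(\<Sum>k=1..Suc N. (v k - v (k - 1)) * (\<Sum>n=k..Suc N. c n))
      = (\<Sum>k=1..Suc N. (v k - v (k - 1)) * (\<Sum>n=k..N. c n) + (v k - v (k - 1)) * c (Suc N))"
    by (intro sum.cong refl) (auto simp: distrib_left)
  also have "\<dots> = (\<Sum>k=1..N. (v k - v (k - 1)) * (\<Sum>n=k..N. c n)) + (\<Sum>k=1..Suc N. v k - v (k - 1)) * c (Suc N)"
    by (simp add: sum.distrib sum_distrib_right distrib_right)
  finally show ?case unfolding v Suc.IH by simp
qed simp

text \<open>
  Expand the squares: the pair of terms \<open>c\<^sub>m\<close>, \<open>c\<^sub>n\<close> with \<open>n \<le> m\<close> occurs in the tails with \<open>k \<le> n\<close>, whose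
  weights telescope to \<open>v\<^sub>n\<close>.
\<close>

lemma sum_tail_squares:
  fixes v :: "nat \<Rightarrow> real" and c :: "nat \<Rightarrow> complex"
  assumes "v 0 = 0"
  shows "(\<Sum>k=1..N. (v k - v (k - 1)) * (cmod (\<Sum>n=k..N. c n))\<^sup>2)
       = (\<Sum>m=1..N. v m * (cmod (c m))\<^sup>2 + 2 * Re (c m * (\<Sum>n=1..m - 1. v n * cnj (c n))))"
proof (induction N)
  case (Suc N)
  define R where "R k = (\<Sum>n=k..N. c n)" for k
  define e where "e = c (Suc N)"
  have v: "(\<Sum>k=1..M. v k - v (k - 1)) = v M" for M
    using assms by (induction M) auto
  have sq: "(cmod (x + y))\<^sup>2 = (cmod x)\<^sup>2 + (cmod y)\<^sup>2 + 2 * Re (y * cnj x)" for x y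
    by (simp add: cmod_power2) (simp add: power2_eq_square algebra_simps)
  have Re_of_real_mult: "Re (e * (of_real x * y)) = x * Re (e * y)" for x y
    by (simp add: algebra_simps)
  have arith: "D * (X + Y + 2 * Z) = D * X + D * Y + 2 * (D * Z)" for D X Y Z :: real
    by (simp add: algebra_simps)
  have "(\<Sum>k=1..Suc N. (v k - v (k - 1)) * (cmod (\<Sum>n=k..Suc N. c n))\<^sup>2)
      = (\<Sum>k=1..Suc N. (v k - v (k - 1)) * (cmod (R k))\<^sup>2 + (v k - v (k - 1)) * (cmod e)\<^sup>2
           + 2 * Re (e * (complex_of_real (v k - v (k - 1)) * cnj (R k))))"
  proof (intro sum.cong refl)
    fix k assume "k \<in> {1..Suc N}"
    then have "(\<Sum>n=k..Suc N. c n) = R k + e" by (auto simp: R_def e_def)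
    then have "(cmod (\<Sum>n=k..Suc N. c n))\<^sup>2 = (cmod (R k))\<^sup>2 + (cmod e)\<^sup>2 + 2 * Re (e * cnj (R k))"
      by (simp only: sq)
    then show "(v k - v (k - 1)) * (cmod (\<Sum>n=k..Suc N. c n))\<^sup>2
        = (v k - v (k - 1)) * (cmod (R k))\<^sup>2 + (v k - v (k - 1)) * (cmod e)\<^sup>2
           + 2 * Re (e * (complex_of_real (v k - v (k - 1)) * cnj (R k)))"
      by (simp only: Re_of_real_mult arith)
  qed
  also have "\<dots> = (\<Sum>k=1..N. (v k - v (k - 1)) * (cmod (R k))\<^sup>2) + (\<Sum>k=1..Suc N. v k - v (k - 1)) * (cmod e)\<^sup>2
           + 2 * Re (e * (\<Sum>k=1..N. complex_of_real (v k - v (k - 1)) * cnj (R k)))"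
    by (simp add: sum.distrib sum_distrib_right distrib_right R_def sum_distrib_left)
  also have "(\<Sum>k=1..N. complex_of_real (v k - v (k - 1)) * cnj (R k)) = (\<Sum>n=1..N. v n * cnj (c n))"
    using summation_by_parts[where v = "\<lambda>k. complex_of_real (v k)" and c = "\<lambda>n. cnj (c n)" and N = N] assms
    by (simp add: R_def)
  finally show ?case unfolding v R_def Suc.IH by (simp add: e_def)
qed simp

text \<open>
  Its real part is the Poisson extension to \<open>half_plane (1/2)\<close> of the boundary function
  \<open>\<bar>dpoly a N (1/2 + \<i> * t)\<bar>\<^sup>2\<close>: in the expanded square, \<open>(n / m) powr (\<i> * t)\<close> with \<open>n < m\<close> has the
  bounded holomorphic extension \<open>(n / m) powr (w - 1/2)\<close>, and the conjugate terms contribute the same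
  real part, whence the factor \<open>2\<close>.
\<close>

definition poisson_majorant :: "(nat \<Rightarrow> complex) \<Rightarrow> nat \<Rightarrow> complex \<Rightarrow> complex" where
  "poisson_majorant a N w = (\<Sum>m=1..N. of_real ((cmod (a m))\<^sup>2 / m)
     + 2 * (a m * of_nat m powr (- w) * (\<Sum>n=1..m - 1. cnj (a n) * of_nat n powr (w - 1))))"

text \<open>
  This is the identity \<open>sum_tail_squares\<close> for \<open>v\<^sub>n = n powr (2 * \<sigma>)\<close> and \<open>c\<^sub>n = a\<^sub>n * n powr (- w)\<close>, where
  \<open>2 * \<sigma> = 2 * Re w - 1\<close> and \<open>v\<^sub>n\<close> times the conjugate of \<open>n powr (- w)\<close> is \<open>n powr (w - 1)\<close>.
\<close>

lemma Re_poisson_majorant: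
  "Re (poisson_majorant a N w) = (\<Sum>k=1..N. (real k powr (2 * Re w - 1) - real (k - 1) powr (2 * Re w - 1))
      * (cmod (\<Sum>n=k..N. a n * of_nat n powr (- w)))\<^sup>2)"
proof -
  define v where "v k = real k powr (2 * Re w - 1)" for k :: nat
  define c where "c n = a n * of_nat n powr (- w)" for n :: nat
  have v0: "v 0 = 0" by (simp add: v_def)
  have diag: "v m * (cmod (c m))\<^sup>2 = (cmod (a m))\<^sup>2 / m" if "m \<ge> 1" for m
  proof -
    have "v m * (cmod (c m))\<^sup>2 = (cmod (a m))\<^sup>2 * (real m powr (2 * Re w - 1) * (real m powr (- Re w) * real m powr (- Re w)))"
      by (simp add: v_def c_def norm_mult power2_eq_square mult_ac)
    also have "real m powr (2 * Re w - 1) * (real m powr (- Re w) * real m powr (- Re w)) = 1 / m"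
    proof -
      have "2 * Re w - 1 + (- Re w + - Re w) = - 1" by simp
      then show ?thesis using that by (simp only: powr_add[symmetric]) (simp add: powr_minus divide_inverse)
    qed
    finally show ?thesis by simp
  qed
  have off: "v n * cnj (c n) = cnj (a n) * of_nat n powr (w - 1)" if "n \<ge> 1" for n
  proof -
    have L: "Ln (of_nat n) = of_real (ln (real n))" using that by (simp add: Ln_of_nat)
    have "complex_of_real (v n) * cnj (of_nat n powr (- w)) = exp (of_real (ln (real n)) * of_real (2 * Re w - 1) + (- cnj w) * of_real (ln (real n)))"
    proof -
      have "complex_of_real (v n) = exp (of_real (ln (real n)) * of_real (2 * Re w - 1))"
        using that by (simp add: v_def powr_def exp_of_real[symmetric] mult.commute)
      moreover have "cnj (of_nat n powr (- w)) = exp ((- cnj w) * of_real (ln (real n)))"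
        using that L by (simp add: powr_def exp_cnj)
      ultimately show ?thesis by (simp only: exp_add)
    qed
    also have "of_real (ln (real n)) * of_real (2 * Re w - 1) + (- cnj w) * of_real (ln (real n)) = (w - 1) * of_real (ln (real n))"
      by (simp add: complex_eq_iff algebra_simps)
    also have "exp ((w - 1) * of_real (ln (real n))) = of_nat n powr (w - 1)"
      using that L by (simp add: powr_def)
    finally show ?thesis by (simp add: c_def mult_ac)
  qed
  have "Re (poisson_majorant a N w) = (\<Sum>m=1..N. v m * (cmod (c m))\<^sup>2 + 2 * Re (c m * (\<Sum>n=1..m - 1. v n * cnj (c n))))"
    unfolding poisson_majorant_def Re_sum
  proof (intro sum.cong refl)
    fix m assume m: "m \<in> {1..N}"
    have "(\<Sum>n=1..m - 1. v n * cnj (c n)) = (\<Sum>n=1..m - 1. cnj (a n) * of_nat n powr (w - 1))"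
      by (intro sum.cong refl off) auto
    then show "Re (of_real ((cmod (a m))\<^sup>2 / m)
     + 2 * (a m * of_nat m powr (- w) * (\<Sum>n=1..m - 1. cnj (a n) * of_nat n powr (w - 1))))
      = v m * (cmod (c m))\<^sup>2 + 2 * Re (c m * (\<Sum>n=1..m - 1. v n * cnj (c n)))"
      using diag[of m] m by (simp add: c_def)
  qed
  also have "\<dots> = (\<Sum>k=1..N. (v k - v (k - 1)) * (cmod (\<Sum>n=k..N. c n))\<^sup>2)"
    by (rule sum_tail_squares[symmetric]) (rule v0)
  finally show ?thesis by (simp add: v_def c_def)
qed

lemma powr_increment_nonneg: "x \<ge> 0 \<Longrightarrow> real k powr x - real (k - 1) powr x \<ge> 0"
  by (simp add: powr_mono2)

lemma dpoly_square_le_poisson_majorant: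
  assumes "Re w \<ge> 1/2"
  shows "(cmod (dpoly a N w))\<^sup>2 \<le> Re (poisson_majorant a N w)"
proof (cases "N \<ge> 1")
  case True
  have "(real 1 powr (2 * Re w - 1) - real (1 - 1) powr (2 * Re w - 1))
      * (cmod (\<Sum>n=1..N. a n * of_nat n powr (- w)))\<^sup>2 \<le> Re (poisson_majorant a N w)"
    unfolding Re_poisson_majorant using True assms
    by (intro member_le_sum[where i = 1 and f = "\<lambda>k. (real k powr (2 * Re w - 1) - real (k - 1) powr (2 * Re w - 1))
      * (cmod (\<Sum>n=k..N. a n * of_nat n powr (- w)))\<^sup>2"] mult_nonneg_nonneg powr_increment_nonneg) auto
  then show ?thesis by (simp add: dpoly_def)
qed (simp add: dpoly_def poisson_majorant_def)

text \<open>
  The increment is the integral of \<open>\<delta> * t powr (\<delta> - 1)\<close>, of modulus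
  \<open>\<bar>\<delta>\<bar> * t powr (\<sigma> - 1/2) * t powr (- \<sigma>' - 1/2)\<close>, so the claim is the Cauchy-Schwarz inequality for this
  integral. In terms of derivatives, the arithmetic-geometric mean inequality with a parameter \<open>l\<close> bounds the derivative by that
  of an explicit function, and the parameter is optimised at the end.
\<close>

lemma powr_increment_square_le:
  fixes a b \<sigma> \<sigma>' :: real and \<delta> :: complex
  assumes ab: "0 < a" "a < b" and pos: "\<sigma> > 0" "\<sigma>' > 0" and \<delta>: "Re \<delta> = \<sigma> - \<sigma>'"
  shows "(cmod (of_real b powr \<delta> - of_real a powr \<delta>))\<^sup>2
       \<le> (cmod \<delta>)\<^sup>2 / (4 * \<sigma> * \<sigma>') * ((b powr (2 * \<sigma>) - a powr (2 * \<sigma>)) * (a powr (- 2 * \<sigma>') - b powr (- 2 * \<sigma>')))"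
proof -
  define P where "P = (b powr (2 * \<sigma>) - a powr (2 * \<sigma>)) / (2 * \<sigma>)"
  define Q where "Q = (a powr (- 2 * \<sigma>') - b powr (- 2 * \<sigma>')) / (2 * \<sigma>')"
  have P: "P > 0" using ab pos unfolding P_def by (intro divide_pos_pos) (auto intro: powr_less_mono2)
  have Q: "Q > 0" using ab pos unfolding Q_def by (intro divide_pos_pos) (auto intro: powr_less_mono2_neg)
  have bound: "cmod (of_real b powr \<delta> - of_real a powr \<delta>) \<le> cmod \<delta> / 2 * (l * P + Q / l)" if l: "l > 0" for l
  proof -
    define \<Phi> where "\<Phi> t = cmod \<delta> / 2 * (l / (2 * \<sigma>) * t powr (2 * \<sigma>) - 1 / (l * 2 * \<sigma>') * t powr (- 2 * \<sigma>'))" for t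
    have "cmod (of_real b powr \<delta> - of_real a powr \<delta>) \<le> \<Phi> b - \<Phi> a"
    proof (rule differentiable_bound_general)
      show "continuous_on {a..b} (\<lambda>t. complex_of_real t powr \<delta>)"
      proof (rule continuous_on_powr_complex)
        show "{a..b} \<subseteq> {t. Re (complex_of_real t) \<ge> 0 \<or> Im (complex_of_real t) \<noteq> 0}" using ab by auto
      qed (use ab in \<open>auto intro!: continuous_intros\<close>)
      show "continuous_on {a..b} \<Phi>"
        unfolding \<Phi>_def using ab pos l by (auto intro!: continuous_intros)
      fix t assume t: "a < t" "t < b"
      then have t0: "t > 0" using ab by simp
      show "((\<lambda>t. complex_of_real t powr \<delta>) has_vector_derivative \<delta> * of_real t powr (\<delta> - 1)) (at t)"
        using t0 by (intro has_vector_derivative_real_field has_field_derivative_powr) (simp add: complex_nonpos_Reals_iff)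
      have "(\<Phi> has_real_derivative cmod \<delta> / 2 * (l * t powr (2 * \<sigma> - 1) + t powr (- 2 * \<sigma>' - 1) / l)) (at t)"
        unfolding \<Phi>_def using t0 pos l
        by (auto intro!: derivative_eq_intros simp: field_simps powr_diff powr_minus)
      then show "(\<Phi> has_vector_derivative cmod \<delta> / 2 * (l * t powr (2 * \<sigma> - 1) + t powr (- 2 * \<sigma>' - 1) / l)) (at t)"
        by (simp add: has_real_derivative_iff_has_vector_derivative)
      define x where "x = sqrt l * t powr (\<sigma> - 1/2)"
      define y where "y = t powr (- \<sigma>' - 1/2) / sqrt l"
      have "x * y = t powr (\<sigma> - 1/2) * t powr (- \<sigma>' - 1/2)" using l by (simp add: x_def y_def)
      also have "\<dots> = t powr (Re \<delta> - 1)" using t0 by (simp add: powr_add[symmetric] \<delta>)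
      finally have xy: "x * y = t powr (Re \<delta> - 1)" .
      have x2: "x\<^sup>2 = l * t powr (2 * \<sigma> - 1)"
        using l by (simp add: x_def power_mult_distrib) (simp add: power2_eq_square powr_add[symmetric])
      have y2: "y\<^sup>2 = t powr (- 2 * \<sigma>' - 1) / l"
        using l by (simp add: y_def power_divide) (simp add: power2_eq_square powr_add[symmetric])
      have "2 * (x * y) \<le> x\<^sup>2 + y\<^sup>2" using sum_squares_bound[of x y] by simp
      then have "cmod \<delta> / 2 * (2 * (x * y)) \<le> cmod \<delta> / 2 * (x\<^sup>2 + y\<^sup>2)" by (rule mult_left_mono) simp
      then show "cmod (\<delta> * of_real t powr (\<delta> - 1)) \<le> cmod \<delta> / 2 * (l * t powr (2 * \<sigma> - 1) + t powr (- 2 * \<sigma>' - 1) / l)"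
        using t0 by (simp add: norm_mult norm_powr_real_powr xy x2 y2)
    qed (use ab in simp)
    also have "\<Phi> b - \<Phi> a = cmod \<delta> / 2 * (l * P + Q / l)"
      using pos l by (simp add: \<Phi>_def P_def Q_def field_simps)
    finally show ?thesis .
  qed
  \<comment> \<open>The minimiser of \<open>l * P + Q / l\<close>, at which both summands agree.\<close>
  define l where "l = sqrt Q / sqrt P"
  have l: "l > 0" using P Q by (simp add: l_def)
  have "l * P = sqrt Q * sqrt P" "Q / l = sqrt Q * sqrt P"
    using P Q by (simp_all add: l_def field_simps)
  then have "cmod (of_real b powr \<delta> - of_real a powr \<delta>) \<le> cmod \<delta> * (sqrt Q * sqrt P)"
    using bound[OF l] by (simp add: mult.commute)
  then have "(cmod (of_real b powr \<delta> - of_real a powr \<delta>))\<^sup>2 \<le> (cmod \<delta> * (sqrt Q * sqrt P))\<^sup>2"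
    by (rule power_mono) simp
  also have "\<dots> = (cmod \<delta>)\<^sup>2 * (Q * P)" using P Q by (simp add: power_mult_distrib)
  also have "\<dots> = (cmod \<delta>)\<^sup>2 / (4 * \<sigma> * \<sigma>') * ((b powr (2 * \<sigma>) - a powr (2 * \<sigma>)) * (a powr (- 2 * \<sigma>') - b powr (- 2 * \<sigma>')))"
    by (simp add: P_def Q_def mult_ac)
  finally show ?thesis .
qed

text \<open>
  With \<open>\<delta> = w - w'\<close>, the value at \<open>w'\<close> is the sum of \<open>(a\<^sub>n * n powr (- w)) * n powr \<delta>\<close>. Summation by parts
  against the tails \<open>R\<^sub>k\<close> at \<open>w\<close> isolates \<open>R\<^sub>1\<close>, the value at \<open>w\<close>, as the term \<open>k = 1\<close>. In the other
  terms the squared increments of \<open>k powr \<delta>\<close> are at most \<open>\<kappa>\<close> times the weights \<open>A k\<close> of the majorant at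
  \<open>w\<close> times the increments \<open>B k\<close> of \<open>- (k powr (- 2 * \<sigma>'))\<close>, whose total is at most \<open>1\<close>.
\<close>

lemma dpoly_difference_square_le_poisson_majorant:
  assumes w: "Re w > 1/2" and w': "Re w' > 1/2"
  shows "(cmod (dpoly a N w - dpoly a N w'))\<^sup>2
       \<le> (cmod (w - w'))\<^sup>2 / (4 * (Re w - 1/2) * (Re w' - 1/2)) * Re (poisson_majorant a N w)"
proof (cases "N \<ge> 1")
  case True
  define \<sigma> where "\<sigma> = Re w - 1/2"
  define \<sigma>' where "\<sigma>' = Re w' - 1/2"
  define \<delta> where "\<delta> = w - w'"
  define R where "R k = (\<Sum>n=k..N. a n * of_nat n powr (- w))" for k
  define v where "v k = (of_nat k powr \<delta> :: complex)" for k :: nat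
  define A where "A k = real k powr (2 * \<sigma>) - real (k - 1) powr (2 * \<sigma>)" for k :: nat
  define B where "B k = real (k - 1) powr (- 2 * \<sigma>') - real k powr (- 2 * \<sigma>')" for k :: nat
  define \<kappa> where "\<kappa> = (cmod \<delta>)\<^sup>2 / (4 * \<sigma> * \<sigma>')"
  have pos: "\<sigma> > 0" "\<sigma>' > 0" using w w' by (auto simp: \<sigma>_def \<sigma>'_def)
  then have \<kappa>: "\<kappa> \<ge> 0" by (simp add: \<kappa>_def)
  have A: "A k \<ge> 0" for k unfolding A_def using pos by (intro powr_increment_nonneg) simp
  have B: "B k \<ge> 0" if "k \<ge> 2" for k
    unfolding B_def using pos that by (simp add: powr_mono2')
  have step: "cmod (v k - v (k - 1)) \<le> sqrt \<kappa> * (sqrt (A k) * sqrt (B k))" if k: "k \<ge> 2" for k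
  proof (rule power2_le_imp_le)
    have "(cmod (v k - v (k - 1)))\<^sup>2 \<le> \<kappa> * (A k * B k)"
      using powr_increment_square_le[of "real (k - 1)" "real k" \<sigma> \<sigma>' \<delta>] k pos
      by (simp add: v_def \<kappa>_def A_def B_def \<delta>_def \<sigma>_def \<sigma>'_def)
    also have "\<dots> = (sqrt \<kappa> * (sqrt (A k) * sqrt (B k)))\<^sup>2"
      using A B[OF k] \<kappa> by (simp add: power_mult_distrib)
    finally show "(cmod (v k - v (k - 1)))\<^sup>2 \<le> (sqrt \<kappa> * (sqrt (A k) * sqrt (B k)))\<^sup>2" .
  qed (use A B[OF k] \<kappa> in simp)
  have "dpoly a N w' = (\<Sum>n=1..N. v n * (a n * of_nat n powr (- w)))"
    unfolding dpoly_def v_def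
    by (intro sum.cong refl) (simp add: \<delta>_def powr_add[symmetric] mult.left_commute)
  also have "\<dots> = (\<Sum>k=1..N. (v k - v (k - 1)) * R k)"
    unfolding R_def by (rule summation_by_parts[symmetric]) (simp add: v_def)
  also have "\<dots> = dpoly a N w + (\<Sum>k=2..N. (v k - v (k - 1)) * R k)"
    using True by (subst sum.atLeast_Suc_atMost) (simp_all add: v_def R_def dpoly_def numeral_2_eq_2)
  finally have "cmod (dpoly a N w - dpoly a N w') = cmod (\<Sum>k=2..N. (v k - v (k - 1)) * R k)"
    by (simp add: norm_minus_commute)
  also have "\<dots> \<le> (\<Sum>k=2..N. sqrt \<kappa> * (sqrt (A k) * sqrt (B k)) * cmod (R k))"
  proof (intro sum_norm_le)
    fix k assume "k \<in> {2..N}"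
    then have "cmod (v k - v (k - 1)) \<le> sqrt \<kappa> * (sqrt (A k) * sqrt (B k))" by (intro step) simp
    then show "cmod ((v k - v (k - 1)) * R k) \<le> sqrt \<kappa> * (sqrt (A k) * sqrt (B k)) * cmod (R k)"
      unfolding norm_mult by (rule mult_right_mono) simp
  qed
  also have "\<dots> = sqrt \<kappa> * (\<Sum>k=2..N. (sqrt (A k) * cmod (R k)) * sqrt (B k))"
    by (simp add: sum_distrib_left mult_ac)
  finally have "(cmod (dpoly a N w - dpoly a N w'))\<^sup>2 \<le> (sqrt \<kappa> * (\<Sum>k=2..N. (sqrt (A k) * cmod (R k)) * sqrt (B k)))\<^sup>2"
    by (rule power_mono) simp
  also have "\<dots> = \<kappa> * (\<Sum>k=2..N. (sqrt (A k) * cmod (R k)) * sqrt (B k))\<^sup>2"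
    using \<kappa> by (simp add: power_mult_distrib)
  also have "\<dots> \<le> \<kappa> * ((\<Sum>k=2..N. (sqrt (A k) * cmod (R k))\<^sup>2) * (\<Sum>k=2..N. (sqrt (B k))\<^sup>2))"
    by (intro mult_left_mono Cauchy_Schwarz_ineq_sum \<kappa>)
  also have "(\<Sum>k=2..N. (sqrt (A k) * cmod (R k))\<^sup>2) = (\<Sum>k=2..N. A k * (cmod (R k))\<^sup>2)"
    using A by (simp add: power_mult_distrib)
  also have "(\<Sum>k=2..N. (sqrt (B k))\<^sup>2) = (\<Sum>k=2..N. B k)"
    using B by (intro sum.cong) auto
  also have "\<kappa> * ((\<Sum>k=2..N. A k * (cmod (R k))\<^sup>2) * (\<Sum>k=2..N. B k)) \<le> \<kappa> * (Re (poisson_majorant a N w) * 1)"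
  proof (intro mult_left_mono mult_mono \<kappa>)
    have "(\<Sum>k=2..N. A k * (cmod (R k))\<^sup>2) \<le> (\<Sum>k=1..N. A k * (cmod (R k))\<^sup>2)"
      using A by (intro sum_mono2) auto
    also have "\<dots> = Re (poisson_majorant a N w)"
      unfolding Re_poisson_majorant by (simp add: A_def R_def \<sigma>_def right_diff_distrib)
    finally show "(\<Sum>k=2..N. A k * (cmod (R k))\<^sup>2) \<le> Re (poisson_majorant a N w)" .
    have "(\<Sum>k=2..M. B k) = 1 - real M powr (- 2 * \<sigma>')" if "M \<ge> 1" for M
      using that by (induction M rule: dec_induct) (auto simp: B_def)
    from this[OF True] show "(\<Sum>k=2..N. B k) \<le> 1" by simp
    show "Re (poisson_majorant a N w) \<ge> 0"
      using dpoly_square_le_poisson_majorant[of w a N] w by (meson less_imp_le order_trans zero_le_power2)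
  qed (auto intro!: sum_nonneg B)
  finally show ?thesis by (simp add: \<kappa>_def \<delta>_def \<sigma>_def \<sigma>'_def)
qed (simp add: dpoly_def poisson_majorant_def)

text \<open>
  Each term is at most a constant times the decrement of \<open>n powr (- \<sigma>)\<close> from \<open>n\<close> to \<open>n + 1\<close>, by the mean
  value theorem and \<open>n + 1 \<le> 2 * n\<close>; the decrements telescope.
\<close>

lemma sum_tail_powr_le:
  fixes \<sigma> :: real
  assumes \<sigma>: "\<sigma> > 0" and k: "k \<ge> 1"
  shows "(\<Sum>n=k..N. real n powr (- 1 - \<sigma>)) \<le> 2 powr (1 + \<sigma>) / \<sigma> * real k powr (- \<sigma>)"
proof -
  define C where "C = 2 powr (1 + \<sigma>) / \<sigma>"
  have C: "C > 0" using \<sigma> by (simp add: C_def)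
  have step: "real n powr (- 1 - \<sigma>) \<le> C * (real n powr (- \<sigma>) - real (Suc n) powr (- \<sigma>))" if n: "n \<ge> 1" for n
  proof -
    have "\<exists>z. real n < z \<and> z < real (Suc n) \<and>
        - (real (Suc n) powr (- \<sigma>)) - - (real n powr (- \<sigma>)) = (real (Suc n) - real n) * (\<sigma> * z powr (- \<sigma> - 1))"
      using n by (intro MVT2) (auto intro!: derivative_eq_intros simp: powr_diff)
    then obtain z where z: "real n < z" "z < real (Suc n)"
      and eq: "real n powr (- \<sigma>) - real (Suc n) powr (- \<sigma>) = \<sigma> * z powr (- \<sigma> - 1)" by auto
    have "real n powr (- 1 - \<sigma>) = 2 powr (1 + \<sigma>) * (2 * real n) powr (- \<sigma> - 1)"
    proof -
      have "2 powr (1 + \<sigma>) * (2 * real n) powr (- \<sigma> - 1) = (2 powr (1 + \<sigma>) * 2 powr (- \<sigma> - 1)) * real n powr (- \<sigma> - 1)"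
        using n by (simp add: powr_mult)
      also have "2 powr (1 + \<sigma>) * 2 powr (- \<sigma> - 1) = (1::real)" by (simp flip: powr_add)
      moreover have "- \<sigma> - 1 = - 1 - \<sigma>" by simp
      ultimately show ?thesis by (simp only: mult_1)
    qed
    also have "\<dots> \<le> 2 powr (1 + \<sigma>) * z powr (- \<sigma> - 1)"
      using z n \<sigma> by (intro mult_left_mono powr_mono2') auto
    also have "\<dots> = C * (\<sigma> * z powr (- \<sigma> - 1))" using \<sigma> by (simp add: C_def)
    finally show ?thesis unfolding eq .
  qed
  have "(\<Sum>n=k..N. real n powr (- 1 - \<sigma>)) \<le> (\<Sum>n=k..N. C * (real n powr (- \<sigma>) - real (Suc n) powr (- \<sigma>)))"
    using k by (intro sum_mono step) auto
  also have "\<dots> = C * (\<Sum>n=k..N. real n powr (- \<sigma>) - real (Suc n) powr (- \<sigma>))"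
    by (simp only: sum_distrib_left)
  also have "\<dots> \<le> C * real k powr (- \<sigma>)"
  proof (rule mult_left_mono)
    show "(\<Sum>n=k..N. real n powr (- \<sigma>) - real (Suc n) powr (- \<sigma>)) \<le> real k powr (- \<sigma>)"
    proof (cases "k \<le> N")
      case True
      have "(\<Sum>n=k..M. real n powr (- \<sigma>) - real (Suc n) powr (- \<sigma>)) = real k powr (- \<sigma>) - real (Suc M) powr (- \<sigma>)"
        if "k \<le> M" for M
        using that by (induction M rule: dec_induct) (auto simp del: of_nat_Suc)
      from this[OF True] show ?thesis by (simp del: of_nat_Suc)
    qed simp
  qed (use C in simp)
  finally show ?thesis by (simp add: C_def)
qed

text \<open>
  A Schur test. Splitting \<open>n powr (- 1 - 2 * \<sigma>)\<close> as \<open>n powr (- \<sigma>) * n powr (- 1 - \<sigma>)\<close> bounds the squared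
  tail \<open>R\<^sub>k\<close> by a constant times \<open>k powr (- \<sigma>) * T k\<close>. Since
  \<open>(k powr (2 * \<sigma>) - (k-1) powr (2 * \<sigma>)) * k powr (- \<sigma>)\<close> is at most twice the increment of \<open>k powr \<sigma>\<close>, a
  second summation by parts restores \<open>\<bar>a\<^sub>n\<bar>\<^sup>2\<close>.
\<close>

lemma poisson_majorant_le:
  assumes w: "Re w > 1/2"
  defines "\<sigma> \<equiv> Re w - 1/2"
  shows "Re (poisson_majorant a N w) \<le> 2 * (2 powr (1 + \<sigma>) / \<sigma>) * (\<Sum>n=1..N. (cmod (a n))\<^sup>2)"
proof -
  have \<sigma>: "\<sigma> > 0" using w by (simp add: \<sigma>_def)
  define C where "C = 2 powr (1 + \<sigma>) / \<sigma>"
  have C: "C > 0" using \<sigma> by (simp add: C_def)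
  define T where "T k = (\<Sum>n=k..N. (cmod (a n))\<^sup>2 * real n powr (- \<sigma>))" for k
  have T: "T k \<ge> 0" for k by (simp add: T_def sum_nonneg)
  have R: "(cmod (\<Sum>n=k..N. a n * of_nat n powr (- w)))\<^sup>2 \<le> T k * (C * real k powr (- \<sigma>))" if k: "k \<ge> 1" for k
  proof -
    have "cmod (\<Sum>n=k..N. a n * of_nat n powr (- w))
        \<le> (\<Sum>n=k..N. (cmod (a n) * real n powr (- \<sigma> / 2)) * real n powr ((- 1 - \<sigma>) / 2))"
    proof (intro sum_norm_le)
      fix n
      have "real n powr (- \<sigma> / 2) * real n powr ((- 1 - \<sigma>) / 2) = real n powr (- Re w)"
        unfolding powr_add[symmetric] by (rule arg_cong[of _ _ "\<lambda>x. real n powr x"]) (simp add: \<sigma>_def field_simps)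
      then show "cmod (a n * of_nat n powr (- w)) \<le> (cmod (a n) * real n powr (- \<sigma> / 2)) * real n powr ((- 1 - \<sigma>) / 2)"
        by (simp add: norm_mult mult.assoc)
    qed
    then have "(cmod (\<Sum>n=k..N. a n * of_nat n powr (- w)))\<^sup>2
        \<le> (\<Sum>n=k..N. (cmod (a n) * real n powr (- \<sigma> / 2)) * real n powr ((- 1 - \<sigma>) / 2))\<^sup>2"
      by (rule power_mono) simp
    also have "\<dots> \<le> (\<Sum>n=k..N. (cmod (a n) * real n powr (- \<sigma> / 2))\<^sup>2) * (\<Sum>n=k..N. (real n powr ((- 1 - \<sigma>) / 2))\<^sup>2)"
      by (rule Cauchy_Schwarz_ineq_sum)
    also have "(\<Sum>n=k..N. (cmod (a n) * real n powr (- \<sigma> / 2))\<^sup>2) = T k"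
      unfolding T_def power_mult_distrib by (simp add: power2_eq_square powr_add[symmetric])
    also have "(\<Sum>n=k..N. (real n powr ((- 1 - \<sigma>) / 2))\<^sup>2) = (\<Sum>n=k..N. real n powr (- 1 - \<sigma>))"
      by (simp add: power2_eq_square powr_add[symmetric])
    also have "T k * (\<Sum>n=k..N. real n powr (- 1 - \<sigma>)) \<le> T k * (C * real k powr (- \<sigma>))"
      unfolding C_def by (intro mult_left_mono sum_tail_powr_le \<sigma> k T)
    finally show ?thesis .
  qed
  have "Re (poisson_majorant a N w) \<le> (\<Sum>k=1..N. 2 * C * ((real k powr \<sigma> - real (k - 1) powr \<sigma>) * T k))"
    unfolding Re_poisson_majorant
  proof (intro sum_mono)
    fix k assume "k \<in> {1..N}"
    then have k: "k \<ge> 1" by simp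
    define x y where "x = real k powr \<sigma>" and "y = real (k - 1) powr \<sigma>"
    have xy: "0 < x" "0 \<le> y" "y \<le> x"
      using k powr_increment_nonneg[of \<sigma> k] \<sigma> by (auto simp: x_def y_def)
    have d: "real k powr (2 * Re w - 1) - real (k - 1) powr (2 * Re w - 1) = (x - y) * (x + y)"
    proof -
      have "2 * Re w - 1 = \<sigma> + \<sigma>" by (simp add: \<sigma>_def)
      then show ?thesis by (simp only: powr_add x_def y_def) (simp add: algebra_simps)
    qed
    have "(x - y) * (x + y) * (cmod (\<Sum>n=k..N. a n * of_nat n powr (- w)))\<^sup>2 \<le> (x - y) * (x + x) * (T k * (C * (1 / x)))"
      using R[OF k] xy by (intro mult_mono) (auto simp: x_def powr_minus divide_inverse)
    also have "\<dots> = 2 * C * ((x - y) * T k)" using xy by (simp add: field_simps)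
    finally show "(real k powr (2 * Re w - 1) - real (k - 1) powr (2 * Re w - 1)) * (cmod (\<Sum>n=k..N. a n * of_nat n powr (- w)))\<^sup>2
        \<le> 2 * C * ((real k powr \<sigma> - real (k - 1) powr \<sigma>) * T k)"
      unfolding d by (simp add: x_def y_def)
  qed
  also have "\<dots> = 2 * C * (\<Sum>k=1..N. (real k powr \<sigma> - real (k - 1) powr \<sigma>) * T k)"
    by (simp only: sum_distrib_left)
  also have "(\<Sum>k=1..N. (real k powr \<sigma> - real (k - 1) powr \<sigma>) * T k)
      = (\<Sum>n=1..N. real n powr \<sigma> * ((cmod (a n))\<^sup>2 * real n powr (- \<sigma>)))"
    unfolding T_def by (rule summation_by_parts) simp
  also have "\<dots> = (\<Sum>n=1..N. (cmod (a n))\<^sup>2)"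
    by (intro sum.cong refl) (simp add: powr_minus)
  finally show ?thesis by (simp add: C_def)
qed

section \<open>Composition operators with symbols of characteristic zero\<close>

lemma tendsto_of_nat_powr:
  assumes "(f \<longlongrightarrow> l) F"
  shows "((\<lambda>x. of_nat n powr f x :: complex) \<longlongrightarrow> of_nat n powr l) F"
  by (cases "n = 0") (auto simp: powr_def intro!: tendsto_intros assms)

lemma tendsto_poisson_majorant:
  assumes "(f \<longlongrightarrow> l) F"
  shows "((\<lambda>x. poisson_majorant a N (f x)) \<longlongrightarrow> poisson_majorant a N l) F"
  unfolding poisson_majorant_def by (intro tendsto_intros tendsto_of_nat_powr assms)

lemma approximable_of_nat_powr:
  assumes "approximable \<epsilon> \<phi>" "\<epsilon> \<ge> 0"
  shows "approximable \<epsilon> (\<lambda>s. of_nat n powr \<phi> s)"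
proof (cases "n = 0")
  case False
  have "approximable \<epsilon> (\<lambda>s. exp (Ln (of_nat n) * \<phi> s))"
    by (intro approximable_exp approximable_cmult assms)
  with False show ?thesis by (simp add: powr_def mult.commute)
qed (simp add: approximable_const)

lemma approximable_uminus:
  assumes "approximable \<epsilon> \<phi>" "\<epsilon> \<ge> 0"
  shows "approximable \<epsilon> (\<lambda>s. - \<phi> s)"
  using approximable_cmult[OF assms, of "-1"] by simp

lemma approximable_dpoly_comp:
  assumes "approximable \<epsilon> \<phi>" "\<epsilon> \<ge> 0"
  shows "approximable \<epsilon> (\<lambda>s. dpoly a N (\<phi> s))"
  unfolding dpoly_def
  by (intro approximable_sum approximable_cmult approximable_of_nat_powr approximable_uminus assms finite_atLeastAtMost)

lemma approximable_poisson_majorant_comp: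
  assumes "approximable \<epsilon> \<phi>" "\<epsilon> \<ge> 0"
  shows "approximable \<epsilon> (\<lambda>s. poisson_majorant a N (\<phi> s))"
  unfolding poisson_majorant_def
  by (intro approximable_sum approximable_add approximable_const approximable_mult approximable_of_nat_powr approximable_diff
      approximable_uminus assms finite_atLeastAtMost)

text \<open>
  The properties of a Gordon-Hedenmalm symbol of characteristic \<open>0\<close> on which the operator estimates
  depend; \<open>l\<close> is the constant coefficient of its Dirichlet series, described as the value at \<open>+\<infinity>\<close>.
\<close>

definition char0_symbol :: "(complex \<Rightarrow> complex) \<Rightarrow> complex \<Rightarrow> bool" where
  "char0_symbol \<phi> l \<longleftrightarrow> (\<forall>\<epsilon>>0. approximable \<epsilon> \<phi>) \<and> (\<forall>s. Re s > 0 \<longrightarrow> Re (\<phi> s) > 1/2) \<and>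
     ((\<lambda>x. \<phi> (of_real x)) \<longlongrightarrow> l) at_top"

lemma char0_symbolD:
  assumes "char0_symbol \<phi> l"
  shows "\<epsilon> > 0 \<Longrightarrow> approximable \<epsilon> \<phi>" "Re s > 0 \<Longrightarrow> Re (\<phi> s) > 1/2" "((\<lambda>x. \<phi> (of_real x)) \<longlongrightarrow> l) at_top"
  using assms by (auto simp: char0_symbol_def)

text \<open>
  If \<open>Re l = 1/2\<close>, then \<open>g = exp (1/2 - \<phi>)\<close> has modulus less than \<open>1\<close>, hence norm at most \<open>1\<close>, while
  its constant coefficient has modulus \<open>1\<close>. So all its other coefficients vanish and \<open>g\<close> is a constant of
  modulus \<open>1\<close>, a contradiction.
\<close>

lemma Re_char0_symbol_limit:
  assumes \<phi>: "char0_symbol \<phi> l"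
  shows "Re l > 1/2"
proof (rule ccontr)
  assume "\<not> Re l > 1/2"
  moreover have "Re l \<ge> 1/2"
  proof (rule tendsto_lowerbound[OF tendsto_Re[OF char0_symbolD(3)[OF \<phi>]]])
    show "\<forall>\<^sub>F x in at_top. 1/2 \<le> Re (\<phi> (of_real x))"
      using eventually_gt_at_top[of 0]
      by eventually_elim (use char0_symbolD(2)[OF \<phi>] in \<open>auto intro: less_imp_le\<close>)
  qed simp
  ultimately have l: "Re l = 1/2" by simp
  define g where "g s = exp (1/2 - \<phi> s)" for s
  have g_less: "cmod (g s) < 1" if "Re s > 0" for s
    using char0_symbolD(2)[OF \<phi> that] by (simp add: g_def)
  obtain d where d: "\<And>s. Re s > 1/2 \<Longrightarrow> dseries_eval d s = g s" "(norm d)\<^sup>2 \<le> Re 1"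
  proof (rule dominated_approximable_is_dseries)
    show "approximable \<epsilon> g" if "\<epsilon> > 0" for \<epsilon>
      unfolding g_def using that char0_symbolD(1)[OF \<phi> that] by (intro approximable_exp approximable_diff approximable_const) auto
    show "approximable \<epsilon> (\<lambda>_. 1)" for \<epsilon> by (rule approximable_const)
    show "(cmod (g s))\<^sup>2 \<le> Re 1" if "Re s > 0" for s
      using g_less[OF that] by (simp add: power_le_one)
    show "((\<lambda>x. 1) \<longlongrightarrow> (1::complex)) at_top" for F :: "real filter" by (rule tendsto_const)
  qed blast
  have "dcoeff d 1 = exp (1/2 - l)"
  proof (rule tendsto_unique[OF _ dseries_eval_tendsto])
    have "((\<lambda>x. g (of_real x)) \<longlongrightarrow> exp (1/2 - l)) at_top"
      unfolding g_def by (intro tendsto_intros char0_symbolD(3)[OF \<phi>])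
    then show "((\<lambda>x. dseries_eval d (of_real x)) \<longlongrightarrow> exp (1/2 - l)) at_top"
      by (rule Lim_transform_eventually)
        (use eventually_gt_at_top[of "1/2"] in \<open>eventually_elim, simp add: d(1)\<close>)
  qed simp
  then have d1: "cmod (dcoeff d 1) = 1" using l by simp
  have "dcoeff d n = 0" if "n > 1" for n
  proof -
    have "(cmod (dcoeff d n))\<^sup>2 \<le> 0"
    proof -
      have "1 + (cmod (dcoeff d n))\<^sup>2 \<le> (norm d)\<^sup>2"
        using sum_dcoeff_squares_le[of "{1, n}" d] d1 that by simp
      moreover have "(norm d)\<^sup>2 \<le> 1" using d(2) by simp
      ultimately show ?thesis by linarith
    qed
    then show ?thesis by simp
  qed
  then have "dseries_eval d 1 = dpoly (dcoeff d) 1 1" by (rule dseries_eval_finite_support)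
  then have "g 1 = dcoeff d 1" using d(1)[of 1] by (simp add: dpoly_def)
  with d1 g_less[of 1] show False by simp
qed

lemma char0_symbol_convex_combination:
  assumes 0: "char0_symbol \<phi> l" and 1: "char0_symbol \<phi>' l'" and t: "0 \<le> t" "t \<le> 1"
  shows "char0_symbol (\<lambda>s. of_real (1 - t) * \<phi> s + of_real t * \<phi>' s) (of_real (1 - t) * l + of_real t * l')"
  unfolding char0_symbol_def
proof (intro conjI allI impI)
  fix s :: complex assume s: "Re s > 0"
  show "Re (of_real (1 - t) * \<phi> s + of_real t * \<phi>' s) > 1/2"
    using convex_bound_lt[of "- Re (\<phi> s)" "- 1/2" "- Re (\<phi>' s)" "1 - t" t] char0_symbolD(2)[OF 0 s] char0_symbolD(2)[OF 1 s] t
    by simp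
qed (auto intro!: approximable_add approximable_cmult tendsto_intros char0_symbolD[OF 0] char0_symbolD[OF 1])

text \<open>
  The constant of lemma \<open>poisson_majorant_le\<close> at the point \<open>l\<close>. It bounds the squared norm of \<open>comp_op \<phi>\<close>
  when \<open>l\<close> is the limit of \<open>\<phi>\<close> at \<open>+\<infinity>\<close>.
\<close>

definition embedding_const :: "complex \<Rightarrow> real" where
  "embedding_const l = 2 * (2 powr (1 + (Re l - 1/2)) / (Re l - 1/2))"

lemma embedding_const_nonneg: "Re l > 1/2 \<Longrightarrow> embedding_const l \<ge> 0"
  by (simp add: embedding_const_def)

lemma Re_poisson_majorant_dcoeff_le:
  assumes "Re l > 1/2"
  shows "Re (poisson_majorant (dcoeff f) N l) \<le> embedding_const l * (norm f)\<^sup>2"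
proof -
  have "Re (poisson_majorant (dcoeff f) N l) \<le> embedding_const l * (\<Sum>n=1..N. (cmod (dcoeff f n))\<^sup>2)"
    using poisson_majorant_le[OF assms] by (simp add: embedding_const_def)
  also have "\<dots> \<le> embedding_const l * (norm f)\<^sup>2"
    by (intro mult_left_mono sum_dcoeff_squares_le embedding_const_nonneg assms) auto
  finally show ?thesis .
qed

lemma comp_dseries_finite_support:
  assumes \<phi>: "char0_symbol \<phi> l" and f: "\<And>n. n > N \<Longrightarrow> dcoeff f n = 0"
  obtains d where "\<And>s. Re s > 1/2 \<Longrightarrow> dseries_eval d s = dseries_eval f (\<phi> s)"
    "(norm d)\<^sup>2 \<le> embedding_const l * (norm f)\<^sup>2"
proof -
  obtain d where d: "\<And>s. Re s > 1/2 \<Longrightarrow> dseries_eval d s = dpoly (dcoeff f) N (\<phi> s)"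
    "(norm d)\<^sup>2 \<le> Re (poisson_majorant (dcoeff f) N l)"
  proof (rule dominated_approximable_is_dseries)
    show "approximable \<epsilon> (\<lambda>s. dpoly (dcoeff f) N (\<phi> s))" "approximable \<epsilon> (\<lambda>s. poisson_majorant (dcoeff f) N (\<phi> s))"
      if "\<epsilon> > 0" for \<epsilon>
      using that char0_symbolD(1)[OF \<phi> that] by (auto intro: approximable_dpoly_comp approximable_poisson_majorant_comp)
    show "(cmod (dpoly (dcoeff f) N (\<phi> s)))\<^sup>2 \<le> Re (poisson_majorant (dcoeff f) N (\<phi> s))" if "Re s > 0" for s
      using char0_symbolD(2)[OF \<phi> that] by (intro dpoly_square_le_poisson_majorant) simp
    show "((\<lambda>x. poisson_majorant (dcoeff f) N (\<phi> (of_real x))) \<longlongrightarrow> poisson_majorant (dcoeff f) N l) at_top"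
      by (intro tendsto_poisson_majorant char0_symbolD(3)[OF \<phi>])
  qed blast
  show thesis
  proof (rule that)
    show "dseries_eval d s = dseries_eval f (\<phi> s)" if "Re s > 1/2" for s
      using d(1)[OF that] dseries_eval_finite_support[OF f] by simp
    show "(norm d)\<^sup>2 \<le> embedding_const l * (norm f)\<^sup>2"
      by (rule order_trans[OF d(2) Re_poisson_majorant_dcoeff_le[OF Re_char0_symbol_limit[OF \<phi>]]])
  qed
qed

lemma tendsto_dseries_eval:
  assumes "f \<longlonglongrightarrow> g" "Re s > 1/2"
  shows "(\<lambda>k. dseries_eval (f k) s) \<longlonglongrightarrow> dseries_eval g s"
proof (rule LIM_zero_cancel, rule Lim_null_comparison)
  show "\<forall>\<^sub>F k in sequentially. norm (dseries_eval (f k) s - dseries_eval g s) \<le> norm (f k - g) * sqrt (zeta_tail 0 (Re s))"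
    using dseries_eval_bound[OF assms(2), of "f _ - g"] by (simp add: dseries_eval_diff[OF assms(2)])
  have "(\<lambda>k. norm (f k - g) * sqrt (zeta_tail 0 (Re s))) \<longlonglongrightarrow> 0 * sqrt (zeta_tail 0 (Re s))"
    by (intro tendsto_intros tendsto_norm_zero LIM_zero assms(1))
  then show "(\<lambda>k. norm (f k - g) * sqrt (zeta_tail 0 (Re s))) \<longlonglongrightarrow> 0" by simp
qed

text \<open>
  The truncations of \<open>f\<close> have finite support, and the images of truncations form a Cauchy sequence by
  the bound for finite support. Evaluation is continuous, so the limit represents \<open>f \<circ> \<phi>\<close>.
\<close>

lemma comp_dseries:
  assumes \<phi>: "char0_symbol \<phi> l"
  shows "\<exists>d. (\<forall>s. Re s > 1/2 \<longrightarrow> dseries_eval d s = dseries_eval f (\<phi> s)) \<and>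
    norm d \<le> norm f * sqrt (embedding_const l)"
proof -
  have K: "embedding_const l \<ge> 0" by (intro embedding_const_nonneg Re_char0_symbol_limit[OF \<phi>])
  have "\<exists>d. (\<forall>s. Re s > 1/2 \<longrightarrow> dseries_eval d s = dseries_eval (dtrunc N f) (\<phi> s))" for N
    using comp_dseries_finite_support[OF \<phi>, of N "dtrunc N f"] by (auto simp: dcoeff_dtrunc)
  then obtain D where D: "\<And>N s. Re s > 1/2 \<Longrightarrow> dseries_eval (D N) s = dseries_eval (dtrunc N f) (\<phi> s)"
    by metis
  have bound: "norm d \<le> norm h * sqrt (embedding_const l)"
    if d: "\<And>s. Re s > 1/2 \<Longrightarrow> dseries_eval d s = dseries_eval h (\<phi> s)"
      and h: "\<And>n. n > N \<Longrightarrow> dcoeff h n = 0" for d h N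
  proof -
    obtain d' where d': "\<And>s. Re s > 1/2 \<Longrightarrow> dseries_eval d' s = dseries_eval h (\<phi> s)"
      "(norm d')\<^sup>2 \<le> embedding_const l * (norm h)\<^sup>2"
      using comp_dseries_finite_support[OF \<phi> h] by blast
    have "d' = d" by (rule dseries_eqI_eval) (simp add: d d')
    with d'(2) have "(norm d)\<^sup>2 \<le> (norm h * sqrt (embedding_const l))\<^sup>2"
      using K by (simp add: power_mult_distrib mult.commute)
    then show ?thesis by (rule power2_le_imp_le) (simp add: K)
  qed
  have diff: "norm (D M - D N) \<le> norm (dtrunc M f - dtrunc N f) * sqrt (embedding_const l)" for M N
  proof (rule bound[where N = "max M N"])
    fix s assume s: "Re s > 1/2"
    then have "Re (\<phi> s) > 1/2" by (intro char0_symbolD(2)[OF \<phi>]) simp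
    with s show "dseries_eval (D M - D N) s = dseries_eval (dtrunc M f - dtrunc N f) (\<phi> s)"
      by (simp add: dseries_eval_diff D)
  qed (simp add: minus_dseries.rep_eq dcoeff_dtrunc)
  have "Cauchy D"
  proof (rule CauchyI)
    fix e :: real assume e: "e > 0"
    define r where "r = sqrt (embedding_const l) + 1"
    have r: "r > 0" "sqrt (embedding_const l) \<le> r" using K by (auto simp: r_def add_nonneg_pos)
    have "Cauchy (\<lambda>N. dtrunc N f)" by (rule LIMSEQ_imp_Cauchy[OF dtrunc_tendsto])
    then obtain M where M: "\<And>m n. m \<ge> M \<Longrightarrow> n \<ge> M \<Longrightarrow> norm (dtrunc m f - dtrunc n f) < e / r"
      using CauchyD[of "\<lambda>N. dtrunc N f" "e / r"] e r by (meson divide_pos_pos)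
    have "norm (D m - D n) < e" if "m \<ge> M" "n \<ge> M" for m n
    proof -
      have "norm (D m - D n) \<le> norm (dtrunc m f - dtrunc n f) * r"
        by (rule order_trans[OF diff mult_left_mono[OF r(2)]]) simp
      also have "\<dots> < e" using M[OF that] r(1) by (simp add: pos_less_divide_eq)
      finally show ?thesis .
    qed
    then show "\<exists>M. \<forall>m\<ge>M. \<forall>n\<ge>M. norm (D m - D n) < e" by blast
  qed
  then obtain d where d: "D \<longlonglongrightarrow> d" by (rule dseries_Cauchy_limit)
  have "dseries_eval d s = dseries_eval f (\<phi> s)" if s: "Re s > 1/2" for s
  proof (rule LIMSEQ_unique[OF tendsto_dseries_eval[OF d s]])
    have "Re (\<phi> s) > 1/2" using s by (intro char0_symbolD(2)[OF \<phi>]) simp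
    then show "(\<lambda>k. dseries_eval (D k) s) \<longlonglongrightarrow> dseries_eval f (\<phi> s)"
      using tendsto_dseries_eval[OF dtrunc_tendsto] by (simp add: D[OF s])
  qed
  moreover have "norm d \<le> norm f * sqrt (embedding_const l)"
  proof (rule LIMSEQ_le)
    show "(\<lambda>N. norm (D N)) \<longlonglongrightarrow> norm d" by (intro tendsto_intros d)
    show "(\<lambda>N. norm (dtrunc N f) * sqrt (embedding_const l)) \<longlonglongrightarrow> norm f * sqrt (embedding_const l)"
      by (intro tendsto_intros dtrunc_tendsto)
    show "\<exists>N. \<forall>n\<ge>N. norm (D n) \<le> norm (dtrunc n f) * sqrt (embedding_const l)"
    proof (intro exI allI impI)
      show "norm (D n) \<le> norm (dtrunc n f) * sqrt (embedding_const l)" for n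
        by (rule bound[where N = n]) (simp_all add: D dcoeff_dtrunc)
    qed
  qed
  ultimately show ?thesis by blast
qed

lemma dseries_eval_comp_op:
  assumes \<phi>: "char0_symbol \<phi> l" and s: "Re s > 1/2"
  shows "dseries_eval (comp_op \<phi> f) s = dseries_eval f (\<phi> s)"
proof -
  obtain T where T: "\<And>f s. Re s > 1/2 \<Longrightarrow> dseries_eval (T f) s = dseries_eval f (\<phi> s)"
    and T_bound: "\<And>f. norm (T f) \<le> norm f * sqrt (embedding_const l)"
    using comp_dseries[OF \<phi>] by metis
  have \<phi>s: "Re (\<phi> s) > 1/2" if "Re s > 1/2" for s using that by (intro char0_symbolD(2)[OF \<phi>]) simp
  have "bounded_linear T"
  proof (rule bounded_linear_intro)
    show "T (f + g) = T f + T g" for f g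
      by (rule dseries_eqI_eval) (simp only: T dseries_eval_add[OF \<phi>s] dseries_eval_add)
    show "T (r *\<^sub>R f) = r *\<^sub>R T f" for r f
      by (rule dseries_eqI_eval) (simp only: T dseries_eval_scaleR[OF \<phi>s] dseries_eval_scaleR)
  qed (rule T_bound)
  then have B: "blinfun_apply (Blinfun T) = T" by (rule bounded_linear_Blinfun_apply)
  have "comp_op \<phi> = Blinfun T"
    unfolding comp_op_def
  proof (rule the_equality)
    show "\<forall>f. \<forall>s\<in>half_plane (1/2). dseries_eval (blinfun_apply (Blinfun T) f) s = dseries_eval f (\<phi> s)"
      by (simp add: B T)
    fix U :: "dseries \<Rightarrow>\<^sub>L dseries"
    assume U: "\<forall>f. \<forall>s\<in>half_plane (1/2). dseries_eval (blinfun_apply U f) s = dseries_eval f (\<phi> s)"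
    show "U = Blinfun T"
      by (intro blinfun_eqI dseries_eqI_eval) (use U in \<open>simp add: B T\<close>)
  qed
  then show ?thesis using T[OF s] by (simp add: B)
qed

text \<open>
  The additive constant \<open>S\<close> is the bound used for compactness on the part of the half-plane where both
  symbols stay away from the line \<open>Re w = 1/2\<close>; it contributes to the majorant a constant function, whose
  limit at \<open>+\<infinity>\<close> is \<open>S\<close>.
\<close>

lemma norm_comp_op_diff_finite_support:
  assumes \<phi>: "char0_symbol \<phi> l" and \<phi>': "char0_symbol \<phi>' l'"
    and f: "\<And>n. n > N \<Longrightarrow> dcoeff f n = 0" and \<kappa>: "\<kappa> \<ge> 0"
    and le: "\<And>s. Re s > 0 \<Longrightarrow> (cmod (dpoly (dcoeff f) N (\<phi> s) - dpoly (dcoeff f) N (\<phi>' s)))\<^sup>2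
               \<le> \<kappa> * Re (poisson_majorant (dcoeff f) N (\<phi> s)) + S"
  shows "(norm ((comp_op \<phi> - comp_op \<phi>') f))\<^sup>2 \<le> \<kappa> * (embedding_const l * (norm f)\<^sup>2) + S"
proof -
  obtain d where d: "\<And>s. Re s > 1/2 \<Longrightarrow> dseries_eval d s = dpoly (dcoeff f) N (\<phi> s) - dpoly (dcoeff f) N (\<phi>' s)"
    "(norm d)\<^sup>2 \<le> Re (of_real \<kappa> * poisson_majorant (dcoeff f) N l + of_real S)"
  proof (rule dominated_approximable_is_dseries)
    show "approximable \<epsilon> (\<lambda>s. dpoly (dcoeff f) N (\<phi> s) - dpoly (dcoeff f) N (\<phi>' s))"
      "approximable \<epsilon> (\<lambda>s. of_real \<kappa> * poisson_majorant (dcoeff f) N (\<phi> s) + of_real S)"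
      if "\<epsilon> > 0" for \<epsilon>
      using that char0_symbolD(1)[OF \<phi> that] char0_symbolD(1)[OF \<phi>' that]
      by (auto intro!: approximable_dpoly_comp approximable_poisson_majorant_comp approximable_diff approximable_add approximable_cmult approximable_const)
    show "(cmod (dpoly (dcoeff f) N (\<phi> s) - dpoly (dcoeff f) N (\<phi>' s)))\<^sup>2
        \<le> Re (of_real \<kappa> * poisson_majorant (dcoeff f) N (\<phi> s) + of_real S)" if "Re s > 0" for s
      using le[OF that] by simp
    show "((\<lambda>x. of_real \<kappa> * poisson_majorant (dcoeff f) N (\<phi> (of_real x)) + of_real S)
        \<longlongrightarrow> of_real \<kappa> * poisson_majorant (dcoeff f) N l + of_real S) at_top"
      by (intro tendsto_intros tendsto_poisson_majorant char0_symbolD(3)[OF \<phi>])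
  qed blast
  have "(comp_op \<phi> - comp_op \<phi>') f = d"
  proof (rule dseries_eqI_eval)
    fix s assume s: "Re s > 1/2"
    have fin: "dseries_eval f w = dpoly (dcoeff f) N w" for w
      by (rule dseries_eval_finite_support[OF f])
    show "dseries_eval ((comp_op \<phi> - comp_op \<phi>') f) s = dseries_eval d s"
      using s by (simp add: blinfun.diff_left dseries_eval_diff d(1) fin
          dseries_eval_comp_op[OF \<phi> s] dseries_eval_comp_op[OF \<phi>' s])
  qed
  moreover have "\<kappa> * Re (poisson_majorant (dcoeff f) N l) \<le> \<kappa> * (embedding_const l * (norm f)\<^sup>2)"
    by (intro mult_left_mono Re_poisson_majorant_dcoeff_le Re_char0_symbol_limit[OF \<phi>] \<kappa>)
  ultimately show ?thesis using d(2) by simp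
qed

text \<open>
  The hypothesis makes the factor in the continuity estimate for Dirichlet polynomials at most \<open>c\<^sup>2\<close>,
  uniformly on \<open>half_plane 0\<close>.
\<close>

lemma norm_comp_op_diff_le:
  assumes \<phi>: "char0_symbol \<phi> l" and \<phi>': "char0_symbol \<phi>' l'" and c: "c \<ge> 0"
    and le: "\<And>s. Re s > 0 \<Longrightarrow> (cmod (\<phi> s - \<phi>' s))\<^sup>2 \<le> c\<^sup>2 * (4 * (Re (\<phi> s) - 1/2) * (Re (\<phi>' s) - 1/2))"
  shows "norm (comp_op \<phi> - comp_op \<phi>') \<le> c * sqrt (embedding_const l)"
proof (rule norm_blinfun_bound)
  have K: "embedding_const l \<ge> 0" by (intro embedding_const_nonneg Re_char0_symbol_limit[OF \<phi>])
  then show "0 \<le> c * sqrt (embedding_const l)" using c by simp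
  fix f
  have "norm ((comp_op \<phi> - comp_op \<phi>') (dtrunc N f)) \<le> c * sqrt (embedding_const l) * norm (dtrunc N f)" for N
  proof (rule power2_le_imp_le)
    define h where "h = dtrunc N f"
    have h: "dcoeff h n = 0" if "n > N" for n using that by (simp add: h_def dcoeff_dtrunc)
    have "(norm ((comp_op \<phi> - comp_op \<phi>') h))\<^sup>2 \<le> c\<^sup>2 * (embedding_const l * (norm h)\<^sup>2) + 0"
    proof (rule norm_comp_op_diff_finite_support[OF \<phi> \<phi>' h])
      fix s assume s: "Re s > 0"
      define P where "P = 4 * (Re (\<phi> s) - 1/2) * (Re (\<phi>' s) - 1/2)"
      have P: "P > 0" using char0_symbolD(2)[OF \<phi> s] char0_symbolD(2)[OF \<phi>' s] by (simp add: P_def)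
      have M: "0 \<le> Re (poisson_majorant (dcoeff h) N (\<phi> s))"
        using dpoly_square_le_poisson_majorant[of "\<phi> s" "dcoeff h" N] char0_symbolD(2)[OF \<phi> s]
        by (meson less_imp_le order_trans zero_le_power2)
      have "(cmod (dpoly (dcoeff h) N (\<phi> s) - dpoly (dcoeff h) N (\<phi>' s)))\<^sup>2
          \<le> (cmod (\<phi> s - \<phi>' s))\<^sup>2 / P * Re (poisson_majorant (dcoeff h) N (\<phi> s))"
        unfolding P_def by (intro dpoly_difference_square_le_poisson_majorant char0_symbolD(2)[OF \<phi> s] char0_symbolD(2)[OF \<phi>' s])
      also have "\<dots> \<le> c\<^sup>2 * Re (poisson_majorant (dcoeff h) N (\<phi> s))"
      proof (intro mult_right_mono M)
        have "(cmod (\<phi> s - \<phi>' s))\<^sup>2 \<le> c\<^sup>2 * P" unfolding P_def by (rule le[OF s])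
        then show "(cmod (\<phi> s - \<phi>' s))\<^sup>2 / P \<le> c\<^sup>2" using P by (simp add: pos_divide_le_eq)
      qed
      finally show "(cmod (dpoly (dcoeff h) N (\<phi> s) - dpoly (dcoeff h) N (\<phi>' s)))\<^sup>2
          \<le> c\<^sup>2 * Re (poisson_majorant (dcoeff h) N (\<phi> s)) + 0" by simp
    qed auto
    also have "\<dots> = (c * sqrt (embedding_const l) * norm h)\<^sup>2"
      using K by (simp add: power_mult_distrib)
    finally show "(norm ((comp_op \<phi> - comp_op \<phi>') (dtrunc N f)))\<^sup>2 \<le> (c * sqrt (embedding_const l) * norm (dtrunc N f))\<^sup>2"
      by (simp add: h_def)
  qed (use c K in simp)
  then show "norm ((comp_op \<phi> - comp_op \<phi>') f) \<le> c * sqrt (embedding_const l) * norm f"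
    by (intro LIMSEQ_le[of "\<lambda>N. norm ((comp_op \<phi> - comp_op \<phi>') (dtrunc N f))" _ "\<lambda>N. c * sqrt (embedding_const l) * norm (dtrunc N f)"])
      (auto intro!: tendsto_intros dtrunc_tendsto)
qed

section \<open>Compactness of differences\<close>

text \<open>
  The exponent is shifted so that every index \<open>m\<close> gives an element of the space: the coefficient at
  \<open>0\<close> has to vanish.
\<close>

lift_definition dmonomial :: "nat \<Rightarrow> complex \<Rightarrow> dseries" is "\<lambda>m z n. if n = Suc m then z else 0"
proof -
  fix m :: nat and z :: complex
  have "summable (\<lambda>n. (cmod (if n = Suc m then z else 0))\<^sup>2)"
    by (rule summable_finite[of "{Suc m}"]) auto
  then show "(if 0 = Suc m then z else 0) = 0 \<and> summable (\<lambda>n. (cmod (if n = Suc m then z else 0))\<^sup>2)"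
    by simp
qed

lemma norm_dmonomial_diff: "norm (dmonomial m z - dmonomial m w) \<le> cmod (z - w)"
proof (rule power2_le_imp_le[OF norm_dseries_square_leI])
  fix K
  have "(\<Sum>n=1..K. (cmod (dcoeff (dmonomial m z - dmonomial m w) n))\<^sup>2)
      = (\<Sum>n=1..K. if n = Suc m then (cmod (z - w))\<^sup>2 else 0)"
    by (intro sum.cong refl) (simp add: minus_dseries.rep_eq dmonomial.rep_eq)
  also have "\<dots> \<le> (cmod (z - w))\<^sup>2" by simp
  finally show "(\<Sum>n=1..K. (cmod (dcoeff (dmonomial m z - dmonomial m w) n))\<^sup>2) \<le> (cmod (z - w))\<^sup>2" .
qed simp

lemma continuous_on_dmonomial: "continuous_on A (dmonomial m)"
proof (rule continuous_onI)
  fix z :: complex and e :: real assume "e > 0"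
  then show "\<exists>d>0. \<forall>w\<in>A. dist w z < d \<longrightarrow> dist (dmonomial m w) (dmonomial m z) \<le> e"
    using norm_dmonomial_diff[of m] unfolding dist_norm by (metis less_imp_le order_trans)
qed

lemma dtrunc_Suc: "dtrunc (Suc N) f = dtrunc N f + dmonomial N (dcoeff f (Suc N))"
  by (rule dseries_eqI) (auto simp: dcoeff_dtrunc plus_dseries.rep_eq dmonomial.rep_eq)

lemma dtrunc_cball_subset_compact: "\<exists>A. compact A \<and> dtrunc N ` cball 0 1 \<subseteq> A"
proof (induction N)
  case 0
  have "dtrunc 0 f = 0" for f
    by (rule dseries_eqI) (simp add: dcoeff_dtrunc zero_dseries.rep_eq)
  then show ?case by (intro exI[of _ "{0}"]) auto
next
  case (Suc N)
  then obtain A where A: "compact A" "dtrunc N ` cball 0 1 \<subseteq> A" by blast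
  define B where "B = {x + y | x y. x \<in> A \<and> y \<in> dmonomial N ` cball 0 1}"
  have "compact (dmonomial N ` cball 0 1)"
    by (intro compact_continuous_image continuous_on_dmonomial compact_cball)
  then have "compact B" unfolding B_def by (rule compact_sums[OF A(1)])
  moreover have "dtrunc (Suc N) f \<in> B" if "f \<in> cball 0 1" for f
  proof -
    have "cmod (dcoeff f (Suc N)) \<le> 1" using cmod_dcoeff_le[of f "Suc N"] that by simp
    then have "dmonomial N (dcoeff f (Suc N)) \<in> dmonomial N ` cball 0 1" by simp
    moreover have "dtrunc N f \<in> A" using A(2) that by blast
    ultimately show ?thesis unfolding B_def dtrunc_Suc by blast
  qed
  ultimately show ?case by blast
qed

text \<open>
  The hypothesis says that \<open>T\<close> is the norm limit of its compositions with the truncations, which have finite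
  rank. Total boundedness of the image of the unit ball suffices, as the space is complete.
\<close>

lemma compact_operatorI_dtrunc:
  fixes T :: "dseries \<Rightarrow>\<^sub>L dseries"
  assumes "\<And>e. e > 0 \<Longrightarrow> \<exists>N. \<forall>f. norm (T (f - dtrunc N f)) \<le> e * norm f"
  shows "compact_operator T"
proof -
  define S where "S = blinfun_apply T ` cball 0 1"
  have cover: "\<exists>k. finite k \<and> closure S \<subseteq> (\<Union>x\<in>k. ball x e)" if e: "e > 0" for e
  proof -
    have e3: "e / 3 > 0" using e by simp
    then obtain N where N: "\<And>f. norm (T (f - dtrunc N f)) \<le> e / 3 * norm f" using assms by blast
    obtain A where A: "compact A" "dtrunc N ` cball 0 1 \<subseteq> A" using dtrunc_cball_subset_compact by blast
    have "compact (blinfun_apply T ` A)"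
      by (intro compact_continuous_image A) (intro continuous_intros)
    then obtain k where k: "finite k" "blinfun_apply T ` A \<subseteq> (\<Union>x\<in>k. ball x (e / 3))"
      using e3 unfolding compact_eq_totally_bounded by blast
    have "S \<subseteq> (\<Union>x\<in>k. cball x (2 * (e / 3)))"
    proof
      fix y assume "y \<in> S"
      then obtain f where f: "f \<in> cball 0 1" "y = T f" by (auto simp: S_def)
      then have "T (dtrunc N f) \<in> (\<Union>x\<in>k. ball x (e / 3))" using k(2) A(2) by blast
      then obtain x where x: "x \<in> k" "dist x (T (dtrunc N f)) < e / 3" by auto
      have "dist (T (dtrunc N f)) (T f) = norm (T (f - dtrunc N f))"
        by (simp add: dist_norm blinfun.diff_right norm_minus_commute)
      also have "\<dots> \<le> e / 3 * norm f" by (rule N)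
      also have "\<dots> \<le> e / 3" using f(1) e by (simp add: mult_left_le)
      finally have "dist x y \<le> 2 * (e / 3)"
        using x(2) dist_triangle[of x "T f" "T (dtrunc N f)"] f(2) by simp
      with x(1) show "y \<in> (\<Union>x\<in>k. cball x (2 * (e / 3)))" by auto
    qed
    then have "closure S \<subseteq> (\<Union>x\<in>k. cball x (2 * (e / 3)))"
      by (rule closure_minimal) (intro closed_UN k(1) closed_cball ballI)
    also have "\<dots> \<subseteq> (\<Union>x\<in>k. ball x e)" using e by (intro UN_mono) auto
    finally show ?thesis using k(1) by blast
  qed
  moreover have "complete (closure S)"
    by (rule complete_closed_subset[OF closed_closure _ complete_dseries_UNIV]) simp
  ultimately show ?thesis unfolding compact_operator_def compact_eq_totally_bounded S_def by blast
qed

lemma dseries_eval_tail_bound: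
  assumes h: "\<And>n. n \<le> N \<Longrightarrow> dcoeff h n = 0" and x: "1/2 < x" "x \<le> Re w"
  shows "cmod (dseries_eval h w) \<le> norm h * sqrt (zeta_tail N x)"
proof -
  have "dpoly (dcoeff h) N w = 0" unfolding dpoly_def using h by (intro sum.neutral) auto
  then have "cmod (dseries_eval h w) \<le> norm h * sqrt (zeta_tail N (Re w))"
    using dseries_eval_minus_dpoly_le[of w h N] x by simp
  also have "\<dots> \<le> norm h * sqrt (zeta_tail N x)"
    by (intro mult_left_mono real_sqrt_le_mono zeta_tail_antimono x) simp
  finally show ?thesis .
qed

text \<open>
  Apply the difference to \<open>h\<close> whose coefficients up to \<open>N\<close> vanish. Where both symbols are \<open>\<theta>\<close>-far from the
  boundary line, \<open>h\<close> is uniformly small because \<open>zeta_tail N (1/2 + \<theta>)\<close> is; elsewhere the continuity estimate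
  has the small factor \<open>\<kappa>\<close>.
\<close>

lemma compact_comp_op_diff:
  assumes \<phi>: "char0_symbol \<phi> l" and \<phi>': "char0_symbol \<phi>' l'"
    and close: "\<And>\<epsilon>. \<epsilon> > 0 \<Longrightarrow> \<exists>\<theta>>0. \<forall>s. Re s > 0 \<longrightarrow>
       (\<theta> \<le> Re (\<phi> s) - 1/2 \<and> \<theta> \<le> Re (\<phi>' s) - 1/2) \<or>
       (cmod (\<phi> s - \<phi>' s))\<^sup>2 \<le> \<epsilon> * (4 * (Re (\<phi> s) - 1/2) * (Re (\<phi>' s) - 1/2))"
  shows "compact_operator (comp_op \<phi> - comp_op \<phi>')"
proof (rule compact_operatorI_dtrunc)
  fix e :: real assume e: "e > 0"
  define T where "T = comp_op \<phi> - comp_op \<phi>'"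
  have K: "embedding_const l \<ge> 0" by (intro embedding_const_nonneg Re_char0_symbol_limit[OF \<phi>])
  \<comment> \<open>Half of \<open>e\<^sup>2\<close> is spent near the boundary line, the other half where \<open>h\<close> below is uniformly small.\<close>
  define \<kappa> where "\<kappa> = e\<^sup>2 / 2 / (embedding_const l + 1)"
  have \<kappa>: "\<kappa> > 0" "\<kappa> * embedding_const l \<le> e\<^sup>2 / 2"
  proof -
    show "\<kappa> > 0" unfolding \<kappa>_def using e K by (intro divide_pos_pos) auto
    then have "\<kappa> * embedding_const l \<le> \<kappa> * (embedding_const l + 1)" by simp
    also have "embedding_const l + 1 \<noteq> 0" using K by linarith
    then have "\<kappa> * (embedding_const l + 1) = e\<^sup>2 / 2"
      unfolding \<kappa>_def by (rule nonzero_eq_divide_eq[THEN iffD1, OF _ refl])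
    finally show "\<kappa> * embedding_const l \<le> e\<^sup>2 / 2" .
  qed
  obtain \<theta> where \<theta>: "\<theta> > 0" and dich: "\<And>s. Re s > 0 \<Longrightarrow>
       (\<theta> \<le> Re (\<phi> s) - 1/2 \<and> \<theta> \<le> Re (\<phi>' s) - 1/2) \<or>
       (cmod (\<phi> s - \<phi>' s))\<^sup>2 \<le> \<kappa> * (4 * (Re (\<phi> s) - 1/2) * (Re (\<phi>' s) - 1/2))"
    using close[OF \<kappa>(1)] by blast
  have x: "1/2 < 1/2 + \<theta>" using \<theta> by simp
  have "\<forall>\<^sub>F N in sequentially. zeta_tail N (1/2 + \<theta>) < e\<^sup>2 / 8"
    by (rule order_tendstoD(2)[OF zeta_tail_tendsto[OF x]]) (use e in simp)
  then obtain N where N: "zeta_tail N (1/2 + \<theta>) < e\<^sup>2 / 8"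
    using eventually_happens trivial_limit_sequentially by blast
  have Z: "zeta_tail N (1/2 + \<theta>) \<ge> 0" by (rule zeta_tail_nonneg[OF x])
  have fin: "norm (T (dtrunc M f - dtrunc N f)) \<le> e * norm f" if M: "M \<ge> N" for M f
  proof (rule power2_le_imp_le)
    define h where "h = dtrunc M f - dtrunc N f"
    have h: "dcoeff h n = 0" if "n > M" for n
      using that M by (simp add: h_def minus_dseries.rep_eq dcoeff_dtrunc)
    have h0: "dcoeff h n = 0" if "n \<le> N" for n
      using that M by (simp add: h_def minus_dseries.rep_eq dcoeff_dtrunc)
    have hf: "norm h \<le> norm f" unfolding h_def by (rule norm_dtrunc_diff_le)
    then have hf2: "(norm h)\<^sup>2 \<le> (norm f)\<^sup>2" by (intro power_mono) auto
    have fin: "dpoly (dcoeff h) M w = dseries_eval h w" for w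
      by (rule dseries_eval_finite_support[OF h, symmetric])
    define S where "S = e\<^sup>2 / 2 * (norm h)\<^sup>2"
    have "(norm (T h))\<^sup>2 \<le> \<kappa> * (embedding_const l * (norm h)\<^sup>2) + S"
      unfolding T_def
    proof (rule norm_comp_op_diff_finite_support[OF \<phi> \<phi>' h])
      fix s assume s: "Re s > 0"
      have M0: "0 \<le> Re (poisson_majorant (dcoeff h) M (\<phi> s))"
        using dpoly_square_le_poisson_majorant[of "\<phi> s" "dcoeff h" M] char0_symbolD(2)[OF \<phi> s]
        by (meson less_imp_le order_trans zero_le_power2)
      have S0: "S \<ge> 0" by (simp add: S_def)
      from dich[OF s]
      show "(cmod (dpoly (dcoeff h) M (\<phi> s) - dpoly (dcoeff h) M (\<phi>' s)))\<^sup>2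
          \<le> \<kappa> * Re (poisson_majorant (dcoeff h) M (\<phi> s)) + S"
      proof (elim disjE conjE)
        assume \<theta>s: "\<theta> \<le> Re (\<phi> s) - 1/2" "\<theta> \<le> Re (\<phi>' s) - 1/2"
        have "cmod (dseries_eval h (\<phi> s) - dseries_eval h (\<phi>' s))
            \<le> norm h * sqrt (zeta_tail N (1/2 + \<theta>)) + norm h * sqrt (zeta_tail N (1/2 + \<theta>))"
          using \<theta>s by (intro order_trans[OF norm_triangle_ineq4] add_mono dseries_eval_tail_bound[OF h0 x]) auto
        also have "\<dots> = 2 * (norm h * sqrt (zeta_tail N (1/2 + \<theta>)))" by simp
        finally have "(cmod (dseries_eval h (\<phi> s) - dseries_eval h (\<phi>' s)))\<^sup>2
            \<le> (2 * (norm h * sqrt (zeta_tail N (1/2 + \<theta>))))\<^sup>2" by (rule power_mono) simp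
        also have "\<dots> = 4 * zeta_tail N (1/2 + \<theta>) * (norm h)\<^sup>2"
          using Z by (simp add: power_mult_distrib)
        also have "\<dots> \<le> S" unfolding S_def using N by (intro mult_right_mono) auto
        also have "\<dots> \<le> \<kappa> * Re (poisson_majorant (dcoeff h) M (\<phi> s)) + S"
          using M0 \<kappa>(1) by simp
        finally show ?thesis unfolding fin .
      next
        define P where "P = 4 * (Re (\<phi> s) - 1/2) * (Re (\<phi>' s) - 1/2)"
        have P: "P > 0" using char0_symbolD(2)[OF \<phi> s] char0_symbolD(2)[OF \<phi>' s] by (simp add: P_def)
        assume "(cmod (\<phi> s - \<phi>' s))\<^sup>2 \<le> \<kappa> * (4 * (Re (\<phi> s) - 1/2) * (Re (\<phi>' s) - 1/2))"
        then have le: "(cmod (\<phi> s - \<phi>' s))\<^sup>2 / P \<le> \<kappa>"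
          unfolding P_def[symmetric] using P by (simp add: pos_divide_le_eq)
        have "(cmod (dpoly (dcoeff h) M (\<phi> s) - dpoly (dcoeff h) M (\<phi>' s)))\<^sup>2
            \<le> (cmod (\<phi> s - \<phi>' s))\<^sup>2 / P * Re (poisson_majorant (dcoeff h) M (\<phi> s))"
          unfolding P_def by (intro dpoly_difference_square_le_poisson_majorant char0_symbolD(2)[OF \<phi> s] char0_symbolD(2)[OF \<phi>' s])
        also have "\<dots> \<le> \<kappa> * Re (poisson_majorant (dcoeff h) M (\<phi> s))" by (rule mult_right_mono[OF le M0])
        finally show ?thesis using S0 by simp
      qed
    qed (use \<kappa>(1) in auto)
    also have "\<kappa> * (embedding_const l * (norm h)\<^sup>2) \<le> e\<^sup>2 / 2 * (norm h)\<^sup>2"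
      using mult_right_mono[OF \<kappa>(2), of "(norm h)\<^sup>2"] by (simp add: mult.assoc)
    also have "e\<^sup>2 / 2 * (norm h)\<^sup>2 + S = e\<^sup>2 * (norm h)\<^sup>2" by (simp add: S_def)
    also have "\<dots> \<le> (e * norm f)\<^sup>2" using hf2 by (simp add: power_mult_distrib mult_left_mono)
    finally show "(norm (T (dtrunc M f - dtrunc N f)))\<^sup>2 \<le> (e * norm f)\<^sup>2" by (simp add: h_def)
  qed (use e in simp)
  have "norm (T (f - dtrunc N f)) \<le> e * norm f" for f
  proof (rule tendsto_upperbound)
    show "(\<lambda>M. norm (T (dtrunc M f - dtrunc N f))) \<longlonglongrightarrow> norm (T (f - dtrunc N f))"
      by (intro tendsto_intros dtrunc_tendsto)
    show "\<forall>\<^sub>F M in sequentially. norm (T (dtrunc M f - dtrunc N f)) \<le> e * norm f"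
      using fin by (auto intro: eventually_sequentiallyI[of N])
  qed simp
  then show "\<exists>N. \<forall>f. norm ((comp_op \<phi> - comp_op \<phi>') (f - dtrunc N f)) \<le> e * norm f"
    unfolding T_def by blast
qed

section \<open>Symbols of the Gordon-Hedenmalm class\<close>

lemma gh_repr_uniform:
  assumes "gh_repr \<phi> c0 c" "\<epsilon> > 0" "\<eta> > 0"
  shows "\<exists>N\<ge>1. \<forall>s. Re s > \<epsilon> \<longrightarrow> cmod (\<phi> s - of_nat c0 * s - dpoly c N s) \<le> \<eta>"
proof -
  have "\<forall>\<^sub>F N in sequentially. \<forall>s\<in>half_plane \<epsilon>. dist (\<Sum>n=1..N. c n * of_nat n powr (- s)) (dirichlet_series c s) < \<eta>"
    using assms by (auto simp: gh_repr_def uniform_limit_iff)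
  with eventually_ge_at_top[of 1] have "\<forall>\<^sub>F N in sequentially. N \<ge> 1 \<and>
      (\<forall>s\<in>half_plane \<epsilon>. dist (dpoly c N s) (dirichlet_series c s) < \<eta>)"
    by eventually_elim (simp add: dpoly_def)
  then have "\<exists>N. N \<ge> 1 \<and> (\<forall>s\<in>half_plane \<epsilon>. dist (dpoly c N s) (dirichlet_series c s) < \<eta>)"
    by (rule eventually_happens'[OF sequentially_bot])
  then obtain N where N: "N \<ge> 1" "\<forall>s\<in>half_plane \<epsilon>. dist (dpoly c N s) (dirichlet_series c s) < \<eta>"
    by blast
  have "cmod (\<phi> s - of_nat c0 * s - dpoly c N s) \<le> \<eta>" if s: "Re s > \<epsilon>" for s
  proof -
    have "\<phi> s = of_nat c0 * s + dirichlet_series c s"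
      using assms s by (simp add: gh_repr_def)
    with bspec[OF N(2), of s] s show ?thesis by (simp add: dist_norm norm_minus_commute)
  qed
  with N(1) show ?thesis by blast
qed

text \<open>
  The coefficient \<open>c0\<close> is the limit of \<open>\<phi> x / x\<close> as \<open>x\<close> tends to \<open>+\<infinity>\<close>.
\<close>

lemma gh_repr_unique_char:
  assumes "gh_repr \<phi> c0 c" "gh_repr \<phi> c0' c'"
  shows "c0 = c0'"
proof (rule ccontr)
  assume neq: "c0 \<noteq> c0'"
  have lim: "((\<lambda>x. \<phi> (of_real x) - of_nat c0 * of_real x) \<longlongrightarrow> c 1) at_top" if "gh_repr \<phi> c0 c" for c0 c
    using partial_sums_tendsto_constant_term[of 1 "\<lambda>s. \<phi> s - of_nat c0 * s" c] gh_repr_uniform[OF that zero_less_one]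
    by blast
  have "((\<lambda>x. (\<phi> (of_real x) - of_nat c0 * of_real x) - (\<phi> (of_real x) - of_nat c0' * of_real x))
      \<longlongrightarrow> c 1 - c' 1) at_top"
    by (intro tendsto_diff lim assms)
  moreover have "((\<lambda>x::real. inverse (of_real x :: complex)) \<longlongrightarrow> 0) at_top"
    by (rule filterlim_compose[OF tendsto_inverse_0 filterlim_of_real_at_infinity])
  ultimately have "((\<lambda>x. ((\<phi> (of_real x) - of_nat c0 * of_real x) - (\<phi> (of_real x) - of_nat c0' * of_real x))
      * inverse (of_real x)) \<longlongrightarrow> (c 1 - c' 1) * 0) at_top"
    by (rule tendsto_mult)
  moreover have "\<forall>\<^sub>F x in at_top. ((\<phi> (of_real x) - of_nat c0 * of_real x) - (\<phi> (of_real x) - of_nat c0' * of_real x))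
      * inverse (of_real x) = of_nat c0' - of_nat c0"
    using eventually_gt_at_top[of 0] by eventually_elim (simp add: field_simps)
  ultimately have "((\<lambda>x::real. of_nat c0' - of_nat c0 :: complex) \<longlongrightarrow> (c 1 - c' 1) * 0) at_top"
    by (rule Lim_transform_eventually)
  then have "of_nat c0' - of_nat c0 = (0 :: complex)"
    by (simp add: tendsto_const_iff)
  with neq show False by simp
qed

lemma gh_char_0_repr:
  assumes "\<phi> \<in> gordon_hedenmalm" "gh_char \<phi> = 0"
  obtains c where "gh_repr \<phi> 0 c"
proof -
  obtain c0 c where c: "gh_repr \<phi> c0 c" using assms(1) by (auto simp: gordon_hedenmalm_def)
  then have "gh_char \<phi> = c0"
    unfolding gh_char_def using gh_repr_unique_char by (intro the_equality) blast+
  with c assms(2) show thesis using that by simp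
qed

lemma gh_repr_imp_char0_symbol:
  assumes c: "gh_repr \<phi> 0 c"
  shows "char0_symbol \<phi> (c 1)"
  unfolding char0_symbol_def
proof (intro conjI allI impI)
  show "approximable \<epsilon> \<phi>" if "\<epsilon> > 0" for \<epsilon>
    unfolding approximable_def
  proof (intro allI impI)
    fix \<eta> :: real assume "\<eta> > 0"
    then obtain N where N: "N \<ge> 1" "\<And>s. Re s > \<epsilon> \<Longrightarrow> cmod (\<phi> s - of_nat 0 * s - dpoly c N s) \<le> \<eta>"
      using gh_repr_uniform[OF c \<open>\<epsilon> > 0\<close>] by blast
    show "\<exists>p N. N \<ge> 1 \<and> (\<forall>s\<in>half_plane \<epsilon>. cmod (\<phi> s - dpoly p N s) \<le> \<eta>)"
      by (rule exI[of _ c], rule exI[of _ N]) (use N in simp)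
  qed
  show "Re (\<phi> s) > 1/2" if "Re s > 0" for s
  proof -
    have "\<phi> s = dirichlet_series c s" using c that by (simp add: gh_repr_def)
    moreover have sub: "dirichlet_series c ` half_plane 0 \<subseteq> half_plane (1/2)"
      using c unfolding gh_repr_def by blast
    have "dirichlet_series c s \<in> half_plane (1/2)" by (rule subsetD[OF sub imageI]) (simp add: that)
    ultimately show ?thesis by simp
  qed
  show "((\<lambda>x. \<phi> (of_real x)) \<longlongrightarrow> c 1) at_top"
    using partial_sums_tendsto_constant_term[of 1 \<phi> c] gh_repr_uniform[OF c zero_less_one] by simp
qed

lemma gh_repr_char0I:
  assumes half: "\<And>s. Re s > 0 \<Longrightarrow> Re (\<phi> s) > 1/2"
    and unif: "\<And>\<epsilon>. \<epsilon> > 0 \<Longrightarrow> uniform_limit (half_plane \<epsilon>) (dpoly c) \<phi> sequentially"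
  shows "gh_repr \<phi> 0 c"
proof -
  have eq: "dirichlet_series c s = \<phi> s" if s: "Re s > 0" for s
  proof -
    have "(\<lambda>N. dpoly c N s) \<longlonglongrightarrow> \<phi> s"
      by (rule tendsto_uniform_limitI[OF unif[of "Re s / 2"]]) (use s in auto)
    moreover have "dpoly c N s = (\<Sum>n<Suc N. c n * of_nat n powr (- s))" for N
      unfolding dpoly_def by (intro sum.mono_neutral_left) (auto simp: Suc_le_eq)
    ultimately have "(\<lambda>N. \<Sum>n<Suc N. c n * of_nat n powr (- s)) \<longlonglongrightarrow> \<phi> s" by simp
    then have "(\<lambda>n. c n * of_nat n powr (- s)) sums \<phi> s"
      unfolding sums_def by (rule LIMSEQ_imp_Suc)
    then show ?thesis unfolding dirichlet_series_def by (rule sums_unique[symmetric])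
  qed
  have "uniform_limit (half_plane \<epsilon>) (\<lambda>N s. \<Sum>n=1..N. c n * of_nat n powr (- s)) (dirichlet_series c) sequentially"
    if "\<epsilon> > 0" for \<epsilon>
  proof -
    have "uniform_limit (half_plane \<epsilon>) (dpoly c) (dirichlet_series c) sequentially \<longleftrightarrow>
        uniform_limit (half_plane \<epsilon>) (dpoly c) \<phi> sequentially"
      by (rule uniform_limit_cong') (use that eq in auto)
    with unif[OF that] show ?thesis by (simp add: dpoly_def[abs_def])
  qed
  with half eq show ?thesis by (auto simp: gh_repr_def image_subset_iff)
qed

lemma gh_repr_convex_combination:
  assumes 0: "gh_repr \<phi> 0 c" and 1: "gh_repr \<phi>' 0 c'" and t: "0 \<le> t" "t \<le> 1"
  shows "gh_repr (\<lambda>s. of_real (1 - t) * \<phi> s + of_real t * \<phi>' s) 0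
           (\<lambda>n. of_real (1 - t) * c n + of_real t * c' n)"
proof (rule gh_repr_char0I)
  show "Re (of_real (1 - t) * \<phi> s + of_real t * \<phi>' s) > 1/2" if "Re s > 0" for s
    using char0_symbolD(2)[OF char0_symbol_convex_combination[OF gh_repr_imp_char0_symbol[OF 0] gh_repr_imp_char0_symbol[OF 1] t] that] .
  fix \<epsilon> :: real assume \<epsilon>: "\<epsilon> > 0"
  have unif: "uniform_limit (half_plane \<epsilon>) (dpoly c) \<phi> sequentially" if "gh_repr \<phi> 0 c" for \<phi> c
  proof -
    have "uniform_limit (half_plane \<epsilon>) (dpoly c) \<phi> sequentially \<longleftrightarrow>
        uniform_limit (half_plane \<epsilon>) (dpoly c) (dirichlet_series c) sequentially"
      by (rule uniform_limit_cong') (use that \<epsilon> in \<open>auto simp: gh_repr_def\<close>)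
    then show ?thesis using that \<epsilon> by (simp add: gh_repr_def dpoly_def[abs_def])
  qed
  have "dpoly (\<lambda>n. of_real (1 - t) * c n + of_real t * c' n)
      = (\<lambda>N s. of_real (1 - t) * dpoly c N s + of_real t * dpoly c' N s)"
    by (intro ext) (simp only: dpoly_cmult dpoly_add)
  then show "uniform_limit (half_plane \<epsilon>) (dpoly (\<lambda>n. of_real (1 - t) * c n + of_real t * c' n))
      (\<lambda>s. of_real (1 - t) * \<phi> s + of_real t * \<phi>' s) sequentially"
    by (simp only:) (intro uniform_limit_intros unif 0 1)
qed

text \<open>
  For \<open>Re w > 1/2\<close> one has \<open>\<bar>1 + w\<bar> \<ge> 1\<close>, so dividing by its square only decreases.
\<close>

lemma gh_min_le:
  assumes "Re (\<phi>\<^sub>0 s) > 1/2" "Re (\<phi>\<^sub>1 s) > 1/2"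
  shows "gh_min \<phi>\<^sub>0 \<phi>\<^sub>1 s > 0" "gh_min \<phi>\<^sub>0 \<phi>\<^sub>1 s \<le> Re (\<phi>\<^sub>0 s) - 1/2" "gh_min \<phi>\<^sub>0 \<phi>\<^sub>1 s \<le> Re (\<phi>\<^sub>1 s) - 1/2"
proof -
  have *: "0 < (Re w - 1/2) / (cmod (1 + w))\<^sup>2" "(Re w - 1/2) / (cmod (1 + w))\<^sup>2 \<le> Re w - 1/2"
    if w: "Re w > 1/2" for w
  proof -
    have "1 \<le> cmod (1 + w)" using complex_Re_le_cmod[of "1 + w"] w by simp
    then have "1 \<le> (cmod (1 + w))\<^sup>2" by (rule one_le_power)
    then show "0 < (Re w - 1/2) / (cmod (1 + w))\<^sup>2" "(Re w - 1/2) / (cmod (1 + w))\<^sup>2 \<le> Re w - 1/2"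
      using w by (auto intro!: divide_pos_pos) (simp add: divide_le_eq mult_le_cancel_left1)
  qed
  show "gh_min \<phi>\<^sub>0 \<phi>\<^sub>1 s > 0" "gh_min \<phi>\<^sub>0 \<phi>\<^sub>1 s \<le> Re (\<phi>\<^sub>0 s) - 1/2" "gh_min \<phi>\<^sub>0 \<phi>\<^sub>1 s \<le> Re (\<phi>\<^sub>1 s) - 1/2"
    unfolding gh_min_def using *[OF assms(1)] *[OF assms(2)] by (auto simp: min_def)
qed

section \<open>Connected components and compact differences\<close>

theorem theorem5p15:
  fixes \<phi>\<^sub>0 \<phi>\<^sub>1 :: "complex \<Rightarrow> complex" and C :: real
  assumes "\<phi>\<^sub>0 \<in> gordon_hedenmalm" and "\<phi>\<^sub>1 \<in> gordon_hedenmalm"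
    and "gh_char \<phi>\<^sub>0 = 0" and "gh_char \<phi>\<^sub>1 = 0"
    and "C > 0"
    and "\<forall>s\<in>half_plane 0. cmod (\<phi>\<^sub>0 s - \<phi>\<^sub>1 s) \<le> C * gh_min \<phi>\<^sub>0 \<phi>\<^sub>1 s"
  shows "connected_component comp_ops (comp_op \<phi>\<^sub>0) (comp_op \<phi>\<^sub>1) \<and>
    ((\<forall>\<epsilon>>0. \<exists>\<theta>>0. \<forall>s\<in>half_plane 0. gh_min \<phi>\<^sub>0 \<phi>\<^sub>1 s < \<theta> \<longrightarrow>
        cmod (\<phi>\<^sub>0 s - \<phi>\<^sub>1 s) \<le> \<epsilon> * gh_min \<phi>\<^sub>0 \<phi>\<^sub>1 s) \<longrightarrow>
     compact_operator (comp_op \<phi>\<^sub>0 - comp_op \<phi>\<^sub>1))"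
proof -
  obtain c\<^sub>0 where c\<^sub>0: "gh_repr \<phi>\<^sub>0 0 c\<^sub>0" using gh_char_0_repr[OF assms(1,3)] .
  obtain c\<^sub>1 where c\<^sub>1: "gh_repr \<phi>\<^sub>1 0 c\<^sub>1" using gh_char_0_repr[OF assms(2,4)] .
  note s\<^sub>0 = gh_repr_imp_char0_symbol[OF c\<^sub>0] and s\<^sub>1 = gh_repr_imp_char0_symbol[OF c\<^sub>1]
  define m where "m = gh_min \<phi>\<^sub>0 \<phi>\<^sub>1"
  have m: "m s > 0" "m s \<le> Re (\<phi>\<^sub>0 s) - 1/2" "m s \<le> Re (\<phi>\<^sub>1 s) - 1/2" if "Re s > 0" for s
    unfolding m_def using gh_min_le char0_symbolD(2)[OF s\<^sub>0 that] char0_symbolD(2)[OF s\<^sub>1 that] by blast+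
  define \<Phi> where "\<Phi> t = (\<lambda>s. of_real (1 - t) * \<phi>\<^sub>0 s + of_real t * \<phi>\<^sub>1 s)" for t :: real
  define l where "l t = of_real (1 - t) * c\<^sub>0 1 + of_real t * c\<^sub>1 1" for t :: real
  have sym: "char0_symbol (\<Phi> t) (l t)" if "t \<in> {0..1}" for t
    unfolding \<Phi>_def l_def using that by (intro char0_symbol_convex_combination s\<^sub>0 s\<^sub>1) auto
  have gh: "\<Phi> t \<in> gordon_hedenmalm" if "t \<in> {0..1}" for t
    unfolding \<Phi>_def gordon_hedenmalm_def using gh_repr_convex_combination[OF c\<^sub>0 c\<^sub>1, of t] that by auto
  have m\<Phi>: "m s \<le> Re (\<Phi> t s) - 1/2" if "t \<in> {0..1}" "Re s > 0" for t s
    using convex_bound_le[of "- Re (\<phi>\<^sub>0 s)" "- (m s + 1/2)" "- Re (\<phi>\<^sub>1 s)" "1 - t" t] m(2,3)[OF that(2)] that(1)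
    by (simp add: \<Phi>_def)
  have lip: "norm (comp_op (\<Phi> t) - comp_op (\<Phi> u)) \<le> \<bar>t - u\<bar> * C / 2 * sqrt (embedding_const (l t))"
    if t: "t \<in> {0..1}" and u: "u \<in> {0..1}" for t u
  proof (rule norm_comp_op_diff_le[OF sym[OF t] sym[OF u]])
    show "0 \<le> \<bar>t - u\<bar> * C / 2" using assms(5) by simp
    fix s :: complex assume s: "Re s > 0"
    have "\<Phi> t s - \<Phi> u s = of_real (u - t) * (\<phi>\<^sub>0 s - \<phi>\<^sub>1 s)"
      by (simp add: \<Phi>_def algebra_simps)
    then have "cmod (\<Phi> t s - \<Phi> u s) = \<bar>t - u\<bar> * cmod (\<phi>\<^sub>0 s - \<phi>\<^sub>1 s)"
      by (simp add: norm_mult abs_minus_commute del: of_real_diff)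
    also have "\<dots> \<le> \<bar>t - u\<bar> * (C * m s)"
      using assms(6) s by (intro mult_left_mono) (auto simp: m_def)
    finally have "(cmod (\<Phi> t s - \<Phi> u s))\<^sup>2 \<le> (\<bar>t - u\<bar> * (C * m s))\<^sup>2" by (rule power_mono) simp
    also have "\<dots> = (\<bar>t - u\<bar> * C / 2)\<^sup>2 * (4 * (m s * m s))"
      by (simp add: power2_eq_square)
    also have "\<dots> \<le> (\<bar>t - u\<bar> * C / 2)\<^sup>2 * (4 * ((Re (\<Phi> t s) - 1/2) * (Re (\<Phi> u s) - 1/2)))"
      using m\<Phi>[OF t s] m\<Phi>[OF u s] m(1)[OF s] by (intro mult_left_mono mult_mono) auto
    finally show "(cmod (\<Phi> t s - \<Phi> u s))\<^sup>2
        \<le> (\<bar>t - u\<bar> * C / 2)\<^sup>2 * (4 * (Re (\<Phi> t s) - 1/2) * (Re (\<Phi> u s) - 1/2))"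
      by (simp only: mult.assoc)
  qed
  have "continuous_on {0..1} (\<lambda>t. comp_op (\<Phi> t))"
    unfolding continuous_on_def
  proof
    fix t :: real assume t: "t \<in> {0..1}"
    show "((\<lambda>t. comp_op (\<Phi> t)) \<longlongrightarrow> comp_op (\<Phi> t)) (at t within {0..1})"
    proof (rule LIM_zero_cancel, rule Lim_null_comparison)
      show "\<forall>\<^sub>F u in at t within {0..1}. norm (comp_op (\<Phi> u) - comp_op (\<Phi> t))
          \<le> \<bar>t - u\<bar> * C / 2 * sqrt (embedding_const (l t))"
        using lip[OF t] by (auto simp: eventually_at_filter norm_minus_commute)
      have "((\<lambda>u. \<bar>t - u\<bar> * C / 2 * sqrt (embedding_const (l t)))
          \<longlongrightarrow> \<bar>t - t\<bar> * C / 2 * sqrt (embedding_const (l t))) (at t within {0..1})"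
        by (intro tendsto_intros) auto
      then show "((\<lambda>u. \<bar>t - u\<bar> * C / 2 * sqrt (embedding_const (l t))) \<longlongrightarrow> 0) (at t within {0..1})" by simp
    qed
  qed
  then have "connected ((\<lambda>t. comp_op (\<Phi> t)) ` {0..1})"
    by (rule connected_continuous_image) simp
  moreover have "(\<lambda>t. comp_op (\<Phi> t)) ` {0..1} \<subseteq> comp_ops"
    unfolding comp_ops_def using gh by blast
  moreover have "\<Phi> 0 = \<phi>\<^sub>0" "\<Phi> 1 = \<phi>\<^sub>1" by (auto simp: \<Phi>_def)
  then have "comp_op \<phi>\<^sub>0 \<in> (\<lambda>t. comp_op (\<Phi> t)) ` {0..1}" "comp_op \<phi>\<^sub>1 \<in> (\<lambda>t. comp_op (\<Phi> t)) ` {0..1}"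
    using image_eqI[of "comp_op \<phi>\<^sub>0" "\<lambda>t. comp_op (\<Phi> t)" 0 "{0..1}"]
      image_eqI[of "comp_op \<phi>\<^sub>1" "\<lambda>t. comp_op (\<Phi> t)" 1 "{0..1}"] by auto
  ultimately have "connected_component comp_ops (comp_op \<phi>\<^sub>0) (comp_op \<phi>\<^sub>1)"
    unfolding connected_component_def by blast
  moreover have "compact_operator (comp_op \<phi>\<^sub>0 - comp_op \<phi>\<^sub>1)"
    if o: "\<forall>\<epsilon>>0. \<exists>\<theta>>0. \<forall>s\<in>half_plane 0. gh_min \<phi>\<^sub>0 \<phi>\<^sub>1 s < \<theta> \<longrightarrow>
        cmod (\<phi>\<^sub>0 s - \<phi>\<^sub>1 s) \<le> \<epsilon> * gh_min \<phi>\<^sub>0 \<phi>\<^sub>1 s"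
  proof (rule compact_comp_op_diff[OF s\<^sub>0 s\<^sub>1])
    fix \<epsilon> :: real assume \<epsilon>: "\<epsilon> > 0"
    then obtain \<theta> where \<theta>: "\<theta> > 0"
      and small: "\<And>s. Re s > 0 \<Longrightarrow> m s < \<theta> \<Longrightarrow> cmod (\<phi>\<^sub>0 s - \<phi>\<^sub>1 s) \<le> sqrt \<epsilon> * m s"
      using o[rule_format, of "sqrt \<epsilon>"] by (auto simp: m_def)
    have "(\<theta> \<le> Re (\<phi>\<^sub>0 s) - 1/2 \<and> \<theta> \<le> Re (\<phi>\<^sub>1 s) - 1/2) \<or>
       (cmod (\<phi>\<^sub>0 s - \<phi>\<^sub>1 s))\<^sup>2 \<le> \<epsilon> * (4 * (Re (\<phi>\<^sub>0 s) - 1/2) * (Re (\<phi>\<^sub>1 s) - 1/2))" if s: "Re s > 0" for s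
    proof (cases "m s < \<theta>")
      case True
      have "(cmod (\<phi>\<^sub>0 s - \<phi>\<^sub>1 s))\<^sup>2 \<le> (sqrt \<epsilon> * m s)\<^sup>2"
        by (rule power_mono[OF small[OF s True]]) simp
      also have "\<dots> = \<epsilon> * (1 * (m s * m s))" using \<epsilon> by (simp add: power_mult_distrib) (simp add: power2_eq_square)
      also have "\<dots> \<le> \<epsilon> * (4 * ((Re (\<phi>\<^sub>0 s) - 1/2) * (Re (\<phi>\<^sub>1 s) - 1/2)))"
        using m[OF s] \<epsilon> by (intro mult_left_mono mult_mono) auto
      finally show ?thesis by (simp only: mult.assoc simp_thms)
    qed (use m[OF s] in auto)
    with \<theta> show "\<exists>\<theta>>0. \<forall>s. Re s > 0 \<longrightarrow> (\<theta> \<le> Re (\<phi>\<^sub>0 s) - 1/2 \<and> \<theta> \<le> Re (\<phi>\<^sub>1 s) - 1/2) \<or>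
       (cmod (\<phi>\<^sub>0 s - \<phi>\<^sub>1 s))\<^sup>2 \<le> \<epsilon> * (4 * (Re (\<phi>\<^sub>0 s) - 1/2) * (Re (\<phi>\<^sub>1 s) - 1/2))" by blast
  qed
  ultimately show ?thesis by blast
qed

end
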